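(* In the model of the context let $$f(x)=(1-\theta)+(2\theta-1)(3x^2-2x^3),\qquad \theta\in(1/2,1).$$ If $\frac{1}{1-\alpha-\beta}<3\theta-\tfrac32$, then there is a random variable $\mathbf{Z}_\infty$ such that, almost surely, $$\mathbf{Z}_n\longrightarrow\mathbf{Z}_\infty\qquad\text{and}\qquad\frac1n\sum_{k=1}^n\mathbf{I}_k\longrightarrow\mathbf{Z}_\infty ,$$ and $\mathbf{Z}_\infty$ takes values in the set $\mathcal{SZ}(\mathbf{F})$ of the stable zero points of $\mathbf{F}$, which is contained in $(0,1)^N$. The set $\mathcal{SZ}(\mathbf{F})$ contains at most two points of the form $z\mathbf{1}$. Moreover, any $\mathbf{z}_\infty\in\mathcal{SZ}(\mathbf{F})$ which is not of the form $z\mathbf{1}$ has, up to permutation of its components, the form $\mathbf{z}_\infty=(z_{\infty,1},\dots,z_{\infty,N})^\top$ with $$z_{\infty,h}=\begin{cases}\tilde z_{\infty,1}\in(0,x_1^* ) & \text{for } h=1,\dots,N_1,\\ \tilde z_{\infty,2}\in(x_2^*,1)&\text{for } h=N_1+1,\dots,N,\end{cases}$$ for some $N_1\in\{1,\dots,N-1\}$, where $x_1^*\in(0,1/2)$ and $x_2^*=1-x_1^*\in(1/2,1)$ are the solutions of $f'=1/(1-\alpha-\beta)$.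
   Context: Model. Let $N\ge 2$, $\alpha,\beta\in[0,1)$ with $\alpha+\beta\in(0,1)$, $q\in(0,1]$, and let $f:[0,1]\to[0,1]$ be the given strictly increasing $\mathcal{C}^1$ function. Let $(r_n)_{n\ge0}$ be a deterministic sequence in $[0,1]$ with $\lim_{n\to\infty} n r_n=1$. Let $Z_{0,h}$, $1\le h\le N$, be random variables with values in $[0,1]$. For $n\ge 0$ and $1\le h\le N$ set $Z_{n+1,h}=(1-r_n)Z_{n,h}+r_nI_{n+1,h}$, where the $I_{n+1,h}$ take values in $\{0,1\}$ and, given $\mathcal{F}_n=\sigma(Z_{0,h}:1\le h\le N)\vee\sigma(I_{k,h}:1\le k\le n,\,1\le h\le N)$, the variables $I_{n+1,1},\dots,I_{n+1,N}$ are conditionally independent with $$P(I_{n+1,h}=1\mid\mathcal{F}_n)=\alpha Z_n+\beta q+(1-\alpha-\beta)f(Z_{n,h}),\qquad Z_n=\frac1N\sum_{i=1}^N Z_{n,i}.$$ Write $\mathbf{Z}_n=(Z_{n,1},\dots,Z_{n,N})^\top$, $\mathbf{I}_n=(I_{n,1},\dots,I_{n,N})^\top$, and let $\mathbf{1}$ be the vector with all components equal to $1$. Define $\mathbf{F}=(F_1,\dots,F_N)^\top$ on $[0,1]^N$ by $$F_h(\mathbf{z})=\alpha\frac1N\sum_{i=1}^Nz_i+\beta q+(1-\alpha-\beta)f(z_h)-z_h .$$ A zero point of $\mathbf{F}$ is a $\mathbf{z}\in[0,1]^N$ with $\mathbf{F}(\mathbf{z})=\mathbf{0}$; it is stable if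 all eigenvalues of the Jacobian matrix of $\mathbf{F}$ at $\mathbf{z}$ (a symmetric matrix) are $\le 0$.
   Formalization: When α=0 the two component values may also equal the endpoints x_1^* and x_2^*, since the strict inclusions fail there if x_1^* or x_2^* is a double zero of βq+(1-β)f(x)-x; for α>0 the claim is unchanged. *)

theory Defs
  imports "HOL-Probability.Probability"
begin

(* A regular conditional probability is not needed: P(A | F) is a version of the
   conditional expectation of the indicator, so equations about it hold only a.e. *)
definition cond_probability :: "'a measure \<Rightarrow> 'a measure \<Rightarrow> 'a set \<Rightarrow> 'a \<Rightarrow> real" where
  "cond_probability M F A = real_cond_exp M F (indicator A)"

definition cond_indep_vars ::
  "'a measure \<Rightarrow> 'a measure \<Rightarrow> ('i \<Rightarrow> 'b measure) \<Rightarrow> ('i \<Rightarrow> 'a \<Rightarrow> 'b) \<Rightarrow> 'i set \<Rightarrow> bool" where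
  "cond_indep_vars M F N X J \<longleftrightarrow>
     (\<forall>j\<in>J. X j \<in> measurable M (N j)) \<and>
     (\<forall>K\<subseteq>J. finite K \<longrightarrow> K \<noteq> {} \<longrightarrow> (\<forall>A. (\<forall>j\<in>K. A j \<in> sets (N j)) \<longrightarrow>
        (AE \<omega> in M. cond_probability M F (\<Inter>j\<in>K. X j -` A j \<inter> space M) \<omega>
                   = (\<Prod>j\<in>K. cond_probability M F (X j -` A j \<inter> space M) \<omega>))))"

(* The sigma-algebra F_n generated by the Z_{0,h} and by the I_{k,h} with 1 <= k <= n. *)
definition history ::
  "'a measure \<Rightarrow> ('a \<Rightarrow> real^'n) \<Rightarrow> (nat \<Rightarrow> 'a \<Rightarrow> real^'n) \<Rightarrow> nat \<Rightarrow> 'a measure" where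
  "history M Z0 I n = sigma (space M)
     ({(\<lambda>\<omega>. Z0 \<omega> $ h) -` A \<inter> space M | h A. A \<in> sets borel} \<union>
      {(\<lambda>\<omega>. I k \<omega> $ h) -` A \<inter> space M | k h A. k \<in> {1..n} \<and> A \<in> sets borel})"

definition comp_mean :: "real^'n \<Rightarrow> real" where
  "comp_mean z = (1 / real CARD('n)) * (\<Sum>i\<in>UNIV. z $ i)"

(* The index set {1,...,N} is the finite type 'n, so that N = CARD('n).
   The value of I at time 0 is junk and is never constrained. *)
locale reinforced_system = prob_space M for M :: "'a measure" +
  fixes \<alpha> \<beta> q :: real
    and f :: "real \<Rightarrow> real"
    and r :: "nat \<Rightarrow> real"
    and Z I :: "nat \<Rightarrow> 'a \<Rightarrow> real^'n"
  assumes N_ge_2: "CARD('n) \<ge> 2"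
    and alpha: "\<alpha> \<in> {0..<1}"
    and beta: "\<beta> \<in> {0..<1}"
    and alpha_beta: "\<alpha> + \<beta> \<in> {0<..<1}"
    and q: "q \<in> {0<..1}"
    and f_range: "f ` {0..1} \<subseteq> {0..1}"
    and f_strict_mono: "strict_mono_on {0..1} f"
    and f_C1: "\<exists>f'. continuous_on {0..1} f' \<and>
                 (\<forall>x\<in>{0..1}. (f has_real_derivative f' x) (at x within {0..1}))"
    and r_range: "\<And>n. r n \<in> {0..1}"
    and r_lim: "(\<lambda>n. real n * r n) \<longlonglongrightarrow> 1"
    and Z0_measurable: "\<And>h. (\<lambda>\<omega>. Z 0 \<omega> $ h) \<in> borel_measurable M"
    and Z0_range: "\<And>h \<omega>. \<omega> \<in> space M \<Longrightarrow> Z 0 \<omega> $ h \<in> {0..1}"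
    and I_measurable: "\<And>n h. (\<lambda>\<omega>. I (Suc n) \<omega> $ h) \<in> borel_measurable M"
    and I_range: "\<And>n h \<omega>. \<omega> \<in> space M \<Longrightarrow> I (Suc n) \<omega> $ h \<in> {0, 1}"
    and Z_Suc: "\<And>n h \<omega>. \<omega> \<in> space M \<Longrightarrow>
                  Z (Suc n) \<omega> $ h = (1 - r n) * Z n \<omega> $ h + r n * I (Suc n) \<omega> $ h"
    and I_cond_indep: "\<And>n. cond_indep_vars M (history M (Z 0) I n)
                              (\<lambda>_. borel) (\<lambda>h \<omega>. I (Suc n) \<omega> $ h) UNIV"
    and I_cond_prob: "\<And>n h. AE \<omega> in M.
                  cond_probability M (history M (Z 0) I n) {\<omega>' \<in> space M. I (Suc n) \<omega>' $ h = 1} \<omega>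
                  = \<alpha> * comp_mean (Z n \<omega>) + \<beta> * q + (1 - \<alpha> - \<beta>) * f (Z n \<omega> $ h)"

definition drift :: "real \<Rightarrow> real \<Rightarrow> real \<Rightarrow> (real \<Rightarrow> real) \<Rightarrow> real^'n \<Rightarrow> real^'n" where
  "drift \<alpha> \<beta> q f z =
     (\<chi> h. \<alpha> * comp_mean z + \<beta> * q + (1 - \<alpha> - \<beta>) * f (z $ h) - z $ h)"

definition is_eigenvalue :: "real^'n^'n \<Rightarrow> real \<Rightarrow> bool" where
  "is_eigenvalue A c \<longleftrightarrow> (\<exists>v. v \<noteq> 0 \<and> A *v v = c *\<^sub>R v)"

(* cbox 0 1 is the cube [0,1]^N and box 0 1 is (0,1)^N. Since the vector field lives on
   the closed cube, its Jacobian is taken within the cube. That matrix is symmetric for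
   the drift above, so its eigenvalues are the real ones. *)
definition stable_zeros :: "(real^'n \<Rightarrow> real^'n) \<Rightarrow> (real^'n) set" where
  "stable_zeros F = {z \<in> cbox 0 1. F z = 0 \<and>
     (\<forall>c. is_eigenvalue (jacobian F (at z within cbox 0 1)) c \<longrightarrow> c \<le> 0)}"

definition f_theta :: "real \<Rightarrow> real \<Rightarrow> real" where
  "f_theta \<theta> x = (1 - \<theta>) + (2 * \<theta> - 1) * (3 * x^2 - 2 * x^3)"

end

theory Submission
  imports Defs
begin

text \<open>The drift is the gradient of a quartic potential \<open>W\<close>, so \<open>E (W (Z\<^sub>n))\<close> increases up to
  \<open>O(r\<^sub>n\<^sup>2)\<close> and \<open>\<Sum> r\<^sub>n |F (Z\<^sub>n)|\<^sup>2\<close> is almost surely finite. As \<open>\<Sum> r\<^sub>n (I\<^sub>n\<^sub>+\<^sub>1 - E (I\<^sub>n\<^sub>+\<^sub>1 | history))\<close>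
  converges almost surely, every limit point of a trajectory is a zero of \<open>F\<close>; there are finitely many
  zeros, hence the trajectory converges.

  To exclude an unstable zero, which may be degenerate, no center-stable manifold is used: the system is
  cooperative, so two copies of the process started at the same point can be coupled monotonically, the
  second one with success probabilities raised by small tilts. The gap between them, weighted by the
  absolute values of an unstable eigenvector, grows exponentially in \<open>ln n\<close> with probability bounded
  below, so one of the copies leaves the neighbourhood; the tilts are square summable,
  so the law of the second copy has a square integrable density with respect to the untilted one. Hence
  from every late time the probability to stay near the zero is at most \<open>1 - \<epsilon>\<close>.\<close>

section \<open>Monotone coupling in an expanding region\<close>

text \<open>The Jacobian at an unstable zero may also have zero eigenvalues, so no hyperbolic
  splitting is at hand. For ordered copies the difference is a nonnegative vector, and pairing it
  with a suitable nonnegative weight turns instability into the growth of a single scalar. Two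
  copies started at one point have gap zero, however, so the tilts must first create a gap. The
  noise after time n moves the discounted gap by about n^(-1/2); tilts of that order acting over
  about n steps create a mean gap of the same size, while their squares sum to a constant. The price
  of the change of law is then a factor independent of n, which makes the escape probability uniform
  in the starting time and point. The randomness enters through success probabilities bounded away
  from 0 and 1, which keep the density square integrable.\<close>

definition flips :: "('n::finite \<Rightarrow> real) \<Rightarrow> ('n \<Rightarrow> bool) pmf" where
  "flips p = Pi_pmf UNIV False (\<lambda>h. bernoulli_pmf (p h))"

lemma pmf_flips:
  fixes p :: "'n::finite \<Rightarrow> real"
  assumes "\<And>h. p h \<in> {0..1}"
  shows "pmf (flips p) i = (\<Prod>h\<in>UNIV. if i h then p h else 1 - p h)"
  unfolding flips_def
  by (subst pmf_Pi') (use assms in \<open>auto intro!: prod.cong simp: pmf_bernoulli_True pmf_bernoulli_False split: if_splits\<close>)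

lemma expectation_finite_type:
  fixes \<phi> :: "'b::finite \<Rightarrow> real"
  shows "measure_pmf.expectation p \<phi> = (\<Sum>i\<in>UNIV. pmf p i * \<phi> i)"
  by (subst integral_measure_pmf_real[of UNIV]) (auto simp: mult.commute)

lemma integrable_finite_type [simp]:
  fixes \<phi> :: "'b::finite \<Rightarrow> real"
  shows "integrable (measure_pmf p) \<phi>"
  by (rule integrable_measure_pmf_finite) simp

lemma expectation_flips_component:
  fixes p :: "'n::finite \<Rightarrow> real"
  assumes "p h \<in> {0..1}"
  shows "measure_pmf.expectation (flips p) (\<lambda>i. of_bool (i h) :: real) = p h"
proof -
  have "measure_pmf.expectation (flips p) (\<lambda>i. of_bool (i h) :: real) =
        measure_pmf.expectation (map_pmf (\<lambda>i. i h) (flips p)) (of_bool :: bool \<Rightarrow> real)"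
    by simp
  also have "map_pmf (\<lambda>i. i h) (flips p) = bernoulli_pmf (p h)"
    unfolding flips_def by (subst Pi_pmf_component) auto
  also have "measure_pmf.expectation (bernoulli_pmf (p h)) (of_bool :: bool \<Rightarrow> real) = p h"
    using assms by (subst integral_bernoulli_pmf) auto
  finally show ?thesis .
qed

text \<open>The sum is the second moment, under the law with parameters \<open>p\<close>, of the
  density of the law with parameters \<open>q\<close>. Exchanging the sum over configurations with
  the product over coordinates leaves one factor per coordinate: 1 plus the chi-square divergence of
  two Bernoulli laws.\<close>

lemma sum_flips_squared_ratio:
  fixes p q :: "'n::finite \<Rightarrow> real"
  assumes p: "\<And>h. p h \<in> {0<..<1}"
  shows "(\<Sum>i\<in>UNIV. (\<Prod>h\<in>UNIV. if i h then q h else 1 - q h)\<^sup>2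
             / (\<Prod>h\<in>UNIV. if i h then p h else 1 - p h))
       = (\<Prod>h\<in>UNIV. 1 + (q h - p h)\<^sup>2 / (p h * (1 - p h)))"
proof -
  have "(\<Prod>h\<in>UNIV. 1 + (q h - p h)\<^sup>2 / (p h * (1 - p h))) =
        (\<Prod>h\<in>UNIV. \<Sum>b\<in>UNIV. if b then (q h)\<^sup>2 / p h else (1 - q h)\<^sup>2 / (1 - p h))"
  proof (rule prod.cong[OF refl])
    fix h
    have "p h > 0" "1 - p h > 0" using p[of h] by auto
    then show "1 + (q h - p h)\<^sup>2 / (p h * (1 - p h)) =
          (\<Sum>b\<in>UNIV. if b then (q h)\<^sup>2 / p h else (1 - q h)\<^sup>2 / (1 - p h))"
      by (simp add: UNIV_bool field_simps power2_eq_square)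
  qed
  also have "\<dots> = (\<Sum>i\<in>PiE UNIV (\<lambda>_. UNIV). \<Prod>h\<in>UNIV.
      if i h then (q h)\<^sup>2 / p h else (1 - q h)\<^sup>2 / (1 - p h))"
    by (subst prod_sum_PiE) auto
  also have "PiE UNIV (\<lambda>_. UNIV) = (UNIV :: ('n \<Rightarrow> bool) set)" by auto
  also have "(\<Sum>i\<in>(UNIV :: ('n \<Rightarrow> bool) set). \<Prod>h\<in>UNIV.
      if i h then (q h)\<^sup>2 / p h else (1 - q h)\<^sup>2 / (1 - p h)) =
     (\<Sum>i\<in>UNIV. (\<Prod>h\<in>UNIV. if i h then q h else 1 - q h)\<^sup>2
             / (\<Prod>h\<in>UNIV. if i h then p h else 1 - p h))"
    by (intro sum.cong refl, subst prod_power_distrib, subst prod_dividef[symmetric], rule prod.cong) auto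
  finally show ?thesis by simp
qed

text \<open>Change of law by Cauchy-Schwarz: the second moment of the density is at most exp (N t^2
  / c^2) because each p (1 - p) is at least c^2. The bound t \<le> c keeps the shifted parameters in
  [0,1].\<close>

lemma expectation_flips_shift_le:
  fixes p :: "'n::finite \<Rightarrow> real" and t :: real
  assumes c: "c > 0" and p: "\<And>h. p h \<in> {c..1 - c}" and t: "t \<in> {0..c}"
  shows "(measure_pmf.expectation (flips (\<lambda>h. p h + t)) \<phi>)\<^sup>2
         \<le> exp (CARD('n) * t\<^sup>2 / c\<^sup>2) * measure_pmf.expectation (flips p) (\<lambda>i. (\<phi> i)\<^sup>2)"
proof -
  let ?P = "pmf (flips p)" and ?Q = "pmf (flips (\<lambda>h. p h + t))"
  have p01: "p h \<in> {0<..<1}" "p h \<in> {0..1}" "p h + t \<in> {0..1}" for h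
    using p[of h] c t by auto
  have P: "?P i = (\<Prod>h\<in>UNIV. if i h then p h else 1 - p h)" for i
    using p01 by (intro pmf_flips) auto
  have Q: "?Q i = (\<Prod>h\<in>UNIV. if i h then p h + t else 1 - (p h + t))" for i
    using p01 by (intro pmf_flips) auto
  have Ppos: "?P i > 0" for i
    unfolding P by (intro prod_pos) (use p01 in auto)
  have "(measure_pmf.expectation (flips (\<lambda>h. p h + t)) \<phi>)\<^sup>2
      = (\<Sum>i\<in>UNIV. (?Q i / sqrt (?P i)) * (sqrt (?P i) * \<phi> i))\<^sup>2"
    unfolding expectation_finite_type using Ppos
    by (intro arg_cong[where f="\<lambda>x. x\<^sup>2"] sum.cong) (auto simp: less_imp_neq[symmetric])
  also have "\<dots> \<le> (\<Sum>i\<in>UNIV. (?Q i / sqrt (?P i))\<^sup>2) * (\<Sum>i\<in>UNIV. (sqrt (?P i) * \<phi> i)\<^sup>2)"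
    by (rule Cauchy_Schwarz_ineq_sum)
  also have "(\<Sum>i\<in>UNIV. (sqrt (?P i) * \<phi> i)\<^sup>2) = measure_pmf.expectation (flips p) (\<lambda>i. (\<phi> i)\<^sup>2)"
    unfolding expectation_finite_type by (simp add: power_mult_distrib)
  also have "(\<Sum>i\<in>UNIV. (?Q i / sqrt (?P i))\<^sup>2) = (\<Sum>i\<in>UNIV. (?Q i)\<^sup>2 / ?P i)"
    by (simp add: power_divide)
  also have "\<dots> = (\<Prod>h\<in>UNIV. 1 + (p h + t - p h)\<^sup>2 / (p h * (1 - p h)))"
    unfolding P Q by (rule sum_flips_squared_ratio) (rule p01)
  also have "\<dots> \<le> (\<Prod>h\<in>(UNIV::'n set). exp (t\<^sup>2 / c\<^sup>2))"
  proof (rule prod_mono, safe)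
    fix h
    have "c\<^sup>2 \<le> p h * (1 - p h)"
      unfolding power2_eq_square using p[of h] c by (intro mult_mono) auto
    moreover have "0 < c\<^sup>2" using c by simp
    ultimately have "t\<^sup>2 / (p h * (1 - p h)) \<le> t\<^sup>2 / c\<^sup>2"
      using p01[of h] by (intro divide_left_mono mult_pos_pos) auto
    also have "1 + \<dots> \<le> exp (t\<^sup>2 / c\<^sup>2)" by (rule exp_ge_add_one_self)
    finally show "1 + (p h + t - p h)\<^sup>2 / (p h * (1 - p h)) \<le> exp (t\<^sup>2 / c\<^sup>2)" by simp
    show "0 \<le> 1 + (p h + t - p h)\<^sup>2 / (p h * (1 - p h))"
      using p01[of h] by (intro add_nonneg_nonneg divide_nonneg_nonneg mult_nonneg_nonneg) auto
  qed
  also have "\<dots> = exp (CARD('n) * t\<^sup>2 / c\<^sup>2)"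
    by (simp add: exp_of_nat_mult[symmetric])
  finally show ?thesis
    by (simp add: mult_right_mono integral_nonneg_AE)
qed

text \<open>Every success of the first vector is kept, and every failure is turned into a success
  independently with probability s = (p' - p) / (1 - p), so that p + (1 - p) s = p'.\<close>

lemma flips_monotone_coupling:
  fixes p p' :: "'n::finite \<Rightarrow> real"
  assumes p: "\<And>h. 0 \<le> p h" "\<And>h. p h \<le> p' h" "\<And>h. p' h \<le> 1" "\<And>h. p h < 1"
  obtains J where "map_pmf fst J = flips p" "map_pmf snd J = flips p'"
    and "\<And>i i' h. (i, i') \<in> set_pmf J \<Longrightarrow> i h \<Longrightarrow> i' h"
proof
  define s where "s = (\<lambda>h. (p' h - p h) / (1 - p h))"
  have s: "s h \<in> {0..1}" "p h + (1 - p h) * s h = p' h" for h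
    using p(1-4)[of h] unfolding s_def by (auto simp: divide_simps)
  define R where "R = (\<lambda>i :: 'n \<Rightarrow> bool. Pi_pmf UNIV False (\<lambda>h. if i h then return_pmf True else bernoulli_pmf (s h)))"
  have one: "bernoulli_pmf (p' h) = bind_pmf (bernoulli_pmf (p h)) (\<lambda>a. if a then return_pmf True else bernoulli_pmf (s h))" for h
  proof (rule pmf_eqI)
    fix b
    have "p h \<in> {0..1}" "p' h \<in> {0..1}" using p(1-4)[of h] by auto
    then show "pmf (bernoulli_pmf (p' h)) b = pmf (bind_pmf (bernoulli_pmf (p h)) (\<lambda>a. if a then return_pmf True else bernoulli_pmf (s h))) b"
      using s[of h] by (cases b) (auto simp: pmf_bind algebra_simps)
  qed
  define J where "J = bind_pmf (flips p) (\<lambda>i. map_pmf (Pair i) (R i))"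
  show "map_pmf fst J = flips p"
    unfolding J_def by (simp add: map_bind_pmf pmf.map_comp o_def bind_return_pmf')
  have "map_pmf snd J = bind_pmf (flips p) R"
    unfolding J_def by (simp add: map_bind_pmf pmf.map_comp o_def)
  also have "\<dots> = flips p'"
    unfolding flips_def R_def one by (subst Pi_pmf_bind[where d' = False]) auto
  finally show "map_pmf snd J = flips p'" .
  show "i' h" if "(i, i') \<in> set_pmf J" "i h" for i i' h
  proof -
    have "i' \<in> set_pmf (R i)"
      using that(1) unfolding J_def by auto
    then have "i' h \<in> set_pmf (if i h then return_pmf True else bernoulli_pmf (s h))"
      unfolding R_def by (simp add: set_Pi_pmf PiE_dflt_def)
    then show ?thesis using that(2) by simp
  qed
qed

section \<open>Step sizes asymptotic to 1/n\<close>

lemma asymp_inverse_bounds: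
  fixes r :: "nat \<Rightarrow> real"
  assumes "(\<lambda>n. real n * r n) \<longlonglongrightarrow> 1"
  obtains n1 where "n1 \<ge> 1" "\<And>n. n \<ge> n1 \<Longrightarrow> r n \<in> {1 / (2 * n)..2 / n}"
proof -
  have "eventually (\<lambda>n. real n * r n \<in> {1/2<..<2}) sequentially"
    using assms by (rule topological_tendstoD) auto
  then obtain n1 where "\<And>n. n \<ge> n1 \<Longrightarrow> real n * r n \<in> {1/2<..<2}"
    unfolding eventually_sequentially by blast
  then show thesis
    by (intro that[of "max 1 n1"]) (auto simp: field_simps less_imp_le)
qed

lemma not_summable_if_asymp_inverse:
  fixes r :: "nat \<Rightarrow> real"
  assumes "(\<lambda>n. real n * r n) \<longlonglongrightarrow> 1"
  shows "\<not> summable r"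
proof
  assume "summable r"
  then have "summable (\<lambda>n. 2 * r n)" by (rule summable_mult)
  moreover obtain n1 where n1: "n1 \<ge> 1" "\<And>n. n \<ge> n1 \<Longrightarrow> r n \<in> {1 / (2 * n)..2 / n}"
    using asymp_inverse_bounds[OF assms] by blast
  have "eventually (\<lambda>n. norm (inverse (real n)) \<le> 2 * r n) sequentially"
    unfolding eventually_sequentially using n1 by (intro exI[of _ n1]) (auto simp: field_simps)
  ultimately have "summable (\<lambda>n. inverse (real n))"
    by (rule summable_comparison_test_ev[rotated])
  then show False using not_summable_harmonic[where ?'a = real] by simp
qed

definition urn_step :: "real \<Rightarrow> real^'n \<Rightarrow> ('n \<Rightarrow> bool) \<Rightarrow> real^'n" where
  "urn_step a z i = (\<chi> h. (1 - a) * z $ h + a * of_bool (i h))"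

text \<open>The probability to be in \<open>U\<close> at the times \<open>k, \<dots>, k + j\<close> for the process that is in \<open>z\<close> at time
  \<open>k\<close> and whose success probabilities at time \<open>l\<close> are raised by \<open>t l\<close>.\<close>

primrec stay_prob :: "(real^'n \<Rightarrow> 'n \<Rightarrow> real) \<Rightarrow> (nat \<Rightarrow> real) \<Rightarrow> (real^'n) set \<Rightarrow> (nat \<Rightarrow> real)
    \<Rightarrow> nat \<Rightarrow> nat \<Rightarrow> real^'n \<Rightarrow> real" where
  "stay_prob p r U t 0 k z = indicator U z"
| "stay_prob p r U t (Suc j) k z = indicator U z *
     measure_pmf.expectation (flips (\<lambda>h. p z h + t k))
       (\<lambda>i. stay_prob p r U t j (Suc k) (urn_step (r k) z i))"

lemma stay_prob_bounds: "stay_prob p r U t j k z \<in> {0..1}"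
proof (induction j arbitrary: k z)
  case (Suc j)
  have "measure_pmf.expectation (flips (\<lambda>h. p z h + t k))
       (\<lambda>i. stay_prob p r U t j (Suc k) (urn_step (r k) z i)) \<in> {0..1}"
    using Suc by (auto intro!: integral_nonneg_AE measure_pmf.integral_le_const)
  then show ?case by (auto simp: indicator_def)
qed (auto simp: indicator_def)

lemma stay_prob_outside: "z \<notin> U \<Longrightarrow> stay_prob p r U t j k z = 0"
  by (cases j) auto

text \<open>The hypotheses isolate what the coupling uses: \<open>p_mono\<close> preserves the order
  of two copies, \<open>p_range\<close> controls the density of a tilted law, and
  \<open>expanding\<close> says that the drift p z - z increases the \<open>v\<close>-weighted gap
  of an ordered pair at rate at least \<mu>.\<close>

locale expanding_urn =
  fixes p :: "real^'n \<Rightarrow> 'n \<Rightarrow> real" and r :: "nat \<Rightarrow> real" and U :: "(real^'n) set"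
    and v :: "'n \<Rightarrow> real" and \<mu> c :: real
  assumes U_cube: "\<And>z h. z \<in> U \<Longrightarrow> z $ h \<in> {0..1}"
    and c_pos: "c > 0"
    and p_range: "\<And>z h. z \<in> U \<Longrightarrow> p z h \<in> {c..1 - c}"
    and p_mono: "\<And>z z' h. z \<in> U \<Longrightarrow> z' \<in> U \<Longrightarrow> (\<And>h. z $ h \<le> z' $ h) \<Longrightarrow> p z h \<le> p z' h"
    and \<mu>_pos: "\<mu> > 0"
    and v_nonneg: "\<And>h. v h \<ge> 0"
    and v_sum: "(\<Sum>h\<in>UNIV. v h) = 1"
    and expanding: "\<And>z z'. z \<in> U \<Longrightarrow> z' \<in> U \<Longrightarrow> (\<And>h. z $ h \<le> z' $ h) \<Longrightarrow>
       (\<Sum>h\<in>UNIV. v h * (p z' h - p z h)) \<ge> (1 + \<mu>) * (\<Sum>h\<in>UNIV. v h * (z' $ h - z $ h))"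
    and r01: "\<And>n. r n \<in> {0..1}"
begin

abbreviation "stay \<equiv> stay_prob p r U"

text \<open>The square on the left and the first power on the right let the one-step bound iterate:
  Cauchy-Schwarz produces the squared exit probability of the remaining path, to which the induction
  hypothesis applies. A tilted exit probability y thus forces an untilted one of at least a constant
  times y^2.\<close>

lemma stay_shift_lower_bound:
  assumes "\<And>l. k \<le> l \<Longrightarrow> l < k + j \<Longrightarrow> t l \<in> {0..c}"
  shows "(1 - stay t j k z)\<^sup>2
    \<le> exp (CARD('n) / c\<^sup>2 * (\<Sum>l=k..<k+j. (t l)\<^sup>2)) * (1 - stay (\<lambda>_. 0) j k z)"
  using assms
proof (induction j arbitrary: k z)
  case 0
  then show ?case by (auto simp: indicator_def)
next
  case (Suc j)
  let ?E = "exp (CARD('n) / c\<^sup>2 * (\<Sum>l=Suc k..<Suc k+j. (t l)\<^sup>2))"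
  let ?A = "exp (CARD('n) * (t k)\<^sup>2 / c\<^sup>2)"
  have EA: "exp (CARD('n) / c\<^sup>2 * (\<Sum>l=k..<k+Suc j. (t l)\<^sup>2)) = ?A * ?E"
  proof -
    have "(\<Sum>l=k..<k+Suc j. (t l)\<^sup>2) = (t k)\<^sup>2 + (\<Sum>l=Suc k..<Suc k+j. (t l)\<^sup>2)"
      by (subst sum.atLeast_Suc_lessThan) auto
    then show ?thesis
      by (simp only: exp_add[symmetric]) (simp add: add_divide_distrib ring_distribs)
  qed
  show ?case
  proof (cases "z \<in> U")
    case False
    then show ?thesis
      unfolding EA using c_pos
      by (simp add: stay_prob_outside exp_add[symmetric] sum_nonneg del: stay_prob.simps exp_add)
  next
    case True
    let ?\<phi> = "\<lambda>i. 1 - stay t j (Suc k) (urn_step (r k) z i)"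
    let ?\<psi> = "\<lambda>i. 1 - stay (\<lambda>_. 0) j (Suc k) (urn_step (r k) z i)"
    have "(1 - stay t (Suc j) k z)\<^sup>2 = (measure_pmf.expectation (flips (\<lambda>h. p z h + t k)) ?\<phi>)\<^sup>2"
      using True by simp
    also have "\<dots> \<le> ?A * measure_pmf.expectation (flips (p z)) (\<lambda>i. (?\<phi> i)\<^sup>2)"
      using Suc.prems[of k] c_pos p_range[OF True] by (intro expectation_flips_shift_le) auto
    also have "\<dots> \<le> ?A * measure_pmf.expectation (flips (p z)) (\<lambda>i. ?E * ?\<psi> i)"
      using Suc.prems by (intro mult_left_mono integral_mono Suc.IH) auto
    also have "\<dots> = ?A * ?E * (1 - stay (\<lambda>_. 0) (Suc j) k z)"
      using True by simp
    finally show ?thesis unfolding EA .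
  qed
qed


definition gap :: "real^'n \<Rightarrow> real^'n \<Rightarrow> real" where
  "gap z z' = (\<Sum>h\<in>UNIV. v h * (z' $ h - z $ h))"

definition growth :: "nat \<Rightarrow> nat \<Rightarrow> real" where
  "growth n k = (\<Prod>l=n..<k. 1 + \<mu> * r l)"

text \<open>A unit tilt at time \<open>l\<close> raises the mean gap at time \<open>Suc l\<close> by
  \<open>r l\<close>; dividing by the growth since \<open>n\<close> expresses this in units of time
  \<open>n\<close>. By Cauchy-Schwarz, tilts proportional to \<open>weight\<close> have the largest
  total effect for a given sum of squares.\<close>

definition weight :: "nat \<Rightarrow> nat \<Rightarrow> real" where
  "weight n l = r l / growth n (Suc l)"

lemma growth_ge_1: "growth n k \<ge> 1"
  unfolding growth_def using r01 \<mu>_pos by (intro prod_ge_1) (simp add: atLeastAtMost_iff)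

lemma growth_Suc: "n \<le> k \<Longrightarrow> growth n (Suc k) = growth n k * (1 + \<mu> * r k)"
  unfolding growth_def by (simp add: prod.nat_ivl_Suc')

lemma weight_bounds: "weight n k \<in> {0..r k}" 
  unfolding weight_def using growth_ge_1[of n "Suc k"] r01[of k]
  by (auto simp: divide_simps intro: mult_right_le_one_le)
     (metis mult.right_neutral mult_left_mono)

lemma gap_bounds:
  assumes "z \<in> U" "z' \<in> U" "\<And>h. z $ h \<le> z' $ h"
  shows "gap z z' \<in> {0..1}"
proof -
  have "gap z z' \<le> (\<Sum>h\<in>UNIV. v h * 1)"
    unfolding gap_def
  proof (intro sum_mono mult_left_mono v_nonneg)
    show "z' $ h - z $ h \<le> 1" for h using U_cube[of z h] U_cube[of z' h] assms by auto
  qed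
  moreover have "gap z z' \<ge> 0"
    unfolding gap_def using assms v_nonneg by (intro sum_nonneg mult_nonneg_nonneg) auto
  ultimately show ?thesis using v_sum by simp
qed

text \<open>Chebyshev's inequality for the coupled pair, by backward induction: \<open>gap / growth\<close> minus the
  accumulated tilt \<open>S\<close> is a submartingale with increments bounded by \<open>(2 + \<mu>) weight\<close>, while the gap
  never exceeds 1 inside \<open>U\<close>.\<close>

lemma coupled_stay_le:
  fixes n :: nat and b :: real
  defines "t \<equiv> \<lambda>l. b * weight n l" and "S \<equiv> \<lambda>k. b * (\<Sum>l=n..<k. (weight n l)\<^sup>2)"
  assumes b: "b \<ge> 0" and "n \<le> k" and tc: "\<And>l. k \<le> l \<Longrightarrow> l < k + j \<Longrightarrow> t l \<le> c"
    and final: "1 / growth n (k + j) \<le> S (k + j) / 2"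
    and le: "\<And>h. z $ h \<le> z' $ h"
  shows "stay (\<lambda>_. 0) j k z + stay t j k z' - 1 \<le> 4 / (S (k + j))\<^sup>2 *
    ((max 0 (S k - gap z z' / growth n k))\<^sup>2 + (2 + \<mu>)\<^sup>2 * (\<Sum>l=k..<k+j. (weight n l)\<^sup>2))"
  using assms(4-)
\<comment> \<open>The left side bounds from below the probability that both copies stay in
  \<open>U\<close>. It involves only the two marginal laws, so the coupling can be chosen anew in
  each step and no joint process has to be built.\<close>
proof (induction j arbitrary: k z z')
  case 0
  let ?w = "growth n k"
  have w: "?w \<ge> 1" by (rule growth_ge_1)
  have S: "S k > 0" using 0 w by (auto intro: order.strict_trans2[of 0 "2 / ?w"])
  show ?case
  proof (cases "z \<in> U \<and> z' \<in> U")
    case True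
    \<comment> \<open>If both endpoints are in \<open>U\<close>, the gap is at most 1, so by
      \<open>final\<close> it falls short of \<open>S\<close> by at least S/2 and the right side is
      at least 1.\<close>
    have "gap z z' / ?w \<le> 1 / ?w"
      using gap_bounds[of z z'] True 0 w by (intro divide_right_mono) auto
    moreover have "1 / ?w \<le> S k / 2" using 0 by simp
    ultimately have "S k / 2 \<le> max 0 (S k - gap z z' / ?w)" by linarith
    then have "4 / (S k)\<^sup>2 * (S k / 2)\<^sup>2 \<le> 4 / (S k)\<^sup>2 * (max 0 (S k - gap z z' / ?w))\<^sup>2"
      using S \<open>S k / 2 \<le> max 0 (S k - gap z z' / ?w)\<close>
      by (intro mult_left_mono power_mono) (assumption | simp)+
    moreover have "4 / (S k)\<^sup>2 * (S k / 2)\<^sup>2 = 1" using S by (simp add: power_divide)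
    moreover have "stay (\<lambda>_. 0) 0 k z + stay t 0 k z' - 1 = 1" using True by simp
    ultimately show ?thesis by (simp only: add_0_right less_irrefl not_False_eq_True atLeastLessThan_empty order_refl sum.empty mult_zero_right)
  next
    case False
    have "-1 \<le> 4 * (max 0 (S k - gap z z' / ?w))\<^sup>2 / (S k)\<^sup>2"
      by (rule order_trans[of _ 0]) (simp, intro divide_nonneg_nonneg mult_nonneg_nonneg, auto)
    then show ?thesis using False by (auto simp: indicator_def simp del: zero_le_divide_iff)
  qed
next
  case (Suc j)
  let ?w = "growth n k" and ?w' = "growth n (Suc k)" and ?a = "weight n k"
  define x where "x = S k - gap z z' / ?w"
  define C where "C = 4 / (S (k + Suc j))\<^sup>2"
  define \<sigma> where "\<sigma> = (\<lambda>i. (2 + \<mu>)\<^sup>2 * (\<Sum>l=i..<k+Suc j. (weight n l)\<^sup>2))"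
  have C: "C \<ge> 0" unfolding C_def by simp
  have w: "?w \<ge> 1" "?w' \<ge> 1" by (rule growth_ge_1)+
  have ww: "?w' = ?w * (1 + \<mu> * r k)" using Suc by (intro growth_Suc)
  have SS: "S (Suc k) = S k + b * ?a\<^sup>2"
    unfolding S_def using Suc by (simp add: sum.nat_ivl_Suc' algebra_simps)
  have \<sigma>: "\<sigma> k = (2 + \<mu>)\<^sup>2 * ?a\<^sup>2 + \<sigma> (Suc k)" "\<sigma> k \<ge> 0"
    unfolding \<sigma>_def
    by (subst sum.atLeast_Suc_lessThan) (simp_all add: algebra_simps sum_nonneg)
  have tk: "t k \<in> {0..c}" using b weight_bounds[of n k] Suc.prems(2)[of k] by (auto simp: t_def)
  show ?case
  proof (cases "z \<in> U \<and> z' \<in> U")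
    case False
    have "stay (\<lambda>_. 0) (Suc j) k z \<le> 1" "stay t (Suc j) k z' \<le> 1"
      using stay_prob_bounds by (meson atLeastAtMost_iff)+
    then have "stay (\<lambda>_. 0) (Suc j) k z + stay t (Suc j) k z' - 1 \<le> 0"
      using False stay_prob_outside[of z U] stay_prob_outside[of z' U]
      by (auto simp del: stay_prob.simps)
    also have "0 \<le> C * ((max 0 x)\<^sup>2 + \<sigma> k)" using C \<sigma> by (intro mult_nonneg_nonneg) auto
    finally show ?thesis unfolding C_def x_def \<sigma>_def .
  next
    case True
    have g: "gap z z' \<in> {0..1}" using gap_bounds True Suc.prems(4) by auto
    have "p z h < 1" "0 \<le> p z h" "p z h \<le> p z' h + t k" "p z' h + t k \<le> 1" for h
      using p_range[of z h] p_range[of z' h] p_mono[of z z' h] True Suc.prems(4) tk c_pos by auto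
    then obtain J where J: "map_pmf fst J = flips (p z)" "map_pmf snd J = flips (\<lambda>h. p z' h + t k)"
      "\<And>i i' h. (i, i') \<in> set_pmf J \<Longrightarrow> i h \<Longrightarrow> i' h"
      using flips_monotone_coupling[of "p z" "\<lambda>h. p z' h + t k"] by metis
    let ?E = "measure_pmf.expectation J"
    have E1: "measure_pmf.expectation (flips (p z)) \<phi> = ?E (\<lambda>y. \<phi> (fst y))" for \<phi> :: "_ \<Rightarrow> real"
      unfolding J(1)[symmetric] by simp
    have E2: "measure_pmf.expectation (flips (\<lambda>h. p z' h + t k)) \<phi> = ?E (\<lambda>y. \<phi> (snd y))" for \<phi> :: "_ \<Rightarrow> real"
      unfolding J(2)[symmetric] by simp
    define m where "m = (\<lambda>y :: ('n \<Rightarrow> bool) \<times> ('n \<Rightarrow> bool). \<Sum>h\<in>UNIV. v h * (of_bool (snd y h) - of_bool (fst y h)))"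
    \<comment> \<open>The increment over one step of gap / growth minus the accumulated tilt. Its
      mean would be zero if the expansion had rate exactly \<mu>.\<close>
    define \<delta> where "\<delta> = (\<lambda>y. (r k * m y - (1 + \<mu>) * r k * gap z z') / ?w' - b * ?a\<^sup>2)"
    have gap': "gap (urn_step (r k) z (fst y)) (urn_step (r k) z' (snd y)) = (1 - r k) * gap z z' + r k * m y" for y
      unfolding gap_def urn_step_def m_def
      by (simp add: sum_distrib_left sum.distrib[symmetric] algebra_simps)
    have x': "S (Suc k) - ((1 - r k) * gap z z' + r k * m y) / ?w' = x - \<delta> y" for y
    proof -
      have "gap z z' / ?w = gap z z' * (1 + \<mu> * r k) / ?w'"
        unfolding ww using w r01[of k] \<mu>_pos
        by (metis less_numeral_extra(1) mult_divide_mult_cancel_right mult_eq_0_iff not_one_le_zero w(2) ww)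
      then show ?thesis
        unfolding x_def SS \<delta>_def using w by (simp add: diff_divide_distrib add_divide_distrib algebra_simps)
    qed
    have Efst: "?E (\<lambda>y. of_bool (fst y h)) = p z h" for h
      using \<open>p z h < 1\<close> \<open>0 \<le> p z h\<close>
      by (subst E1[of "\<lambda>i. of_bool (i h)", symmetric]) (simp add: expectation_flips_component)
    have "p z' h + t k \<in> {0..1}" for h
      using order_trans[OF \<open>0 \<le> p z h\<close> \<open>p z h \<le> p z' h + t k\<close>] \<open>p z' h + t k \<le> 1\<close> by simp
    then have Esnd: "?E (\<lambda>y. of_bool (snd y h)) = p z' h + t k" for h
      by (subst E2[of "\<lambda>i. of_bool (i h)", symmetric]) (simp add: expectation_flips_component)
    have Em: "?E m = (\<Sum>h\<in>UNIV. v h * (p z' h + t k - p z h))"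
    proof -
      have "?E m = (\<Sum>h\<in>UNIV. v h * (?E (\<lambda>y. of_bool (snd y h)) - ?E (\<lambda>y. of_bool (fst y h))))"
        unfolding m_def by simp
      also have "\<dots> = (\<Sum>h\<in>UNIV. v h * (p z' h + t k - p z h))"
        by (simp add: Efst Esnd)
      finally show ?thesis .
    qed
    have E\<delta>: "?E \<delta> \<ge> 0"
    proof -
      have "(\<Sum>h\<in>UNIV. v h * (p z' h + t k - p z h)) = (\<Sum>h\<in>UNIV. v h * (p z' h - p z h)) + t k * (\<Sum>h\<in>UNIV. v h)"
        by (simp add: sum_distrib_left sum.distrib[symmetric] algebra_simps)
      also have "\<dots> \<ge> (1 + \<mu>) * gap z z' + t k"
        using expanding[of z z'] True Suc.prems(4) by (auto simp: v_sum gap_def)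
      finally have "r k * ?E m - (1 + \<mu>) * r k * gap z z' \<ge> r k * t k"
      proof -
        assume "(1 + \<mu>) * gap z z' + t k \<le> (\<Sum>h\<in>UNIV. v h * (p z' h + t k - p z h))"
        then have "r k * ((1 + \<mu>) * gap z z' + t k) \<le> r k * ?E m"
          unfolding Em using r01[of k] by (intro mult_left_mono) auto
        then show ?thesis by (simp add: algebra_simps)
      qed
      then have "(r k * ?E m - (1 + \<mu>) * r k * gap z z') / ?w' \<ge> r k * t k / ?w'"
        using w by (intro divide_right_mono) auto
      also have "r k * t k / ?w' = b * ?a\<^sup>2"
        unfolding t_def by (simp add: weight_def power2_eq_square)
      finally show ?thesis unfolding \<delta>_def by simp
    qed
    have \<delta>2: "(\<delta> y)\<^sup>2 \<le> (2 + \<mu>)\<^sup>2 * ?a\<^sup>2" if "y \<in> set_pmf J" for y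
    proof -
      have d: "of_bool (snd y h) - of_bool (fst y h) \<in> {0..1::real}" for h
        using J(3)[of "fst y" "snd y" h] that by auto
      have "v h * (of_bool (snd y h) - of_bool (fst y h)) \<in> {0..v h * 1}" for h
        using mult_left_mono[OF _ v_nonneg[of h], of _ 1] mult_nonneg_nonneg[OF v_nonneg[of h]] d[of h]
        unfolding atLeastAtMost_iff by blast
      then have "m y \<le> (\<Sum>h\<in>UNIV. v h * 1)" "m y \<ge> 0"
        unfolding m_def atLeastAtMost_iff by (intro sum_mono sum_nonneg; blast)+
      then have m: "m y \<le> 1" "m y \<ge> 0" using v_sum by auto
      have ba: "b * ?a \<in> {0..1}"
      proof -
        have "c \<le> 1" using p_range[of z undefined] True c_pos by auto
        then show ?thesis using tk by (auto simp: t_def)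
      qed
      have "\<delta> y = ?a * (m y - (1 + \<mu>) * gap z z' - b * ?a)"
        unfolding \<delta>_def by (simp add: weight_def power2_eq_square algebra_simps diff_divide_distrib add_divide_distrib)
      moreover have "\<bar>m y - (1 + \<mu>) * gap z z' - b * ?a\<bar> \<le> 2 + \<mu>"
      proof -
        have "(1 + \<mu>) * gap z z' \<le> (1 + \<mu>) * 1"
          using g \<mu>_pos by (intro mult_left_mono) auto
        moreover have "(1 + \<mu>) * gap z z' \<ge> 0"
          using g \<mu>_pos by (intro mult_nonneg_nonneg) auto
        moreover have "\<bar>m y - X - b * ?a\<bar> \<le> 2 + \<mu>" if "X \<le> (1 + \<mu>) * 1" "0 \<le> X" for X
          using that m ba \<mu>_pos by auto
        ultimately show ?thesis by blast
      qed
      then have "(m y - (1 + \<mu>) * gap z z' - b * ?a)\<^sup>2 \<le> (2 + \<mu>)\<^sup>2"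
        using \<mu>_pos by (intro abs_le_square_iff[THEN iffD1]) auto
      ultimately show ?thesis
        by (simp add: power_mult_distrib mult.commute[of "(2 + \<mu>)\<^sup>2"] mult_left_mono)
    qed
    have "stay (\<lambda>_. 0) (Suc j) k z + stay t (Suc j) k z' - 1 =
        ?E (\<lambda>y. stay (\<lambda>_. 0) j (Suc k) (urn_step (r k) z (fst y)) + stay t j (Suc k) (urn_step (r k) z' (snd y)) - 1)"
      using True by (simp add: E1 E2)
    also have "\<dots> \<le> ?E (\<lambda>y. C * ((max 0 x)\<^sup>2 - 2 * max 0 x * \<delta> y + \<sigma> k))"
    proof (rule integral_mono_AE)
      show "AE y in measure_pmf J. stay (\<lambda>_. 0) j (Suc k) (urn_step (r k) z (fst y)) +
         stay t j (Suc k) (urn_step (r k) z' (snd y)) - 1 \<le> C * ((max 0 x)\<^sup>2 - 2 * max 0 x * \<delta> y + \<sigma> k)"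
        unfolding AE_measure_pmf_iff
      proof
        fix y assume y: "y \<in> set_pmf J"
        have ord: "urn_step (r k) z (fst y) $ h \<le> urn_step (r k) z' (snd y) $ h" for h
        proof -
          have "(1 - r k) * z $ h \<le> (1 - r k) * z' $ h"
            using r01[of k] Suc.prems(4)[of h] by (intro mult_left_mono) auto
          moreover have "r k * of_bool (fst y h) \<le> r k * of_bool (snd y h)"
            using J(3)[of "fst y" "snd y" h] y r01[of k] by (intro mult_left_mono) auto
          ultimately show ?thesis unfolding urn_step_def by simp
        qed
        have "stay (\<lambda>_. 0) j (Suc k) (urn_step (r k) z (fst y)) +
         stay t j (Suc k) (urn_step (r k) z' (snd y)) - 1 \<le> C * ((max 0 (x - \<delta> y))\<^sup>2 + \<sigma> (Suc k))"
          using Suc.IH[of "Suc k", OF _ _ _ ord] Suc.prems unfolding gap' x'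
          by (simp add: C_def \<sigma>_def)
        \<comment> \<open>Replacing \<open>x\<close> by its positive part cannot decrease the
          square. This dominates the truncated square by a quadratic in \<open>\<delta> y\<close>
          whose linear term has nonpositive mean.\<close>
        also have "(max 0 (x - \<delta> y))\<^sup>2 \<le> (max 0 x)\<^sup>2 - 2 * max 0 x * \<delta> y + (\<delta> y)\<^sup>2"
        proof -
          have "\<bar>max 0 (x - \<delta> y)\<bar> \<le> \<bar>max 0 x - \<delta> y\<bar>" by (auto simp: max_def)
          then have "(max 0 (x - \<delta> y))\<^sup>2 \<le> (max 0 x - \<delta> y)\<^sup>2" by (simp only: abs_le_square_iff)
          then show ?thesis by (simp add: power2_diff algebra_simps)
        qed
        finally show "stay (\<lambda>_. 0) j (Suc k) (urn_step (r k) z (fst y)) +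
         stay t j (Suc k) (urn_step (r k) z' (snd y)) - 1 \<le> C * ((max 0 x)\<^sup>2 - 2 * max 0 x * \<delta> y + \<sigma> k)"
          using \<delta>2[OF y] C \<sigma> by (smt (verit) mult_left_mono)
      qed
    qed auto
    also have "\<dots> = C * ((max 0 x)\<^sup>2 - 2 * max 0 x * ?E \<delta> + \<sigma> k)"
      by simp
    also have "\<dots> \<le> C * ((max 0 x)\<^sup>2 + \<sigma> k)"
      using C E\<delta> by (intro mult_left_mono) auto
    finally show ?thesis unfolding C_def x_def \<sigma>_def .
  qed
qed


section \<open>Uniform escape probability\<close>

lemma growth_ge_sum: "growth n k \<ge> 1 + \<mu> * (\<Sum>l=n..<k. r l)"
proof (induction k)
  case (Suc k)
  show ?case
  proof (cases "n \<le> k")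
    case True
    have "growth n (Suc k) = growth n k + growth n k * (\<mu> * r k)"
      unfolding growth_Suc[OF True] by (simp add: algebra_simps)
    also have "growth n k * (\<mu> * r k) \<ge> 1 * (\<mu> * r k)"
      using growth_ge_1[of n k] r01[of k] \<mu>_pos by (intro mult_right_mono mult_nonneg_nonneg) auto
    ultimately show ?thesis
      using Suc True by (simp add: sum.nat_ivl_Suc' algebra_simps)
  qed (simp add: growth_def)
qed (simp add: growth_def)

lemma growth_le_exp: "growth n k \<le> exp (\<mu> * (\<Sum>l=n..<k. r l))"
proof -
  have "growth n k \<le> (\<Prod>l=n..<k. exp (\<mu> * r l))"
    unfolding growth_def using r01 \<mu>_pos
    by (intro prod_mono conjI add_nonneg_nonneg mult_nonneg_nonneg exp_ge_add_one_self) auto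
  then show ?thesis by (simp add: exp_sum sum_distrib_left)
qed

text \<open>The horizon \<open>j\<close> may depend on \<open>n\<close>, the bound \<epsilon> does
  not. If the untilted and the tilted copy from the same \<open>z\<close> exit with probabilities x
  and y, the coupling gives x + y \<ge> 3/4 and the change of law gives y^2 \<le> E x; together they
  force x \<ge> 1/(16 E).\<close>

theorem stay_le:
  assumes r_lim: "(\<lambda>n. real n * r n) \<longlonglongrightarrow> 1"
  shows "\<exists>\<epsilon>>0. \<exists>n0. \<forall>n\<ge>n0. \<exists>j. \<forall>z\<in>U. stay (\<lambda>_. 0) j n z \<le> 1 - \<epsilon>"
proof -
  \<comment> \<open>\<open>K\<close> will be the sum of the squared tilts; this value makes the
    Chebyshev bound equal to 1/4. \<open>G\<close> bounds the growth between \<open>n\<close> and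
    \<open>2 * n\<close>, where the step sizes sum to at most 2.\<close>
  define K where "K = 16 * (2 + \<mu>)\<^sup>2"
  define G where "G = exp (2 * \<mu>)"
  define E where "E = exp (CARD('n) / c\<^sup>2 * K)"
  have K: "K > 0" unfolding K_def using \<mu>_pos by simp
  have G: "G > 0" unfolding G_def by simp
  have E: "E \<ge> 1" unfolding E_def using K by simp
  from asymp_inverse_bounds[OF r_lim] obtain n1 where n1: "n1 \<ge> 1" "\<And>n. n \<ge> n1 \<Longrightarrow> r n \<in> {1 / (2 * n)..2 / n}"
    by blast
  \<comment> \<open>The square of every tilt is at most 64 K G^2 / n, hence at most c^2 from
    \<open>n2\<close> on.\<close>
  obtain n2 where n2: "real n2 \<ge> 64 * K * G\<^sup>2 / c\<^sup>2" using real_arch_simple by blast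
  have unbounded: "\<exists>k\<ge>2*n. (\<Sum>l=n..<k. r l) \<ge> B" for n B
  proof (rule ccontr)
    assume "\<not> ?thesis"
    then have B: "(\<Sum>l=n..<k. r l) < B" if "k \<ge> 2*n" for k using that by force
    have "(\<Sum>l<k. r l) \<le> (\<Sum>l<n. r l) + B" for k
    proof -
      have "(\<Sum>l<k. r l) \<le> (\<Sum>l<max k (2*n). r l)" using r01 by (intro sum_mono2) auto
      also have "\<dots> = (\<Sum>l<n. r l) + (\<Sum>l=n..<max k (2*n). r l)"
        by (simp add: lessThan_atLeast0 sum.atLeastLessThan_concat)
      finally show ?thesis using B[of "max k (2*n)"] by simp
    qed
    then have "(\<Sum>l\<le>k. r l) \<le> (\<Sum>l<n. r l) + B" for k
      using lessThan_Suc_atMost[of k] by metis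
    then have "summable r" using r01 by (intro bounded_imp_summable) auto
    then show False using not_summable_if_asymp_inverse[OF r_lim] by simp
  qed
  have "\<exists>j. \<forall>z\<in>U. stay (\<lambda>_. 0) j n z \<le> 1 - 1 / (16 * E)" if n: "n \<ge> max n1 n2" for n
  proof -
    have npos: "n > 0" "real n > 0" using n n1(1) by auto
    \<comment> \<open>A lower bound for \<open>Q\<close>: the first n weights are at least 1 / (4 G
      n) each.\<close>
    define q where "q = 1 / (16 * G\<^sup>2 * n)"
    have q: "q > 0" unfolding q_def using G npos by simp
    \<comment> \<open>By time \<open>m\<close> the growth is at least 2 / sqrt (K q), so a gap of at
      most 1, once discounted, is at most half of the accumulated tilt b Q = sqrt (K Q).\<close>
    obtain m where m: "m \<ge> 2*n" "(\<Sum>l=n..<m. r l) \<ge> 2 / sqrt (K * q) / \<mu>" using unbounded by blast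
    define Q where "Q = (\<Sum>l=n..<m. (weight n l)\<^sup>2)"
    have wlow: "weight n l \<ge> 1 / (4 * G * n)" if l: "l \<in> {n..<2*n}" for l
    proof -
      have "(\<Sum>i=n..<Suc l. r i) \<le> (\<Sum>i=n..<Suc l. 2 / n)"
      proof (intro sum_mono)
        fix i assume "i \<in> {n..<Suc l}"
        then have "r i \<le> 2 / i" "real n \<le> real i" using n1(2)[of i] n by auto
        moreover have "2 / real i \<le> 2 / real n" using npos \<open>real n \<le> real i\<close> by (intro divide_left_mono) auto
        ultimately show "r i \<le> 2 / n" by simp
      qed
      also have "\<dots> = real (Suc l - n) * (2 / n)" by simp
      also have "\<dots> \<le> n * (2 / n)" using l npos by (intro mult_right_mono) auto
      also have "\<dots> = 2" using npos by simp
      finally have "growth n (Suc l) \<le> G"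
        unfolding G_def using growth_le_exp[of n "Suc l"] \<mu>_pos
        by (intro order_trans[OF growth_le_exp]) (simp add: mult.commute)
      moreover have "r l \<ge> 1 / (4 * n)"
      proof -
        have "1 / (4 * real n) \<le> 1 / (2 * real l)" using l npos by (intro divide_left_mono) auto
        then show ?thesis using n1(2)[of l] l n by auto
      qed
      ultimately have "(1 / (4 * n)) / G \<le> r l / growth n (Suc l)"
        using G growth_ge_1[of n "Suc l"] r01[of l] by (intro frac_le) auto
      then show ?thesis by (simp add: weight_def mult.commute mult.left_commute)
    qed
    have Q: "Q \<ge> q"
    proof -
      have "q = (\<Sum>l=n..<2*n. (1 / (4 * G * n))\<^sup>2)"
        unfolding q_def using npos by (simp add: power2_eq_square)
      also have "\<dots> \<le> (\<Sum>l=n..<2*n. (weight n l)\<^sup>2)"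
        using wlow G npos by (intro sum_mono power_mono) auto
      also have "\<dots> \<le> Q" unfolding Q_def using m by (intro sum_mono2) auto
      finally show ?thesis .
    qed
    \<comment> \<open>This choice makes the squared tilts sum to \<open>K\<close>, whatever \<open>n\<close> and \<open>m\<close> are.\<close>
    define b where "b = sqrt (K / Q)"
    have b: "b > 0" "b\<^sup>2 = K / Q" unfolding b_def using K Q q by auto
    define j where "j = m - n"
    have nj: "n + j = m" unfolding j_def using m by simp
    have tilt: "b * weight n l \<in> {0..c}" if "n \<le> l" for l
    proof -
      have "weight n l \<le> 2 / n"
      proof -
        have "weight n l \<le> 2 / l" using weight_bounds[of n l] n1(2)[of l] n that by auto
        also have "\<dots> \<le> 2 / n" using npos that by (intro divide_left_mono) auto
        finally show ?thesis .
      qed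
      then have "(b * weight n l)\<^sup>2 \<le> K / Q * (2 / n)\<^sup>2"
        unfolding power_mult_distrib b(2) using weight_bounds[of n l] K Q q
        by (intro mult_left_mono power_mono) auto
      also have "\<dots> \<le> K / q * (2 / n)\<^sup>2"
        using K Q q by (intro mult_right_mono divide_left_mono) auto
      also have "\<dots> = 64 * K * G\<^sup>2 / n"
        unfolding q_def using npos G by (simp add: field_simps power2_eq_square)
      also have "\<dots> \<le> c\<^sup>2"
      proof -
        have "64 * K * G\<^sup>2 / c\<^sup>2 \<le> n" using n2 n by linarith
        then show ?thesis using npos c_pos by (simp add: field_simps)
      qed
      finally have "b * weight n l \<le> c" using c_pos by (auto intro: power2_le_imp_le)
      then show ?thesis using b weight_bounds[of n l] by auto
    qed
    have S2: "(b * Q)\<^sup>2 = K * Q" unfolding power_mult_distrib b(2) using Q q by (simp add: power2_eq_square)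
    have final: "1 / growth n m \<le> b * Q / 2"
    proof -
      have "2 / sqrt (K * q) \<le> \<mu> * (\<Sum>l=n..<m. r l)" using mult_left_mono[OF m(2), of \<mu>] \<mu>_pos by simp
      also have "\<dots> \<le> growth n m" using growth_ge_sum[of n m] by simp
      finally have "1 / growth n m \<le> sqrt (K * q) / 2"
        using K q growth_ge_1[of n m] by (simp add: field_simps)
      also have "\<dots> \<le> sqrt (K * Q) / 2" using K Q by (intro divide_right_mono real_sqrt_le_mono mult_left_mono) auto
      also have "sqrt (K * Q) = b * Q" unfolding S2[symmetric] using b Q q by (subst real_sqrt_abs) simp
      finally show ?thesis .
    qed
    have "stay (\<lambda>_. 0) j n z \<le> 1 - 1 / (16 * E)" for z
    proof -
      define x where "x = 1 - stay (\<lambda>_. 0) j n z"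
      define y where "y = 1 - stay (\<lambda>l. b * weight n l) j n z"
      have "y\<^sup>2 \<le> exp (CARD('n) / c\<^sup>2 * (\<Sum>l=n..<n+j. (b * weight n l)\<^sup>2)) * x"
        unfolding x_def y_def using tilt by (intro stay_shift_lower_bound) auto
      also have "(\<Sum>l=n..<n+j. (b * weight n l)\<^sup>2) = K"
      proof -
        have "(\<Sum>l=n..<n+j. (b * weight n l)\<^sup>2) = b\<^sup>2 * Q"
          by (simp only: nj power_mult_distrib sum_distrib_left Q_def)
        then show ?thesis using b(2) Q q by simp
      qed
      finally have y2: "y\<^sup>2 \<le> E * x" unfolding E_def .
      have cheb: "stay (\<lambda>_. 0) j n z + stay (\<lambda>l. b * weight n l) j n z - 1 \<le>
          4 / (b * Q)\<^sup>2 * ((2 + \<mu>)\<^sup>2 * Q)"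
      proof -
        have "stay (\<lambda>_. 0) j n z + stay (\<lambda>l. b * weight n l) j n z - 1 \<le>
            4 / (b * (\<Sum>l=n..<n+j. (weight n l)\<^sup>2))\<^sup>2 *
             ((max 0 (b * (\<Sum>l=n..<n. (weight n l)\<^sup>2) - gap z z / growth n n))\<^sup>2
              + (2 + \<mu>)\<^sup>2 * (\<Sum>l=n..<n+j. (weight n l)\<^sup>2))"
        proof (rule coupled_stay_le)
          show "0 \<le> b" using b by simp
          show "1 / growth n (n + j) \<le> b * (\<Sum>l=n..<n+j. (weight n l)\<^sup>2) / 2"
            using final unfolding nj Q_def .
          show "b * weight n l \<le> c" if "n \<le> l" for l
            using tilt[OF that] by simp
        qed simp_all
        moreover have "gap z z = 0" by (simp add: gap_def)
        ultimately show ?thesis unfolding nj Q_def[symmetric] by simp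
      qed
      have "4 / (b * Q)\<^sup>2 * ((2 + \<mu>)\<^sup>2 * Q) = 1 / 4"
      proof -
        have "4 / (16 * s * Q) * (s * Q) = 1 / 4" if "s > 0" for s
          using that Q q by simp
        then show ?thesis unfolding S2 K_def using \<mu>_pos by simp
      qed
      then have xy: "x + y \<ge> 3/4" using cheb unfolding x_def y_def by linarith
      have "x \<ge> 1 / (16 * E)"
      proof (rule ccontr)
        assume "\<not> ?thesis"
        then have x: "E * x < 1 / 16" using E by (simp add: field_simps)
        moreover have "x \<ge> 0"
          using stay_prob_bounds[of p r U "\<lambda>_. 0" j n z] unfolding x_def atLeastAtMost_iff by linarith
        then have "x \<le> E * x" using mult_right_mono[OF E, of x] by linarith
        ultimately have "y \<ge> 11/16" using xy by linarith
        then have "y\<^sup>2 \<ge> (11/16)\<^sup>2" by (intro power_mono) auto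
        then show False using y2 x by (simp add: power2_eq_square)
      qed
      then show ?thesis unfolding x_def by simp
    qed
    then show ?thesis by blast
  qed
  moreover have "1 / (16 * E) > 0" using E by simp
  ultimately show ?thesis by blast
qed

end

section \<open>The urn process and its history\<close>

lemma measurable_vec:
  fixes g :: "'a \<Rightarrow> real^'n"
  assumes "\<And>h. (\<lambda>\<omega>. g \<omega> $ h) \<in> borel_measurable N"
  shows "g \<in> borel_measurable N"
proof -
  have "(\<lambda>\<omega>. g \<omega> \<bullet> b) \<in> borel_measurable N" if b: "b \<in> Basis" for b
  proof -
    obtain h where "b = axis h 1" using b unfolding Basis_vec_def Basis_real_def by auto
    then show ?thesis using assms[of h] by (simp add: inner_axis)
  qed
  then show ?thesis by (subst borel_measurable_euclidean_space) auto
qed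

lemma measurable_vec_nth [measurable (raw)]:
  fixes g :: "'a \<Rightarrow> real^'n"
  assumes "g \<in> borel_measurable N"
  shows "(\<lambda>\<omega>. g \<omega> $ h) \<in> borel_measurable N"
  by (rule borel_measurable_continuous_on[OF _ assms]) (intro continuous_intros)

definition rate :: "real \<Rightarrow> real \<Rightarrow> real \<Rightarrow> (real \<Rightarrow> real) \<Rightarrow> real^'n \<Rightarrow> 'n \<Rightarrow> real" where
  "rate \<alpha> \<beta> q f z h = \<alpha> * comp_mean z + \<beta> * q + (1 - \<alpha> - \<beta>) * f (z $ h)"

lemma drift_nth: "drift \<alpha> \<beta> q f z $ h = rate \<alpha> \<beta> q f z h - z $ h"
  by (simp add: drift_def rate_def)

lemma comp_mean_bounds:
  fixes z :: "real^'n"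
  assumes "\<And>h. z $ h \<in> {0..1}"
  shows "comp_mean z \<in> {0..1}"
proof -
  have "(\<Sum>i\<in>UNIV. z $ i) \<le> (\<Sum>i\<in>(UNIV::'n set). 1)" using assms by (intro sum_mono) auto
  moreover have "(\<Sum>i\<in>UNIV. z $ i) \<ge> 0" using assms by (intro sum_nonneg) auto
  ultimately show ?thesis unfolding comp_mean_def by (auto simp: field_simps)
qed

lemma comp_mean_mono:
  fixes z :: "real^'n"
  assumes "\<And>h. z $ h \<le> z' $ h"
  shows "comp_mean z \<le> comp_mean z'"
  unfolding comp_mean_def using assms by (intro mult_left_mono sum_mono) auto

text \<open>The base locale describes \<open>f\<close> on the unit interval only. Continuity on the
  whole line makes \<open>rate\<close> a Borel function on the whole space, so that measurability of
  functions of \<open>Z n\<close> follows by composition.\<close>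

locale continuous_system = reinforced_system M \<alpha> \<beta> q f r Z I
  for M :: "'a measure" and \<alpha> \<beta> q :: real and f r and Z I :: "nat \<Rightarrow> 'a \<Rightarrow> real^'n" +
  assumes f_continuous: "continuous_on UNIV f"
begin

abbreviation "p \<equiv> rate \<alpha> \<beta> q f"
abbreviation "F \<equiv> history M (Z 0) I"

lemma Z_range: "\<omega> \<in> space M \<Longrightarrow> Z n \<omega> $ h \<in> {0..1}"
proof (induction n)
  case (Suc n)
  have "r n \<in> {0..1}" by (rule r_range)
  moreover have "I (Suc n) \<omega> $ h \<in> {0, 1}" by (rule I_range) fact
  ultimately have "(1 - r n) * Z n \<omega> $ h + r n * I (Suc n) \<omega> $ h \<in> {0..1}"
    using Suc convex_bound_le[of "Z n \<omega> $ h" 1 "I (Suc n) \<omega> $ h" "1 - r n" "r n"] by auto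
  then show ?case using Z_Suc[of \<omega>] Suc by simp
qed (rule Z0_range)

lemma rate_range:
  assumes "\<And>h. z $ h \<in> {0..1}"
  shows "p z h \<in> {0..1}"
proof -
  have 1: "f (z $ h) \<in> {0..1}" using f_range assms[of h] by blast
  have m: "comp_mean z \<in> {0..1}" by (rule comp_mean_bounds) (rule assms)
  have "\<alpha> * comp_mean z \<le> \<alpha> * 1" "\<beta> * q \<le> \<beta> * 1" "(1 - \<alpha> - \<beta>) * f (z $ h) \<le> (1 - \<alpha> - \<beta>) * 1"
    using 1 m alpha beta alpha_beta q by (intro mult_left_mono; simp)+
  moreover have "0 \<le> \<alpha> * comp_mean z" "0 \<le> \<beta> * q" "0 \<le> (1 - \<alpha> - \<beta>) * f (z $ h)"
    using 1 m alpha beta alpha_beta q by (intro mult_nonneg_nonneg; simp)+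
  ultimately show ?thesis unfolding rate_def by simp
qed

lemma rate_Z_range: "\<omega> \<in> space M \<Longrightarrow> p (Z n \<omega>) h \<in> {0..1}"
  by (intro rate_range Z_range)

lemma space_history [simp]: "space (F n) = space M"
  unfolding history_def by (intro space_measure_of) auto

lemma Z0_history: "(\<lambda>\<omega>. Z 0 \<omega> $ h) \<in> borel_measurable (F n)"
  unfolding history_def
  by (rule measurableI) (auto simp: space_measure_of_conv intro!: in_measure_of)

lemma I_history: "k \<in> {1..n} \<Longrightarrow> (\<lambda>\<omega>. I k \<omega> $ h) \<in> borel_measurable (F n)"
  unfolding history_def
  by (rule measurableI) (force simp: space_measure_of_conv intro!: in_measure_of)+

lemma subalgebra_history: "subalgebra M (F n)"
  unfolding subalgebra_def
proof
  have I: "(\<lambda>\<omega>. I k \<omega> $ h) \<in> borel_measurable M" if "k \<in> {1..n}" for k h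
    using I_measurable[of "k - 1" h] that by simp
  have gen: "{(\<lambda>\<omega>. Z 0 \<omega> $ h) -` A \<inter> space M | h A. A \<in> sets borel} \<union>
      {(\<lambda>\<omega>. I k \<omega> $ h) -` A \<inter> space M | k h A. k \<in> {1..n} \<and> A \<in> sets borel} \<subseteq> sets M"
    using measurable_sets[OF Z0_measurable] measurable_sets[OF I] by blast
  then show "sets (F n) \<subseteq> sets M"
    unfolding history_def
    by (subst sets_measure_of) (blast, rule sets.sigma_sets_subset[OF gen])
qed simp

lemma history_mono: "subalgebra (F (Suc n)) (F n)"
  unfolding subalgebra_def
proof
  have "k \<in> {1..Suc n}" if "k \<in> {1..n}" for k using that by auto
  then have "{(\<lambda>\<omega>. I k \<omega> $ h) -` A \<inter> space M | k h A. k \<in> {1..n} \<and> A \<in> sets borel}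
      \<subseteq> {(\<lambda>\<omega>. I k \<omega> $ h) -` A \<inter> space M | k h A. k \<in> {1..Suc n} \<and> A \<in> sets borel}"
    by blast
  note sub = Un_mono[OF order_refl this]
  show "sets (F n) \<subseteq> sets (F (Suc n))"
    unfolding history_def
    by (subst sets_measure_of, blast, subst sets_measure_of, blast) (rule sigma_sets_mono'[OF sub])
qed simp

lemma sets_history_mono: "A \<in> sets (F n) \<Longrightarrow> A \<in> sets (F (Suc n))"
  using history_mono[of n] by (auto simp: subalgebra_def)

lemma sets_historyD: "A \<in> sets (F n) \<Longrightarrow> A \<in> sets M"
  using subalgebra_history[of n] by (auto simp: subalgebra_def)

lemma Z_history: "Z n \<in> borel_measurable (F n)"
proof (induction n)
  case 0
  show ?case by (rule measurable_vec) (rule Z0_history)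
next
  case (Suc n)
  have "Z n \<in> borel_measurable (F (Suc n))"
    by (rule measurable_from_subalg[OF history_mono Suc])
  then have "(\<lambda>\<omega>. (1 - r n) * Z n \<omega> $ h + r n * I (Suc n) \<omega> $ h) \<in> borel_measurable (F (Suc n))" for h
    using I_history[of "Suc n" "Suc n" h] by measurable
  then show ?case
    by (intro measurable_vec, subst measurable_cong[OF Z_Suc]) auto
qed

lemma Z_measurable [measurable]: "Z n \<in> borel_measurable M"
  by (rule measurable_from_subalg[OF subalgebra_history Z_history])

lemma I_nth_measurable [measurable]: "(\<lambda>\<omega>. I (Suc n) \<omega> $ h) \<in> borel_measurable M"
  by (rule I_measurable)

lemma rate_measurable: "(\<lambda>z. p z h) \<in> borel_measurable borel"
proof -
  have [measurable]: "f \<in> borel_measurable borel"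
    using f_continuous by (rule borel_measurable_continuous_onI)
  show ?thesis unfolding rate_def comp_mean_def by measurable
qed

lemma rate_Z_history: "(\<lambda>\<omega>. p (Z n \<omega>) h) \<in> borel_measurable (F n)"
  by (rule measurable_compose[OF Z_history rate_measurable])

lemma rate_Z_measurable [measurable]: "(\<lambda>\<omega>. p (Z n \<omega>) h) \<in> borel_measurable M"
  by (rule measurable_from_subalg[OF subalgebra_history rate_Z_history])

text \<open>Conditional probabilities are versions determined only almost everywhere. Integrals
  against bounded history-measurable functions do not depend on the version, and it is in this form
  that the model assumptions are used.\<close>

lemma integral_mult_indicator_cond_probability:
  assumes g: "g \<in> borel_measurable (F n)" and bd: "\<And>\<omega>. \<omega> \<in> space M \<Longrightarrow> \<bar>g \<omega>\<bar> \<le> B"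
    and A: "A \<in> sets M"
  shows "(\<integral>\<omega>. g \<omega> * indicator A \<omega> \<partial>M) = (\<integral>\<omega>. g \<omega> * cond_probability M (F n) A \<omega> \<partial>M)"
proof -
  interpret finite_measure_subalgebra M "F n"
    by unfold_locales (rule subalgebra_history)
  have [measurable]: "g \<in> borel_measurable M" "A \<in> sets M"
    using measurable_from_subalg[OF subalgebra_history g] A by auto
  have "\<bar>g \<omega> * indicator A \<omega>\<bar> \<le> max B 0" if "\<omega> \<in> space M" for \<omega>
    using bd[OF that] by (auto simp: indicator_def)
  then have "integrable M (\<lambda>\<omega>. g \<omega> * indicator A \<omega>)"
    by (intro integrable_const_bound[of _ "max B 0"]) auto
  then show ?thesis
    unfolding cond_probability_def by (subst real_cond_exp_intg(2)) (use g in auto)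
qed

lemma AE_cond_probability_compl:
  assumes A: "A \<in> sets M"
  shows "AE \<omega> in M. cond_probability M (F n) (space M - A) \<omega> = 1 - cond_probability M (F n) A \<omega>"
proof -
  interpret finite_measure_subalgebra M "F n"
    by unfold_locales (rule subalgebra_history)
  have [measurable]: "A \<in> sets M" by (rule A)
  have int: "integrable M (indicator A :: 'a \<Rightarrow> real)"
    by (intro integrable_const_bound[of _ 1]) auto
  have "AE \<omega> in M. real_cond_exp M (F n) (indicator (space M - A)) \<omega> = real_cond_exp M (F n) (\<lambda>\<omega>. 1 - indicator A \<omega>) \<omega>"
    by (rule real_cond_exp_cong) (auto simp: indicator_def)
  moreover have "AE \<omega> in M. real_cond_exp M (F n) (\<lambda>\<omega>. 1 - indicator A \<omega>) \<omega> =
      real_cond_exp M (F n) (\<lambda>_. 1) \<omega> - real_cond_exp M (F n) (indicator A) \<omega>"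
    by (rule real_cond_exp_diff) (auto simp: int)
  moreover have "AE \<omega> in M. real_cond_exp M (F n) (\<lambda>_. 1) \<omega> = 1"
    by (rule real_cond_exp_F_meas) auto
  ultimately show ?thesis unfolding cond_probability_def by eventually_elim simp
qed

text \<open>The centred success indicators are martingale differences; the property is stated in
  tested form, with \<open>g\<close> a bounded function of the history.\<close>

lemma expectation_mult_noise:
  assumes g: "g \<in> borel_measurable (F n)" and bd: "\<And>\<omega>. \<omega> \<in> space M \<Longrightarrow> \<bar>g \<omega>\<bar> \<le> B"
  shows "(\<integral>\<omega>. g \<omega> * (I (Suc n) \<omega> $ h - p (Z n \<omega>) h) \<partial>M) = 0"
proof -
  define A where "A = {\<omega>' \<in> space M. I (Suc n) \<omega>' $ h = 1}"
  have [measurable]: "A \<in> sets M" unfolding A_def by measurable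
  have [measurable]: "g \<in> borel_measurable M"
    by (rule measurable_from_subalg[OF subalgebra_history g])
  have bd': "\<bar>g \<omega> * c\<bar> \<le> B" if "\<omega> \<in> space M" "c \<in> {0..1}" for \<omega> c
  proof -
    have "\<bar>g \<omega>\<bar> * c \<le> \<bar>g \<omega>\<bar> * 1" using that by (intro mult_left_mono) auto
    then show ?thesis using bd[OF that(1)] that by (simp add: abs_mult)
  qed
  have IA: "I (Suc n) \<omega> $ h = indicator A \<omega>" if "\<omega> \<in> space M" for \<omega>
    using I_range[OF that, of n h] that by (auto simp: A_def indicator_def)
  have "(\<integral>\<omega>. g \<omega> * (I (Suc n) \<omega> $ h - p (Z n \<omega>) h) \<partial>M) =
        (\<integral>\<omega>. g \<omega> * indicator A \<omega> - g \<omega> * p (Z n \<omega>) h \<partial>M)"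
    by (intro Bochner_Integration.integral_cong) (auto simp: IA algebra_simps)
  also have "\<dots> = (\<integral>\<omega>. g \<omega> * indicator A \<omega> \<partial>M) - (\<integral>\<omega>. g \<omega> * p (Z n \<omega>) h \<partial>M)"
    by (intro Bochner_Integration.integral_diff integrable_const_bound[of _ B] AE_I2)
       (auto intro!: bd' simp: real_norm_def rate_Z_range[unfolded atLeastAtMost_iff])
  also have "(\<integral>\<omega>. g \<omega> * indicator A \<omega> \<partial>M) = (\<integral>\<omega>. g \<omega> * cond_probability M (F n) A \<omega> \<partial>M)"
    by (rule integral_mult_indicator_cond_probability[OF g bd]) auto
  also have "\<dots> = (\<integral>\<omega>. g \<omega> * p (Z n \<omega>) h \<partial>M)"
    using I_cond_prob[of n h, folded rate_def A_def]
    by (intro integral_cong_AE) (auto simp: cond_probability_def elim!: eventually_mono)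
  finally show ?thesis by simp
qed

text \<open>The Markov property in tested form. By conditional independence each of the finitely
  many outcome vectors \<open>i\<close> has conditional probability \<open>P i\<close>, which is its
  probability under \<open>flips\<close>; decomposing along the outcomes reduces the claim to these
  probabilities.\<close>

lemma expectation_next_state:
  fixes \<phi> :: "real^'n \<Rightarrow> real"
  assumes g: "g \<in> borel_measurable (F n)" and bd: "\<And>\<omega>. \<omega> \<in> space M \<Longrightarrow> \<bar>g \<omega>\<bar> \<le> B"
    and \<phi>: "\<phi> \<in> borel_measurable borel" "\<And>z. \<bar>\<phi> z\<bar> \<le> C"
  shows "(\<integral>\<omega>. g \<omega> * \<phi> (Z (Suc n) \<omega>) \<partial>M) =
    (\<integral>\<omega>. g \<omega> * measure_pmf.expectation (flips (p (Z n \<omega>))) (\<lambda>i. \<phi> (urn_step (r n) (Z n \<omega>) i)) \<partial>M)"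
proof -
  define A where "A = (\<lambda>i :: 'n \<Rightarrow> bool. \<Inter>h\<in>UNIV. (\<lambda>\<omega>. I (Suc n) \<omega> $ h) -` {of_bool (i h)} \<inter> space M)"
  define P where "P = (\<lambda>i \<omega>. \<Prod>h\<in>UNIV. if i h then p (Z n \<omega>) h else 1 - p (Z n \<omega>) h)"
  define G where "G = (\<lambda>i \<omega>. g \<omega> * \<phi> (urn_step (r n) (Z n \<omega>) i))"
  have one: "(\<lambda>\<omega>. I (Suc n) \<omega> $ h) -` {of_bool b} \<inter> space M \<in> sets M" for h b
    by (rule measurable_sets[OF I_nth_measurable]) simp
  have A: "A i \<in> sets M" for i
    unfolding A_def by (intro sets.finite_INT one) auto
  have AP: "AE \<omega> in M. cond_probability M (F n) (A i) \<omega> = P i \<omega>" for i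
  proof -
    have "AE \<omega> in M. cond_probability M (F n) (A i) \<omega> =
        (\<Prod>h\<in>UNIV. cond_probability M (F n) ((\<lambda>\<omega>. I (Suc n) \<omega> $ h) -` {of_bool (i h)} \<inter> space M) \<omega>)"
      unfolding A_def
      by (rule I_cond_indep[of n, unfolded cond_indep_vars_def, THEN conjunct2, rule_format]) auto
    moreover have "AE \<omega> in M. \<forall>h\<in>UNIV. cond_probability M (F n) ((\<lambda>\<omega>. I (Suc n) \<omega> $ h) -` {of_bool (i h)} \<inter> space M) \<omega>
        = (if i h then p (Z n \<omega>) h else 1 - p (Z n \<omega>) h)"
    proof (intro AE_finite_allI finite)
      fix h
      let ?A = "{\<omega>' \<in> space M. I (Suc n) \<omega>' $ h = 1}"
      have A1: "?A \<in> sets M" by measurable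
      have eq: "(\<lambda>\<omega>. I (Suc n) \<omega> $ h) -` {of_bool (i h)} \<inter> space M = (if i h then ?A else space M - ?A)"
        using I_range[of _ n h] by auto
      show "AE \<omega> in M. cond_probability M (F n) ((\<lambda>\<omega>. I (Suc n) \<omega> $ h) -` {of_bool (i h)} \<inter> space M) \<omega>
        = (if i h then p (Z n \<omega>) h else 1 - p (Z n \<omega>) h)"
        unfolding eq using I_cond_prob[of n h] AE_cond_probability_compl[OF A1, of n]
        by eventually_elim (simp add: rate_def)
    qed
    ultimately show ?thesis unfolding P_def by eventually_elim simp
  qed
  have \<phi>n: "(\<lambda>\<omega>. \<phi> (urn_step (r n) (Z n \<omega>) i)) \<in> borel_measurable (F n)" for i
  proof (rule measurable_compose[OF _ \<phi>(1)])
    have [measurable]: "Z n \<in> borel_measurable (F n)" by (rule Z_history)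
    show "(\<lambda>\<omega>. urn_step (r n) (Z n \<omega>) i) \<in> borel_measurable (F n)"
      by (rule measurable_vec) (simp add: urn_step_def)
  qed
  have G: "G i \<in> borel_measurable (F n)" for i
    unfolding G_def using g \<phi>n by measurable
  have Gb: "\<bar>G i \<omega>\<bar> \<le> B * C" if "\<omega> \<in> space M" for i \<omega>
    unfolding G_def abs_mult using bd[OF that] \<phi>(2) by (intro mult_mono) (auto intro: order_trans[OF abs_ge_zero])
  have GM [measurable]: "G i \<in> borel_measurable M" for i
    by (rule measurable_from_subalg[OF subalgebra_history G])
  have PM [measurable]: "P i \<in> borel_measurable M" for i
    unfolding P_def by (intro borel_measurable_prod) (auto split: if_split)
  have P01: "P i \<omega> \<in> {0..1}" if "\<omega> \<in> space M" for i \<omega>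
    unfolding P_def using rate_Z_range[OF that] 
    by (auto intro!: prod_nonneg prod_le_1 simp: atLeastAtMost_iff split: if_split)
  have BC: "B * C \<ge> 0" 
    using not_empty Gb by (meson abs_ge_zero equals0I order_trans)
  have GI: "integrable M (\<lambda>\<omega>. G i \<omega> * indicator (A i) \<omega>)" for i
    using A Gb BC by (intro integrable_const_bound[of _ "B * C"] AE_I2) (auto simp: indicator_def)
  have GP: "integrable M (\<lambda>\<omega>. G i \<omega> * P i \<omega>)" for i
  proof (intro integrable_const_bound[of _ "B * C"] AE_I2)
    fix \<omega> assume \<omega>: "\<omega> \<in> space M"
    have "\<bar>G i \<omega>\<bar> * \<bar>P i \<omega>\<bar> \<le> (B * C) * 1"
      using Gb[OF \<omega>] P01[OF \<omega>, of i] BC by (intro mult_mono) auto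
    then show "norm (G i \<omega> * P i \<omega>) \<le> B * C" by (simp add: abs_mult)
  qed auto
  have step: "g \<omega> * \<phi> (Z (Suc n) \<omega>) = (\<Sum>i\<in>UNIV. G i \<omega> * indicator (A i) \<omega>)" if \<omega>: "\<omega> \<in> space M" for \<omega>
  proof -
    define i where "i = (\<lambda>h. I (Suc n) \<omega> $ h = 1)"
    have i: "I (Suc n) \<omega> $ h = of_bool (i h)" for h
      using I_range[OF \<omega>, of n h] by (auto simp: i_def)
    have "\<omega> \<in> A i' \<longleftrightarrow> i' = i" for i'
      unfolding A_def using \<omega> by (auto simp: i fun_eq_iff)
    then have "(\<Sum>i'\<in>UNIV. G i' \<omega> * indicator (A i') \<omega>) = (\<Sum>i'\<in>UNIV. if i' = i then G i' \<omega> else 0)"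
      by (intro sum.cong) (auto simp: indicator_def)
    moreover have "Z (Suc n) \<omega> = urn_step (r n) (Z n \<omega>) i"
      by (simp add: vec_eq_iff Z_Suc[OF \<omega>] urn_step_def i)
    ultimately show ?thesis by (simp add: G_def)
  qed
  have "(\<integral>\<omega>. g \<omega> * \<phi> (Z (Suc n) \<omega>) \<partial>M) = (\<integral>\<omega>. (\<Sum>i\<in>UNIV. G i \<omega> * indicator (A i) \<omega>) \<partial>M)"
    using step by (intro Bochner_Integration.integral_cong) auto
  also have "\<dots> = (\<Sum>i\<in>UNIV. \<integral>\<omega>. G i \<omega> * indicator (A i) \<omega> \<partial>M)"
    using GI by (rule Bochner_Integration.integral_sum)
  also have "\<dots> = (\<Sum>i\<in>UNIV. \<integral>\<omega>. G i \<omega> * P i \<omega> \<partial>M)"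
  proof (intro sum.cong refl)
    fix i
    have "(\<integral>\<omega>. G i \<omega> * indicator (A i) \<omega> \<partial>M) = (\<integral>\<omega>. G i \<omega> * cond_probability M (F n) (A i) \<omega> \<partial>M)"
      by (rule integral_mult_indicator_cond_probability[OF G Gb A])
    also have "\<dots> = (\<integral>\<omega>. G i \<omega> * P i \<omega> \<partial>M)"
      using AP[of i] by (intro integral_cong_AE) (auto simp: cond_probability_def elim!: eventually_mono)
    finally show "(\<integral>\<omega>. G i \<omega> * indicator (A i) \<omega> \<partial>M) = (\<integral>\<omega>. G i \<omega> * P i \<omega> \<partial>M)" .
  qed
  also have "\<dots> = (\<integral>\<omega>. (\<Sum>i\<in>UNIV. G i \<omega> * P i \<omega>) \<partial>M)"
    using GP by (rule Bochner_Integration.integral_sum[symmetric])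
  also have "\<dots> = (\<integral>\<omega>. g \<omega> * measure_pmf.expectation (flips (p (Z n \<omega>))) (\<lambda>i. \<phi> (urn_step (r n) (Z n \<omega>) i)) \<partial>M)"
  proof (intro Bochner_Integration.integral_cong refl)
    fix \<omega> assume "\<omega> \<in> space M"
    then have P: "pmf (flips (p (Z n \<omega>))) i = P i \<omega>" for i
      unfolding P_def by (intro pmf_flips rate_Z_range)
    show "(\<Sum>i\<in>UNIV. G i \<omega> * P i \<omega>) =
        g \<omega> * measure_pmf.expectation (flips (p (Z n \<omega>))) (\<lambda>i. \<phi> (urn_step (r n) (Z n \<omega>) i))"
      unfolding expectation_finite_type P G_def sum_distrib_left
      by (intro sum.cong refl) (simp only: mult_ac)
  qed
  finally show ?thesis .
qed

end

section \<open>Convergence of the noise\<close>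

lemma ex_cube_root_floor: "\<exists>j::nat. j ^ 3 \<le> n \<and> n < Suc j ^ 3"
proof (induction n)
  case 0
  show ?case by (intro exI[of _ 0]) simp
next
  case (Suc n)
  then obtain j where j: "j ^ 3 \<le> n" "n < Suc j ^ 3" by blast
  show ?case
  proof (cases "Suc n < Suc j ^ 3")
    case True
    then show ?thesis using j by (intro exI[of _ j]) simp
  next
    case False
    then have "Suc n = Suc j ^ 3" using j by simp
    moreover have "Suc j ^ 3 < Suc (Suc j) ^ 3" by (rule power_strict_mono) auto
    ultimately show ?thesis by (intro exI[of _ "Suc j"]) simp
  qed
qed

lemma cube_gap_le: "real (Suc j ^ 3 - j ^ 3) \<le> 3 * (real j + 1)\<^sup>2"
proof -
  have "j ^ 3 \<le> Suc j ^ 3" by (rule power_mono) auto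
  then have "real (Suc j ^ 3 - j ^ 3) = (real j + 1) ^ 3 - real j ^ 3" by (simp add: of_nat_diff add.commute)
  also have "\<dots> = 3 * (real j)\<^sup>2 + 3 * real j + 1" by (simp add: power3_eq_cube power2_eq_square algebra_simps)
  also have "\<dots> \<le> 3 * (real j + 1)\<^sup>2" by (simp add: power2_eq_square algebra_simps)
  finally show ?thesis .
qed

lemma cube_add_1_ge: "real j ^ 3 + 1 \<ge> (real j + 1) ^ 3 / 4"
proof -
  have "4 * (real j ^ 3 + 1) - (real j + 1) ^ 3 = 3 * (real j + 1) * (real j - 1)\<^sup>2"
    by (simp add: power3_eq_cube power2_eq_square algebra_simps)
  also have "\<dots> \<ge> 0" by (intro mult_nonneg_nonneg) auto
  finally show ?thesis by simp
qed

lemma inverse_cube_add_1_le: "1 / (real (j ^ 3) + 1) \<le> 4 / (real j + 1) ^ 3"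
proof -
  have "1 / (real j ^ 3 + 1) \<le> 1 / ((real j + 1) ^ 3 / 4)"
    using cube_add_1_ge[of j] by (intro divide_left_mono mult_pos_pos) (auto intro: add_nonneg_pos)
  then show ?thesis by simp
qed

text \<open>Convergence along the cubes suffices, since the terms are \<open>O(1/k)\<close> and the cubes are dense
  enough for the sum over one block to vanish. This replaces a maximal inequality.\<close>

lemma summable_if_cube_blocks:
  fixes x :: "nat \<Rightarrow> real"
  assumes blocks: "summable (\<lambda>j. \<bar>\<Sum>k=j^3..<Suc j^3. x k\<bar>)"
    and small: "\<And>k. \<bar>x k\<bar> \<le> C / (real k + 1)"
  shows "summable x"
proof -
  define T where "T = (\<lambda>n. \<Sum>k<n. x k)"
  have C: "C \<ge> 0" using order_trans[OF abs_ge_zero small[of 0]] by simp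
  have block: "T (Suc j ^ 3) - T (j ^ 3) = (\<Sum>k=j^3..<Suc j^3. x k)" for j
  proof -
    have "j ^ 3 \<le> Suc j ^ 3" by (rule power_mono) auto
    then show ?thesis unfolding T_def by (simp only: lessThan_atLeast0 sum_diff_nat_ivl)
  qed
  have "T (j ^ 3) = (\<Sum>i<j. \<Sum>k=i^3..<Suc i^3. x k)" for j
    unfolding block[symmetric] by (induction j) (auto simp: T_def)
  moreover have "summable (\<lambda>j. \<Sum>k=j^3..<Suc j^3. x k)"
    using blocks by (rule summable_rabs_cancel)
  ultimately obtain L where L: "(\<lambda>j. T (j ^ 3)) \<longlonglongrightarrow> L"
    unfolding summable_iff_convergent convergent_def by auto
  \<comment> \<open>Inside the block that starts at j^3 the partial sums move by at most the block
    length 3 (j + 1)^2 times the term bound 4 C / (j + 1)^3.\<close>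
  have "(\<lambda>j. 12 * C / (real j + 1)) \<longlonglongrightarrow> 0" by real_asymp
  then have lim: "(\<lambda>j. \<bar>T (j ^ 3) - L\<bar> + 12 * C / (real j + 1)) \<longlonglongrightarrow> \<bar>L - L\<bar> + 0"
    using L by (intro tendsto_intros)
  have "T \<longlonglongrightarrow> L"
  proof (rule LIMSEQ_I)
    fix \<epsilon> :: real assume "\<epsilon> > 0"
    then have "eventually (\<lambda>j. \<bar>T (j ^ 3) - L\<bar> + 12 * C / (real j + 1) < \<epsilon>) sequentially"
      using order_tendstoD(2)[OF lim] by simp
    then obtain J where J: "\<And>j. j \<ge> J \<Longrightarrow> \<bar>T (j ^ 3) - L\<bar> + 12 * C / (real j + 1) < \<epsilon>"
      unfolding eventually_sequentially by blast
    show "\<exists>n0. \<forall>n\<ge>n0. norm (T n - L) < \<epsilon>"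
    proof (intro exI allI impI)
      fix n assume n: "n \<ge> J ^ 3"
      obtain j where j: "j ^ 3 \<le> n" "n < Suc j ^ 3" using ex_cube_root_floor by blast
      have "J < Suc j"
      proof (rule ccontr)
        assume "\<not> J < Suc j"
        then have "Suc j ^ 3 \<le> J ^ 3" by (intro power_mono) auto
        then show False using j n by linarith
      qed
      have "\<bar>T n - T (j ^ 3)\<bar> = \<bar>\<Sum>k=j^3..<n. x k\<bar>"
        unfolding T_def using j by (simp only: lessThan_atLeast0 sum_diff_nat_ivl)
      also have "\<dots> \<le> (\<Sum>k=j^3..<n. C / (real (j ^ 3) + 1))"
      proof (intro order_trans[OF sum_abs] sum_mono order_trans[OF small])
        fix k assume "k \<in> {j^3..<n}"
        then have "real (j ^ 3) \<le> real k" by (subst of_nat_le_iff) simp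
        then show "C / (real k + 1) \<le> C / (real (j ^ 3) + 1)"
          using C by (intro divide_left_mono mult_pos_pos) (auto intro: add_nonneg_pos)
      qed
      also have "\<dots> = real (n - j ^ 3) * (C * (1 / (real (j ^ 3) + 1)))" by simp
      also have "\<dots> \<le> (3 * (real j + 1)\<^sup>2) * (C * (4 / (real j + 1) ^ 3))"
      proof (intro mult_mono mult_left_mono inverse_cube_add_1_le C)
        have "real (n - j ^ 3) \<le> real (Suc j ^ 3 - j ^ 3)" using j by (subst of_nat_le_iff) simp
        then show "real (n - j ^ 3) \<le> 3 * (real j + 1)\<^sup>2" using cube_gap_le[of j] by linarith
      qed (use C in auto)
      also have "\<dots> = 12 * C / (real j + 1)"
        by (simp add: power2_eq_square power3_eq_cube)
      finally show "norm (T n - L) < \<epsilon>" using J[of j] \<open>J < Suc j\<close> by simp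
    qed
  qed
  then show ?thesis unfolding T_def summable_iff_convergent convergent_def by blast
qed

text \<open>By monotone convergence the sum has finite expectation, hence is finite almost
  everywhere.\<close>

lemma AE_summable_if_summable_integral:
  fixes X :: "nat \<Rightarrow> 'a \<Rightarrow> real"
  assumes int: "\<And>j. integrable N (X j)" and nonneg: "\<And>j \<omega>. \<omega> \<in> space N \<Longrightarrow> X j \<omega> \<ge> 0"
    and sum: "summable (\<lambda>j. \<integral>\<omega>. X j \<omega> \<partial>N)"
  shows "AE \<omega> in N. summable (\<lambda>j. X j \<omega>)"
proof -
  have [measurable]: "X j \<in> borel_measurable N" for j using int[of j] by simp
  have "(\<integral>\<^sup>+\<omega>. (\<Sum>j. ennreal (X j \<omega>)) \<partial>N) = (\<Sum>j. \<integral>\<^sup>+\<omega>. ennreal (X j \<omega>) \<partial>N)"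
    by (rule nn_integral_suminf) simp
  also have "\<dots> = (\<Sum>j. ennreal (\<integral>\<omega>. X j \<omega> \<partial>N))"
    using int nonneg by (intro suminf_cong nn_integral_eq_integral AE_I2) auto
  also have "\<dots> = ennreal (\<Sum>j. \<integral>\<omega>. X j \<omega> \<partial>N)"
    using sum nonneg by (intro suminf_ennreal2 Bochner_Integration.integral_nonneg) auto
  also have "\<dots> \<noteq> \<infinity>" by simp
  finally have "AE \<omega> in N. (\<Sum>j. ennreal (X j \<omega>)) \<noteq> \<infinity>"
    by (intro nn_integral_noteq_infinite) auto
  then show ?thesis
    using AE_space by eventually_elim (rule summable_suminf_not_top, auto simp: nonneg)
qed

lemma asymp_inverse_le:
  fixes r :: "nat \<Rightarrow> real"
  assumes "(\<lambda>n. real n * r n) \<longlonglongrightarrow> 1" "\<And>n. r n \<in> {0..1}"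
  obtains C where "\<And>n. r n \<le> C / (real n + 1)"
proof -
  obtain n1 where n1: "n1 \<ge> 1" "\<And>n. n \<ge> n1 \<Longrightarrow> r n \<in> {1 / (2 * n)..2 / n}"
    using asymp_inverse_bounds[OF assms(1)] by blast
  have "r n \<le> (4 + n1) / (real n + 1)" for n
  proof (cases "n \<ge> n1")
    case True
    then have "r n \<le> 2 / n" "n > 0" using n1 by auto
    moreover have "2 / real n \<le> 4 / (real n + 1)" using True n1(1) by (simp add: field_simps)
    moreover have "4 / (real n + 1) \<le> (4 + n1) / (real n + 1)" by (intro divide_right_mono) auto
    ultimately show ?thesis by linarith
  next
    case False
    then have "1 \<le> (4 + n1) / (real n + 1)" by (simp add: field_simps)
    moreover have "r n \<le> 1" using assms(2)[of n] by simp
    ultimately show ?thesis by linarith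
  qed
  then show thesis by (rule that)
qed

lemma summable_inverse_Suc_squared: "summable (\<lambda>n. 1 / (real n + 1)\<^sup>2)"
proof -
  have "summable (\<lambda>n. 1 / (real (Suc n))\<^sup>2)"
    by (subst summable_Suc_iff) (use inverse_power_summable[of 2, where ?'a = real] in \<open>simp add: inverse_eq_divide\<close>)
  then show ?thesis by (simp add: add.commute)
qed

context continuous_system
begin

definition noise :: "'n \<Rightarrow> nat \<Rightarrow> 'a \<Rightarrow> real" where
  "noise h k \<omega> = I (Suc k) \<omega> $ h - p (Z k \<omega>) h"

lemma abs_noise_le: "\<omega> \<in> space M \<Longrightarrow> \<bar>noise h k \<omega>\<bar> \<le> 1"
  using I_range[of \<omega> k h] rate_Z_range[of \<omega> k h] by (auto simp: noise_def)

lemma noise_history: "k < n \<Longrightarrow> noise h k \<in> borel_measurable (F n)"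
proof (induction n)
  case (Suc n)
  show ?case
  proof (cases "k < n")
    case True
    then show ?thesis using Suc measurable_from_subalg[OF history_mono] by blast
  next
    case False
    then have k: "k = n" using Suc by simp
    have "(\<lambda>\<omega>. p (Z k \<omega>) h) \<in> borel_measurable (F (Suc k))"
      by (rule measurable_from_subalg[OF history_mono rate_Z_history])
    then show ?thesis
      unfolding k noise_def using I_history[of "Suc n" "Suc n" h] by simp
  qed
qed simp

lemma noise_measurable [measurable]: "noise h k \<in> borel_measurable M"
  unfolding noise_def by measurable

text \<open>Martingale differences are orthogonal: the partial sum is bounded and known at time
  \<open>n\<close>, so its product with the next noise has mean zero, and each squared noise has
  mean at most 1.\<close>

lemma second_moment_noise_sum_le:
  fixes a :: "nat \<Rightarrow> real"
  shows "(\<integral>\<omega>. (\<Sum>k=m..<n. a k * noise h k \<omega>)\<^sup>2 \<partial>M) \<le> (\<Sum>k=m..<n. (a k)\<^sup>2)"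
proof (induction n)
  case (Suc n)
  define S where "S = (\<lambda>\<omega>. \<Sum>k=m..<n. a k * noise h k \<omega>)"
  define B where "B = (\<Sum>k=m..<n. \<bar>a k\<bar>)"
  have S: "\<bar>S \<omega>\<bar> \<le> B" if "\<omega> \<in> space M" for \<omega>
  proof -
    have "\<bar>S \<omega>\<bar> \<le> (\<Sum>k=m..<n. \<bar>a k\<bar> * \<bar>noise h k \<omega>\<bar>)"
      unfolding S_def by (rule order_trans[OF sum_abs]) (simp add: abs_mult)
    also have "\<dots> \<le> (\<Sum>k=m..<n. \<bar>a k\<bar> * 1)"
      using abs_noise_le[OF that] by (intro sum_mono mult_left_mono) auto
    finally show ?thesis by (simp add: B_def)
  qed
  have SF: "S \<in> borel_measurable (F n)"
    unfolding S_def using noise_history by (intro borel_measurable_sum borel_measurable_times) auto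
  have SM [measurable]: "S \<in> borel_measurable M"
    unfolding S_def by measurable
  show ?case
  proof (cases "m \<le> n")
    case True
    have int1: "integrable M (\<lambda>\<omega>. (S \<omega>)\<^sup>2)"
      using S by (intro integrable_const_bound[of _ "B\<^sup>2"] AE_I2) (auto simp: abs_le_square_iff[symmetric] intro: order_trans[OF _ abs_ge_self])
    have int2: "integrable M (\<lambda>\<omega>. S \<omega> * noise h n \<omega>)"
    proof (intro integrable_const_bound[of _ "B * 1"] AE_I2)
      fix \<omega> assume \<omega>: "\<omega> \<in> space M"
      show "norm (S \<omega> * noise h n \<omega>) \<le> B * 1"
        unfolding real_norm_def abs_mult using S[OF \<omega>] abs_noise_le[OF \<omega>]
        by (intro mult_mono) (auto intro: order_trans[OF abs_ge_zero])
    qed simp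
    have n1: "(noise h n \<omega>)\<^sup>2 \<le> 1" if "\<omega> \<in> space M" for \<omega>
      using abs_noise_le[OF that] by (simp add: abs_square_le_1)
    have int3: "integrable M (\<lambda>\<omega>. (noise h n \<omega>)\<^sup>2)"
      using n1 by (intro integrable_const_bound[of _ 1] AE_I2) auto
    have "(\<integral>\<omega>. (\<Sum>k=m..<Suc n. a k * noise h k \<omega>)\<^sup>2 \<partial>M) =
        (\<integral>\<omega>. (S \<omega>)\<^sup>2 + (2 * a n) * (S \<omega> * noise h n \<omega>) + (a n)\<^sup>2 * (noise h n \<omega>)\<^sup>2 \<partial>M)"
    proof -
      have "(\<Sum>k=m..<Suc n. a k * noise h k \<omega>) = S \<omega> + a n * noise h n \<omega>" for \<omega>
        unfolding S_def using True by simp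
      then show ?thesis by (simp only:) (simp add: power2_sum power_mult_distrib ac_simps)
    qed
    also have "\<dots> = (\<integral>\<omega>. (S \<omega>)\<^sup>2 \<partial>M) + (2 * a n) * (\<integral>\<omega>. S \<omega> * noise h n \<omega> \<partial>M)
        + (a n)\<^sup>2 * (\<integral>\<omega>. (noise h n \<omega>)\<^sup>2 \<partial>M)"
      using int1 int2 int3 by simp
    also have "(\<integral>\<omega>. S \<omega> * noise h n \<omega> \<partial>M) = 0"
      unfolding noise_def by (rule expectation_mult_noise[OF SF S])
    also have "(\<integral>\<omega>. (noise h n \<omega>)\<^sup>2 \<partial>M) \<le> 1"
      using int3 n1 by (intro integral_le_const AE_I2) auto
    finally show ?thesis
      using Suc True unfolding S_def by (simp add: mult_left_mono)
  qed simp
qed simp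

text \<open>On the block that starts at j^3 the second moment is of order j^2 times j^(-6), so the
  first absolute moment is of order j^(-2) and the block sums are absolutely summable almost
  surely.\<close>

lemma AE_summable_noise:
  assumes a: "\<And>k. \<bar>a k\<bar> \<le> C / (real k + 1)"
  shows "AE \<omega> in M. summable (\<lambda>k. a k * noise h k \<omega>)"
proof -
  have C: "C \<ge> 0" using order_trans[OF abs_ge_zero a[of 0]] by simp
  define D where "D = (\<lambda>j \<omega>. \<Sum>k=j^3..<Suc j^3. a k * noise h k \<omega>)"
  have [measurable]: "D j \<in> borel_measurable M" for j unfolding D_def by measurable
  have Db: "\<bar>D j \<omega>\<bar> \<le> (\<Sum>k=j^3..<Suc j^3. \<bar>a k\<bar>)" if "\<omega> \<in> space M" for j \<omega>
  proof -
    have "\<bar>D j \<omega>\<bar> \<le> (\<Sum>k=j^3..<Suc j^3. \<bar>a k\<bar> * \<bar>noise h k \<omega>\<bar>)"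
      unfolding D_def by (rule order_trans[OF sum_abs]) (simp add: abs_mult)
    also have "\<dots> \<le> (\<Sum>k=j^3..<Suc j^3. \<bar>a k\<bar> * 1)"
      using abs_noise_le[OF that] by (intro sum_mono mult_left_mono) auto
    finally show ?thesis by simp
  qed
  have int1: "integrable M (\<lambda>\<omega>. \<bar>D j \<omega>\<bar>)" for j
    using Db by (intro integrable_const_bound[of _ "\<Sum>k=j^3..<Suc j^3. \<bar>a k\<bar>"] AE_I2) auto
  have int2: "integrable M (\<lambda>\<omega>. (D j \<omega>)\<^sup>2)" for j
    using Db by (intro integrable_const_bound[of _ "(\<Sum>k=j^3..<Suc j^3. \<bar>a k\<bar>)\<^sup>2"] AE_I2)
      (auto simp: abs_le_square_iff[symmetric] intro: order_trans)
  have D2: "(\<integral>\<omega>. (D j \<omega>)\<^sup>2 \<partial>M) \<le> 48 * C\<^sup>2 / (real j + 1) ^ 4" for j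
  proof -
    have "(\<integral>\<omega>. (D j \<omega>)\<^sup>2 \<partial>M) \<le> (\<Sum>k=j^3..<Suc j^3. (a k)\<^sup>2)"
      unfolding D_def by (rule second_moment_noise_sum_le)
    also have "\<dots> \<le> (\<Sum>k=j^3..<Suc j^3. (C * (4 / (real j + 1) ^ 3))\<^sup>2)"
    proof (intro sum_mono)
      fix k assume "k \<in> {j^3..<Suc j^3}"
      then have "real (j ^ 3) \<le> real k" by (subst of_nat_le_iff) simp
      then have "C / (real k + 1) \<le> C * (1 / (real (j ^ 3) + 1))"
        using C by (simp, intro divide_left_mono mult_pos_pos) (auto intro: add_nonneg_pos)
      also have "\<dots> \<le> C * (4 / (real j + 1) ^ 3)"
        using C by (intro mult_left_mono inverse_cube_add_1_le)
      finally have "\<bar>a k\<bar> \<le> \<bar>C * (4 / (real j + 1) ^ 3)\<bar>" using a[of k] by linarith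
      then show "(a k)\<^sup>2 \<le> (C * (4 / (real j + 1) ^ 3))\<^sup>2" by (simp only: abs_le_square_iff)
    qed
    also have "\<dots> = real (Suc j ^ 3 - j ^ 3) * (16 * C\<^sup>2 / (real j + 1) ^ 6)"
      by (simp add: power_divide power_mult_distrib flip: power_mult)
    also have "\<dots> \<le> (3 * (real j + 1)\<^sup>2) * (16 * C\<^sup>2 / (real j + 1) ^ 6)"
      by (intro mult_right_mono cube_gap_le) auto
    also have "\<dots> = 48 * C\<^sup>2 / (real j + 1) ^ 4"
    proof -
      have "3 * x\<^sup>2 * (16 * C\<^sup>2 / (x ^ 4 * x\<^sup>2)) = 48 * C\<^sup>2 / x ^ 4" if "x > 0" for x :: real
        using that by (simp add: field_simps flip: power_add)
      from this[of "real j + 1"] show ?thesis by (simp flip: power_add)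
    qed
    finally show ?thesis .
  qed
  have "AE \<omega> in M. summable (\<lambda>j. \<bar>D j \<omega>\<bar>)"
  proof (rule AE_summable_if_summable_integral)
    show "summable (\<lambda>j. \<integral>\<omega>. \<bar>D j \<omega>\<bar> \<partial>M)"
    proof (rule summable_comparison_test[OF exI[of _ 0]], safe)
      show "summable (\<lambda>j. (1 / 2 + 24 * C\<^sup>2) * (1 / (real j + 1)\<^sup>2))"
        by (intro summable_mult summable_inverse_Suc_squared)
      fix j :: nat
      \<comment> \<open>This \<open>s\<close> balances the inequality 2 |D| \<le> 1/s + s D^2: both
        terms on the right have mean of order (j + 1)^(-2).\<close>
      define s where "s = (real j + 1)\<^sup>2"
      have s: "s > 0" unfolding s_def by simp
      have "\<bar>D j \<omega>\<bar> \<le> 1 / (2 * s) + s / 2 * (D j \<omega>)\<^sup>2" for \<omega>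
      proof -
        have "0 \<le> (1 - s * \<bar>D j \<omega>\<bar>)\<^sup>2 / (2 * s)" using s by simp
        also have "\<dots> = 1 / (2 * s) + s / 2 * (D j \<omega>)\<^sup>2 - \<bar>D j \<omega>\<bar>"
          using s by (simp add: power2_diff power_mult_distrib field_simps power2_eq_square)
        finally show ?thesis by simp
      qed
      then have "(\<integral>\<omega>. \<bar>D j \<omega>\<bar> \<partial>M) \<le> (\<integral>\<omega>. 1 / (2 * s) + s / 2 * (D j \<omega>)\<^sup>2 \<partial>M)"
        using int1 int2 by (intro integral_mono) auto
      also have "\<dots> = 1 / (2 * s) + s / 2 * (\<integral>\<omega>. (D j \<omega>)\<^sup>2 \<partial>M)"
        using int2 by (simp add: prob_space)
      also have "\<dots> \<le> 1 / (2 * s) + s / 2 * (48 * C\<^sup>2 / (real j + 1) ^ 4)"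
        using s D2 by (intro add_left_mono mult_left_mono) auto
      also have "(real j + 1) ^ 4 = s\<^sup>2" unfolding s_def by (simp flip: power_mult)
      also have "1 / (2 * s) + s / 2 * (48 * C\<^sup>2 / s\<^sup>2) = (1 / 2 + 24 * C\<^sup>2) * (1 / s)"
        using s by (simp add: field_simps power2_eq_square)
      finally show "norm (\<integral>\<omega>. \<bar>D j \<omega>\<bar> \<partial>M) \<le> (1 / 2 + 24 * C\<^sup>2) * (1 / (real j + 1)\<^sup>2)"
        by (simp add: s_def)
    qed
  qed (auto simp: int1)
  then show ?thesis
    using AE_space
  proof eventually_elim
    case (elim \<omega>)
    show ?case
    proof (rule summable_if_cube_blocks[where C = C])
      show "summable (\<lambda>j. \<bar>\<Sum>k=j^3..<Suc j^3. a k * noise h k \<omega>\<bar>)" using elim by (simp add: D_def)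
      show "\<bar>a k * noise h k \<omega>\<bar> \<le> C / (real k + 1)" for k
      proof -
        have "\<bar>a k\<bar> * \<bar>noise h k \<omega>\<bar> \<le> \<bar>a k\<bar> * 1"
          using abs_noise_le[of \<omega> h k] elim by (intro mult_left_mono) auto
        then show ?thesis using a[of k] by (simp add: abs_mult)
      qed
    qed
  qed
qed

end

section \<open>Summable energy\<close>

lemma norm_vec_squared: "(norm (x :: real^'n))\<^sup>2 = (\<Sum>h\<in>UNIV. (x $ h)\<^sup>2)"
  by (simp add: norm_vec_def L2_set_def sum_nonneg)

context continuous_system
begin

lemma r_le: obtains C where "\<And>n. r n \<le> C / (real n + 1)"
  using asymp_inverse_le[OF r_lim r_range] by blast

lemma summable_r_squared: "summable (\<lambda>n. (r n)\<^sup>2)"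
proof -
  obtain C where C: "\<And>n. r n \<le> C / (real n + 1)" using r_le by blast
  show ?thesis
  proof (rule summable_comparison_test[OF exI[of _ 0]], safe)
    show "summable (\<lambda>n. C\<^sup>2 * (1 / (real n + 1)\<^sup>2))"
      by (intro summable_mult summable_inverse_Suc_squared)
    fix n
    have "(r n)\<^sup>2 \<le> (C / (real n + 1))\<^sup>2" using C r_range[of n] by (intro power_mono) auto
    then show "norm ((r n)\<^sup>2) \<le> C\<^sup>2 * (1 / (real n + 1)\<^sup>2)" by (simp add: power_divide)
  qed
qed

lemma AE_summable_r_noise: "AE \<omega> in M. \<forall>h. summable (\<lambda>k. r k * noise h k \<omega>)"
proof -
  obtain C where C: "\<And>n. r n \<le> C / (real n + 1)" using r_le by blast
  then have "\<bar>r n\<bar> \<le> C / (real n + 1)" for n using r_range[of n] by auto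
  then show ?thesis unfolding AE_all_countable by (blast intro: AE_summable_noise)
qed

lemma Z_Suc_noise:
  assumes "\<omega> \<in> space M"
  shows "Z (Suc n) \<omega> = Z n \<omega> + r n *\<^sub>R (drift \<alpha> \<beta> q f (Z n \<omega>) + (\<chi> h. noise h n \<omega>))"
  by (simp add: vec_eq_iff Z_Suc[OF assms] drift_nth noise_def algebra_simps)

text \<open>\<open>W\<close> enters through a one-sided second order bound with the drift as its
  gradient. Along one step the noise term has mean zero because the drift is known at time
  \<open>n\<close>; the bounds telescope, and boundedness of \<open>W\<close> on the cube bounds the
  expected energy.\<close>

lemma AE_summable_drift:
  fixes W :: "real^'n \<Rightarrow> real"
  assumes W: "W \<in> borel_measurable borel"
    and Wb: "\<And>z. (\<And>h. z $ h \<in> {0..1}) \<Longrightarrow> \<bar>W z\<bar> \<le> B"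
    and Taylor: "\<And>z z'. (\<And>h. z $ h \<in> {0..1}) \<Longrightarrow> (\<And>h. z' $ h \<in> {0..1}) \<Longrightarrow>
        W z' \<ge> W z + drift \<alpha> \<beta> q f z \<bullet> (z' - z) - K * (norm (z' - z))\<^sup>2"
    and K: "K \<ge> 0"
  shows "AE \<omega> in M. summable (\<lambda>n. r n * (norm (drift \<alpha> \<beta> q f (Z n \<omega>)))\<^sup>2)"
proof -
  let ?b = "\<lambda>n \<omega>. drift \<alpha> \<beta> q f (Z n \<omega>)"
  have W': "integrable M (\<lambda>\<omega>. W (Z n \<omega>))" for n
    using W Z_range Wb by (intro integrable_const_bound[of _ B] AE_I2) (auto intro!: measurable_compose[OF Z_measurable])
  have bh: "(\<lambda>\<omega>. ?b n \<omega> $ h) \<in> borel_measurable (F n)" for n h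
  proof -
    have [measurable]: "Z n \<in> borel_measurable (F n)" by (rule Z_history)
    show ?thesis unfolding drift_nth using rate_Z_history[of n h] by measurable
  qed
  have b1: "\<bar>?b n \<omega> $ h\<bar> \<le> 1" if "\<omega> \<in> space M" for n \<omega> h
    using rate_Z_range[OF that, of n h] Z_range[OF that, of n h] by (auto simp: drift_nth)
  have [measurable]: "(\<lambda>\<omega>. ?b n \<omega> $ h) \<in> borel_measurable M" for n h
    by (rule measurable_from_subalg[OF subalgebra_history bh])
  have bm [measurable]: "?b n \<in> borel_measurable M" for n by (rule measurable_vec) simp
  have bn: "(norm (?b n \<omega>))\<^sup>2 \<le> CARD('n)" if "\<omega> \<in> space M" for n \<omega>
  proof -
    have "(norm (?b n \<omega>))\<^sup>2 = (\<Sum>h\<in>UNIV. (?b n \<omega> $ h)\<^sup>2)"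
      by (rule norm_vec_squared)
    also have "\<dots> \<le> (\<Sum>h\<in>(UNIV :: 'n set). 1)"
      using b1[OF that] by (intro sum_mono) (simp add: abs_square_le_1)
    finally show ?thesis by simp
  qed
  have int: "integrable M (\<lambda>\<omega>. (norm (?b n \<omega>))\<^sup>2)" for n
    using bn by (intro integrable_const_bound[of _ "CARD('n)"] AE_I2) auto
  have intn: "integrable M (\<lambda>\<omega>. ?b n \<omega> $ h * noise h n \<omega>)" for n h
  proof (intro integrable_const_bound[of _ "1 * 1"] AE_I2)
    fix \<omega> assume \<omega>: "\<omega> \<in> space M"
    show "norm (?b n \<omega> $ h * noise h n \<omega>) \<le> 1 * 1"
      unfolding real_norm_def abs_mult using b1[OF \<omega>] abs_noise_le[OF \<omega>] by (intro mult_mono) auto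
  qed simp
  have cross: "(\<integral>\<omega>. ?b n \<omega> $ h * noise h n \<omega> \<partial>M) = 0" for n h
    unfolding noise_def by (rule expectation_mult_noise[OF bh b1])
  have step: "r n * (\<integral>\<omega>. (norm (?b n \<omega>))\<^sup>2 \<partial>M) \<le>
      (\<integral>\<omega>. W (Z (Suc n) \<omega>) \<partial>M) - (\<integral>\<omega>. W (Z n \<omega>) \<partial>M) + K * CARD('n) * (r n)\<^sup>2" for n
  proof -
    have "(\<integral>\<omega>. W (Z n \<omega>) + r n * (norm (?b n \<omega>))\<^sup>2 + r n * (\<Sum>h\<in>UNIV. ?b n \<omega> $ h * noise h n \<omega>)
        - K * CARD('n) * (r n)\<^sup>2 \<partial>M) \<le> (\<integral>\<omega>. W (Z (Suc n) \<omega>) \<partial>M)"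
    proof (intro integral_mono)
      fix \<omega> assume \<omega>: "\<omega> \<in> space M"
      let ?d = "Z (Suc n) \<omega> - Z n \<omega>"
      have d: "?d = r n *\<^sub>R (?b n \<omega> + (\<chi> h. noise h n \<omega>))" using Z_Suc_noise[OF \<omega>, of n] by simp
      have "?b n \<omega> \<bullet> ?d = r n * (norm (?b n \<omega>))\<^sup>2 + r n * (\<Sum>h\<in>UNIV. ?b n \<omega> $ h * noise h n \<omega>)"
        unfolding d by (simp add: inner_add_right power2_norm_eq_inner algebra_simps) (simp add: inner_vec_def)
      moreover have "(norm ?d)\<^sup>2 \<le> CARD('n) * (r n)\<^sup>2"
      proof -
        have "(norm ?d)\<^sup>2 = (\<Sum>h\<in>UNIV. (?d $ h)\<^sup>2)"
          by (rule norm_vec_squared)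
        also have "\<dots> \<le> (\<Sum>h\<in>(UNIV :: 'n set). (r n)\<^sup>2)"
        proof (intro sum_mono)
          fix h
          have "?d $ h = r n * (I (Suc n) \<omega> $ h - Z n \<omega> $ h)"
            by (simp add: Z_Suc[OF \<omega>] algebra_simps)
          moreover have "(I (Suc n) \<omega> $ h - Z n \<omega> $ h)\<^sup>2 \<le> 1"
            unfolding abs_square_le_1 using I_range[OF \<omega>, of n h] Z_range[OF \<omega>, of n h] by auto
          ultimately show "(?d $ h)\<^sup>2 \<le> (r n)\<^sup>2"
            by (simp add: power_mult_distrib mult_left_le)
        qed
        finally show ?thesis by simp
      qed
      then have "K * (norm ?d)\<^sup>2 \<le> K * CARD('n) * (r n)\<^sup>2" using mult_left_mono[OF _ K] by (simp add: mult.assoc)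
      moreover have "W (Z (Suc n) \<omega>) \<ge> W (Z n \<omega>) + ?b n \<omega> \<bullet> ?d - K * (norm ?d)\<^sup>2"
        by (intro Taylor Z_range \<omega>)
      ultimately show "W (Z n \<omega>) + r n * (norm (?b n \<omega>))\<^sup>2 + r n * (\<Sum>h\<in>UNIV. ?b n \<omega> $ h * noise h n \<omega>)
        - K * CARD('n) * (r n)\<^sup>2 \<le> W (Z (Suc n) \<omega>)" by linarith
    qed (use W' int intn in auto)
    then show ?thesis using W' int intn by (simp add: cross prob_space)
  qed
  show ?thesis
  proof (rule AE_summable_if_summable_integral)
    show "integrable M (\<lambda>\<omega>. r n * (norm (?b n \<omega>))\<^sup>2)" for n using int by simp
    show "0 \<le> r n * (norm (?b n \<omega>))\<^sup>2" for n \<omega> using r_range[of n] by simp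
    have "(\<Sum>k\<le>n. r k * (\<integral>\<omega>. (norm (?b k \<omega>))\<^sup>2 \<partial>M)) \<le> 2 * B + K * CARD('n) * (\<Sum>k. (r k)\<^sup>2)" for n
    proof -
      have WB: "\<bar>\<integral>\<omega>. W (Z k \<omega>) \<partial>M\<bar> \<le> B" for k
      proof -
        have "\<bar>\<integral>\<omega>. W (Z k \<omega>) \<partial>M\<bar> \<le> (\<integral>\<omega>. \<bar>W (Z k \<omega>)\<bar> \<partial>M)" by (rule integral_abs_bound)
        also have "\<dots> \<le> B" using W' Wb Z_range by (intro integral_le_const AE_I2) auto
        finally show ?thesis .
      qed
      have "(\<Sum>k\<le>n. r k * (\<integral>\<omega>. (norm (?b k \<omega>))\<^sup>2 \<partial>M)) \<le>
        (\<Sum>k\<le>n. (\<integral>\<omega>. W (Z (Suc k) \<omega>) \<partial>M) - (\<integral>\<omega>. W (Z k \<omega>) \<partial>M) + K * CARD('n) * (r k)\<^sup>2)"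
        by (intro sum_mono step)
      also have "\<dots> = (\<integral>\<omega>. W (Z (Suc n) \<omega>) \<partial>M) - (\<integral>\<omega>. W (Z 0 \<omega>) \<partial>M) + K * CARD('n) * (\<Sum>k\<le>n. (r k)\<^sup>2)"
        by (induction n) (simp_all add: algebra_simps)
      also have "\<dots> \<le> 2 * B + K * CARD('n) * (\<Sum>k. (r k)\<^sup>2)"
        using WB[of "Suc n"] WB[of 0] K
        by (intro add_mono mult_left_mono sum_le_suminf summable_r_squared) auto
      finally show ?thesis .
    qed
    then show "summable (\<lambda>n. \<integral>\<omega>. r n * (norm (?b n \<omega>))\<^sup>2 \<partial>M)"
      using r_range by (intro bounded_imp_summable) (auto intro!: mult_nonneg_nonneg)
  qed
qed

end

section \<open>The process leaves an expanding region\<close>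

lemma stay_prob_measurable:
  fixes U :: "(real^'n) set"
  assumes U: "closed U" and p: "\<And>h. (\<lambda>z. p z h) \<in> borel_measurable borel"
    and p01: "\<And>z h. z \<in> U \<Longrightarrow> p z h \<in> {0..1}"
  shows "stay_prob p r U (\<lambda>_. 0) j k \<in> borel_measurable borel"
proof (induction j arbitrary: k)
  case 0
  have [measurable]: "U \<in> sets borel" using U by simp
  show ?case by simp
next
  case (Suc j)
  have [measurable]: "U \<in> sets borel" using U by simp
  \<comment> \<open>Inside \<open>U\<close> the expectation becomes a finite sum with explicit
    products, which are measurable in \<open>z\<close>; outside \<open>U\<close> both sides
    vanish.\<close>
  have eq: "stay_prob p r U (\<lambda>_. 0) (Suc j) k z = indicator U z *
      (\<Sum>i\<in>UNIV. (\<Prod>h\<in>UNIV. if i h then p z h else 1 - p z h) *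
        stay_prob p r U (\<lambda>_. 0) j (Suc k) (urn_step (r k) z i))" for z
    by (cases "z \<in> U") (auto simp: expectation_finite_type pmf_flips[OF p01])
  have [measurable]: "(\<lambda>z. stay_prob p r U (\<lambda>_. 0) j (Suc k) (urn_step (r k) z i)) \<in> borel_measurable borel" for i
    by (rule measurable_compose[OF _ Suc]) (rule measurable_vec, simp add: urn_step_def)
  have [measurable]: "(\<lambda>z. if b then p z h else 1 - p z h) \<in> borel_measurable borel" for b h
    using p[of h] by (cases b) auto
  show ?case unfolding eq by measurable
qed

context continuous_system
begin

text \<open>Identifies the recursion with the actual process. The history event \<open>B\<close> is
  general because each induction step absorbs the event that \<open>Z k\<close> lies in
  \<open>U\<close> into it and passes to the history at the next time.\<close>

lemma prob_stay:
  fixes U :: "(real^'n) set"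
  assumes U: "closed U" and cube: "\<And>z h. z \<in> U \<Longrightarrow> z $ h \<in> {0..1}" and B: "B \<in> sets (F k)"
  shows "prob (B \<inter> {\<omega> \<in> space M. \<forall>l\<in>{k..k+j}. Z l \<omega> \<in> U}) =
    (\<integral>\<omega>. indicator B \<omega> * stay_prob p r U (\<lambda>_. 0) j k (Z k \<omega>) \<partial>M)"
  using B
proof (induction j arbitrary: k B)
  case 0
  have [measurable]: "U \<in> sets borel" using U by simp
  have [measurable]: "B \<in> sets M" using 0 by (rule sets_historyD)
  have "(\<integral>\<omega>. indicator B \<omega> * stay_prob p r U (\<lambda>_. 0) 0 k (Z k \<omega>) \<partial>M) =
      (\<integral>\<omega>. indicator (B \<inter> {\<omega> \<in> space M. Z k \<omega> \<in> U}) \<omega> \<partial>M)"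
    by (intro Bochner_Integration.integral_cong) (auto simp: indicator_def)
  also have "\<dots> = prob ((B \<inter> {\<omega> \<in> space M. Z k \<omega> \<in> U}) \<inter> space M)"
    by (rule Bochner_Integration.integral_indicator)
  also have "(B \<inter> {\<omega> \<in> space M. Z k \<omega> \<in> U}) \<inter> space M = B \<inter> {\<omega> \<in> space M. Z k \<omega> \<in> U}" by auto
  finally show ?case by simp
next
  case (Suc j)
  define B' where "B' = B \<inter> {\<omega> \<in> space M. Z k \<omega> \<in> U}"
  have "{\<omega> \<in> space (F k). Z k \<omega> \<in> U} \<in> sets (F k)"
    using Z_history[of k] U by (intro measurable_sets_Collect[of "Z k"] ) auto
  then have B': "B' \<in> sets (F k)" unfolding B'_def using Suc.prems by auto
  have "{k..k + Suc j} = insert k {Suc k..Suc k + j}" by auto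
  then have "B \<inter> {\<omega> \<in> space M. \<forall>l\<in>{k..k + Suc j}. Z l \<omega> \<in> U} =
      B' \<inter> {\<omega> \<in> space M. \<forall>l\<in>{Suc k..Suc k + j}. Z l \<omega> \<in> U}"
    unfolding B'_def by auto
  then have "prob (B \<inter> {\<omega> \<in> space M. \<forall>l\<in>{k..k + Suc j}. Z l \<omega> \<in> U}) =
    (\<integral>\<omega>. indicator B' \<omega> * stay_prob p r U (\<lambda>_. 0) j (Suc k) (Z (Suc k) \<omega>) \<partial>M)"
    using Suc.IH[OF sets_history_mono[OF B']] by simp
  also have "\<dots> = (\<integral>\<omega>. indicator B' \<omega> * measure_pmf.expectation (flips (p (Z k \<omega>)))
        (\<lambda>i. stay_prob p r U (\<lambda>_. 0) j (Suc k) (urn_step (r k) (Z k \<omega>) i)) \<partial>M)"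
  proof (rule expectation_next_state[where B = 1 and C = 1])
    show "indicator B' \<in> borel_measurable (F k)" using B' by simp
    show "stay_prob p r U (\<lambda>_. 0) j (Suc k) \<in> borel_measurable borel"
      by (rule stay_prob_measurable[OF U rate_measurable]) (intro rate_range cube)
    show "\<bar>stay_prob p r U (\<lambda>_. 0) j (Suc k) z\<bar> \<le> 1" for z
      using stay_prob_bounds[of p r U "\<lambda>_. 0" j "Suc k" z] by simp
  qed (auto simp: indicator_def)
  also have "\<dots> = (\<integral>\<omega>. indicator B \<omega> * stay_prob p r U (\<lambda>_. 0) (Suc j) k (Z k \<omega>) \<partial>M)"
    by (intro Bochner_Integration.integral_cong) (auto simp: B'_def indicator_def)
  finally show ?case .
qed

text \<open>With \<open>S\<close> the event of staying forever and \<open>E m\<close> that of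
  staying up to time \<open>m\<close>, the uniform escape bound gives prob S \<le> (1 - \<epsilon>)
  prob (E m) for late \<open>m\<close>. As prob (E m) tends to prob S, the latter is zero.\<close>

lemma AE_leaves_expanding_region:
  fixes U :: "(real^'n) set"
  assumes U: "closed U" and urn: "expanding_urn p r U v \<mu> c"
  shows "AE \<omega> in M. \<not> (\<forall>l\<ge>n. Z l \<omega> \<in> U)"
proof -
  interpret expanding_urn p r U v \<mu> c by (rule urn)
  define E where "E = (\<lambda>m. {\<omega> \<in> space M. \<forall>l\<in>{n..m}. Z l \<omega> \<in> U})"
  define S where "S = {\<omega> \<in> space M. \<forall>l\<ge>n. Z l \<omega> \<in> U}"
  have [measurable]: "U \<in> sets borel" using U by simp
  have EM [measurable]: "E m \<in> sets M" for m unfolding E_def by measurable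
  have SE: "S = (\<Inter>m. E m)" unfolding S_def E_def by auto (metis atLeastAtMost_iff order_refl)
  have SM [measurable]: "S \<in> sets M" unfolding SE by measurable
  have dec: "decseq E" unfolding E_def decseq_def by auto
  have lim: "(\<lambda>m. prob (E m)) \<longlonglongrightarrow> prob S"
    unfolding SE using EM dec by (intro finite_Lim_measure_decseq) auto
  have "prob S = 0"
  proof (rule ccontr)
    assume "prob S \<noteq> 0"
    then have S: "prob S > 0" using measure_nonneg[of M S] by linarith
    obtain \<epsilon> n0 where \<epsilon>: "\<epsilon> > 0" and n0: "\<And>m. m \<ge> n0 \<Longrightarrow> \<exists>j. \<forall>z\<in>U. stay (\<lambda>_. 0) j m z \<le> 1 - \<epsilon>"
      using stay_le[OF r_lim] by blast
    have "(\<lambda>m. (1 - \<epsilon>) * prob (E m)) \<longlonglongrightarrow> (1 - \<epsilon>) * prob S" by (intro tendsto_intros lim)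
    moreover have "(1 - \<epsilon>) * prob S < prob S" using S \<epsilon> by (simp add: algebra_simps)
    ultimately have "eventually (\<lambda>m. (1 - \<epsilon>) * prob (E m) < prob S) sequentially" by (rule order_tendstoD)
    \<comment> \<open>Approximating \<open>S\<close> by the event \<open>E m\<close> of the history at time \<open>m\<close> makes the martingale 0-1 law
      unnecessary.\<close>
    then obtain m where m: "m \<ge> max n n0" "(1 - \<epsilon>) * prob (E m) < prob S"
      unfolding eventually_sequentially by (meson max.cobounded1 max.cobounded2)
    obtain j where j: "\<And>z. z \<in> U \<Longrightarrow> stay (\<lambda>_. 0) j m z \<le> 1 - \<epsilon>" using n0[of m] m by auto
    have EF: "E m \<in> sets (F m)"
    proof -
      have "{\<omega> \<in> space (F m). Z l \<omega> \<in> U} \<in> sets (F m)" if "l \<le> m" for l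
      proof -
        have "sets (F l) \<subseteq> sets (F m)"
          by (rule lift_Suc_mono_le[of "\<lambda>k. sets (F k)", OF _ that]) (rule subsetI, rule sets_history_mono)
        moreover have "{\<omega> \<in> space (F l). Z l \<omega> \<in> U} \<in> sets (F l)"
          using Z_history[of l] U by (intro measurable_sets_Collect[of "Z l"]) auto
        ultimately show ?thesis by auto
      qed
      then have "{\<omega> \<in> space (F m). \<forall>l\<in>{n..m}. Z l \<omega> \<in> U} \<in> sets (F m)"
        by (intro sets.sets_Collect_finite_All) auto
      then show ?thesis unfolding E_def by simp
    qed
    have "{n..m+j} = {n..m} \<union> {m..m+j}" using m by auto
    then have "E (m + j) = E m \<inter> {\<omega> \<in> space M. \<forall>l\<in>{m..m+j}. Z l \<omega> \<in> U}" unfolding E_def by auto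
    then have "prob (E (m + j)) = (\<integral>\<omega>. indicator (E m) \<omega> * stay (\<lambda>_. 0) j m (Z m \<omega>) \<partial>M)"
      using prob_stay[OF U U_cube EF, of j] by simp
    also have "\<dots> \<le> (\<integral>\<omega>. (1 - \<epsilon>) * indicator (E m) \<omega> \<partial>M)"
    proof (rule integral_mono)
      have [measurable]: "(\<lambda>\<omega>. stay (\<lambda>_. 0) j m (Z m \<omega>)) \<in> borel_measurable M"
        by (rule measurable_compose[OF Z_measurable stay_prob_measurable[OF U rate_measurable]])
          (intro rate_range U_cube)
      show "integrable M (\<lambda>\<omega>. indicator (E m) \<omega> * stay (\<lambda>_. 0) j m (Z m \<omega>))"
        using stay_prob_bounds[of p r U "\<lambda>_. 0" j m]
        by (intro integrable_const_bound[of _ 1] AE_I2) (auto simp: indicator_def)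
      show "integrable M (\<lambda>\<omega>. (1 - \<epsilon>) * indicator (E m) \<omega>)"
        by (intro integrable_mult_right integrable_const_bound[of _ 1] AE_I2) auto
      show "indicator (E m) \<omega> * stay (\<lambda>_. 0) j m (Z m \<omega>) \<le> (1 - \<epsilon>) * indicator (E m) \<omega>" for \<omega>
        using j[of "Z m \<omega>"] m by (auto simp: indicator_def E_def)
    qed
    also have "\<dots> = (1 - \<epsilon>) * prob (E m)"
      using sets.sets_into_space[OF EM[of m]] by (simp add: Int_absorb2)
    also have "\<dots> < prob S" by (rule m)
    also have "prob S \<le> prob (E (m + j))" unfolding SE by (intro finite_measure_mono) auto
    finally show False by simp
  qed
  then have "AE \<omega> in M. \<omega> \<notin> S" using SM by (subst (asm) prob_eq_0) auto
  then show ?thesis using AE_space by eventually_elim (auto simp: S_def)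
qed

end

section \<open>Limits of perturbed gradient trajectories\<close>

text \<open>Around a point where \<open>b\<close> does not vanish the trajectory can neither stay, because \<open>r\<close> is not
  summable, nor leave, because leaving costs a fixed amount of the convergent series \<open>r |b|\<^sup>2\<close>.\<close>

lemma limit_points_are_zeros:
  fixes z e :: "nat \<Rightarrow> 'a::euclidean_space" and b :: "'a \<Rightarrow> 'a"
  assumes step: "\<And>n. z (Suc n) = z n + r n *\<^sub>R (b (z n) + e n)"
    and r: "\<And>n. r n \<ge> 0" "\<not> summable r"
    and noise: "summable (\<lambda>n. r n *\<^sub>R e n)"
    and energy: "summable (\<lambda>n. r n * (norm (b (z n)))\<^sup>2)"
    and cont: "isCont b \<xi>"
    and limit: "\<And>\<delta>. \<delta> > 0 \<Longrightarrow> \<exists>\<^sub>F n in sequentially. dist (z n) \<xi> < \<delta>"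
  shows "b \<xi> = 0"
proof (rule ccontr)
  assume nz: "b \<xi> \<noteq> 0"
  define \<eta> where "\<eta> = norm (b \<xi>) / 2"
  have \<eta>: "\<eta> > 0" using nz by (simp add: \<eta>_def)
  \<comment> \<open>The radius 2 \<rho> has room for a start within \<rho>, a drift of at most
    \<rho>/2 and noise of less than \<rho>/2.\<close>
  obtain \<rho> where \<rho>: "\<rho> > 0" "\<And>x. dist x \<xi> < 2 * \<rho> \<Longrightarrow> norm (b x) \<ge> \<eta>"
  proof -
    obtain d where d: "d > 0" "\<And>x. dist x \<xi> < d \<Longrightarrow> dist (b x) (b \<xi>) < \<eta>"
      using cont \<eta> unfolding continuous_at_eps_delta by blast
    show thesis
    proof (rule that[of "d / 2"])
      fix x assume "dist x \<xi> < 2 * (d / 2)"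
      then have "norm (b x - b \<xi>) < \<eta>" using d(2)[of x] by (simp add: dist_norm)
      moreover have "norm (b \<xi>) \<le> norm (b x) + norm (b x - b \<xi>)"
        using norm_triangle_ineq4[of "b x" "b x - b \<xi>"] by simp
      ultimately show "norm (b x) \<ge> \<eta>" unfolding \<eta>_def by simp
    qed (use d in simp)
  qed
  have "Cauchy (\<lambda>n. \<Sum>k<n. r k *\<^sub>R e k)"
    using noise unfolding summable_iff_convergent Cauchy_convergent_iff .
  then obtain n1 where n1: "\<And>m n. m \<ge> n1 \<Longrightarrow> n \<ge> n1 \<Longrightarrow>
      norm ((\<Sum>k<m. r k *\<^sub>R e k) - (\<Sum>k<n. r k *\<^sub>R e k)) < \<rho> / 2"
    using CauchyD[of "\<lambda>n. \<Sum>k<n. r k *\<^sub>R e k" "\<rho> / 2"] \<rho>(1) by auto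
  have "Cauchy (\<lambda>n. \<Sum>k<n. r k * (norm (b (z k)))\<^sup>2)"
    using energy unfolding summable_iff_convergent Cauchy_convergent_iff .
  then obtain n2 where n2: "\<And>m n. m \<ge> n2 \<Longrightarrow> n \<ge> n2 \<Longrightarrow>
      norm ((\<Sum>k<m. r k * (norm (b (z k)))\<^sup>2) - (\<Sum>k<n. r k * (norm (b (z k)))\<^sup>2)) < \<rho> / 2 * \<eta>"
    using CauchyD[of "\<lambda>n. \<Sum>k<n. r k * (norm (b (z k)))\<^sup>2" "\<rho> / 2 * \<eta>"] \<rho>(1) \<eta> by auto
  obtain n where n: "n \<ge> max n1 n2" "dist (z n) \<xi> < \<rho>"
    using limit[OF \<rho>(1)] unfolding frequently_sequentially by blast
  have sums: "(\<Sum>k=n..<m. f k) = (\<Sum>k<m. f k) - (\<Sum>k<n. f k)" if "m \<ge> n" for m and f :: "nat \<Rightarrow> 'b::real_normed_vector"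
    using that by (simp add: lessThan_atLeast0 sum_diff_nat_ivl)
  have near: "dist (z m) \<xi> < 2 * \<rho>" if "m \<ge> n" for m
    using that
  proof (induction m rule: less_induct)
    case (less m)
    have ge: "norm (b (z k)) \<ge> \<eta>" if "k \<in> {n..<m}" for k
      using that less \<rho>(2) by auto
    have zm: "z m = z n + (\<Sum>k=n..<m. r k *\<^sub>R b (z k)) + (\<Sum>k=n..<m. r k *\<^sub>R e k)"
      using less.prems
    proof (induction m rule: dec_induct)
      case (step m)
      then show ?case by (simp add: assms(1) scaleR_add_right)
    qed simp
    have "norm (\<Sum>k=n..<m. r k *\<^sub>R b (z k)) \<le> (\<Sum>k=n..<m. r k * norm (b (z k)))"
      using r by (intro order_trans[OF norm_sum] sum_mono) simp
    \<comment> \<open>Inside the ball |b| \<ge> \<eta>, so the length of the drift path is at most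
      its energy divided by \<eta>.\<close>
    also have "\<dots> \<le> (\<Sum>k=n..<m. r k * (norm (b (z k)))\<^sup>2 / \<eta>)"
    proof (intro sum_mono)
      fix k assume "k \<in> {n..<m}"
      then have "norm (b (z k)) * \<eta> \<le> norm (b (z k)) * norm (b (z k))"
        using ge by (intro mult_left_mono) auto
      then have "norm (b (z k)) \<le> (norm (b (z k)))\<^sup>2 / \<eta>" using \<eta> by (simp add: field_simps power2_eq_square)
      then show "r k * norm (b (z k)) \<le> r k * (norm (b (z k)))\<^sup>2 / \<eta>"
        using r(1)[of k] mult_left_mono by fastforce
    qed
    also have "\<dots> = (\<Sum>k=n..<m. r k * (norm (b (z k)))\<^sup>2) / \<eta>" by (simp add: sum_divide_distrib)
    also have "\<dots> \<le> \<rho> / 2"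
    proof -
      have "norm ((\<Sum>k<m. r k * (norm (b (z k)))\<^sup>2) - (\<Sum>k<n. r k * (norm (b (z k)))\<^sup>2)) < \<rho> / 2 * \<eta>"
        using n less.prems by (intro n2) auto
      then have "(\<Sum>k=n..<m. r k * (norm (b (z k)))\<^sup>2) \<le> \<rho> / 2 * \<eta>"
        unfolding sums[OF less.prems] real_norm_def by linarith
      then show ?thesis using \<eta> by (simp add: divide_le_eq)
    qed
    finally have "norm (\<Sum>k=n..<m. r k *\<^sub>R b (z k)) \<le> \<rho> / 2" .
    moreover have "norm (\<Sum>k=n..<m. r k *\<^sub>R e k) < \<rho> / 2"
      using n1[of m n] n less.prems by (simp add: sums)
    moreover have "dist (z m) \<xi> \<le> dist (z n) \<xi> + norm (\<Sum>k=n..<m. r k *\<^sub>R b (z k)) + norm (\<Sum>k=n..<m. r k *\<^sub>R e k)"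
    proof -
      have "z m - \<xi> = (z n - \<xi>) + (\<Sum>k=n..<m. r k *\<^sub>R b (z k)) + (\<Sum>k=n..<m. r k *\<^sub>R e k)"
        unfolding zm by simp
      then show ?thesis
        unfolding dist_norm by (simp only:) (intro norm_triangle_le add_right_mono norm_triangle_ineq)
    qed
    ultimately show ?case using n by linarith
  qed
  have "summable (\<lambda>k. r k * \<eta>\<^sup>2)"
  proof (rule summable_comparison_test[OF exI[of _ n] energy], safe)
    fix k assume "n \<le> k"
    then have "\<eta>\<^sup>2 \<le> (norm (b (z k)))\<^sup>2" using \<rho>(2)[OF near] \<eta> by (intro power_mono) auto
    then show "norm (r k * \<eta>\<^sup>2) \<le> r k * (norm (b (z k)))\<^sup>2" using r(1)[of k] by (simp add: mult_left_mono)
  qed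
  from summable_mult2[OF this, of "inverse (\<eta>\<^sup>2)"] have "summable r" using \<eta> by (simp add: mult.assoc)
  then show False using r(2) by simp
qed

text \<open>In a compact set, vanishing increments make the set of limit points connected, so a
  finite one is a single point. Concretely, an annulus around one limit point contains no other, so
  it is visited finitely often, and short steps cannot jump across it.\<close>

lemma converges_if_finitely_many_limit_points:
  fixes z :: "nat \<Rightarrow> 'a::euclidean_space"
  assumes K: "compact K" "\<And>n. z n \<in> K" and S: "finite S"
    and limit: "\<And>\<xi>. \<xi> \<in> K \<Longrightarrow> (\<And>\<delta>. \<delta> > 0 \<Longrightarrow> \<exists>\<^sub>F n in sequentially. dist (z n) \<xi> < \<delta>) \<Longrightarrow> \<xi> \<in> S"
    and inc: "(\<lambda>n. z (Suc n) - z n) \<longlonglongrightarrow> 0"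
  shows "\<exists>\<xi>\<in>S. z \<longlonglongrightarrow> \<xi>"
proof -
  have cluster: "\<exists>\<xi>\<in>C. \<forall>\<delta>>0. \<exists>\<^sub>F n in sequentially. dist (z n) \<xi> < \<delta>"
    if C: "compact C" and fr: "\<exists>\<^sub>F n in sequentially. z n \<in> C" for C
  proof -
    obtain s :: "nat \<Rightarrow> nat" where s: "strict_mono s" "\<And>n. z (s n) \<in> C"
    proof -
      have "infinite {n. z n \<in> C}" using fr by (simp add: frequently_cofinite cofinite_eq_sequentially[symmetric])
      then show thesis
        using that[of "enumerate {n. z n \<in> C}"] strict_mono_enumerate enumerate_in_set by blast
    qed
    obtain \<xi> t where t: "\<xi> \<in> C" "strict_mono t" "((z \<circ> s) \<circ> t) \<longlonglongrightarrow> \<xi>"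
      using C s(2) unfolding compact_def by (metis comp_apply)
    have "\<exists>\<^sub>F n in sequentially. dist (z n) \<xi> < \<delta>" if "\<delta> > 0" for \<delta>
      unfolding frequently_sequentially
    proof
      fix N
      obtain n0 where n0: "\<And>n. n \<ge> n0 \<Longrightarrow> dist (z (s (t n))) \<xi> < \<delta>"
        using t(3) \<open>\<delta> > 0\<close> unfolding lim_sequentially by auto
      have "s (t (max N n0)) \<ge> N"
        using seq_suble[OF strict_mono_o[OF s(1) t(2)], of "max N n0"] by simp
      then show "\<exists>n\<ge>N. dist (z n) \<xi> < \<delta>" using n0[of "max N n0"] by (intro exI[of _ "s (t (max N n0))"]) auto
    qed
    then show ?thesis using t(1) by blast
  qed
  obtain \<xi> where \<xi>: "\<xi> \<in> K" "\<And>\<delta>. \<delta> > 0 \<Longrightarrow> \<exists>\<^sub>F n in sequentially. dist (z n) \<xi> < \<delta>"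
    using cluster[OF K(1)] K(2) by (metis frequently_sequentially order_refl)
  have \<xi>S: "\<xi> \<in> S" using limit \<xi> by blast
  have "z \<longlonglongrightarrow> \<xi>"
  proof (rule metric_LIMSEQ_I)
    fix \<epsilon> :: real assume \<epsilon>: "\<epsilon> > 0"
    obtain d where d: "d > 0" "\<And>x. x \<in> S \<Longrightarrow> x \<noteq> \<xi> \<Longrightarrow> d \<le> dist \<xi> x"
      using finite_set_avoid[OF S, of \<xi>] by blast
    \<comment> \<open>The annulus between the radii \<delta> and 2 \<delta> avoids \<open>S\<close>,
      whose other points have distance at least d > 2 \<delta>, and its width exceeds the late
      increments.\<close>
    define \<delta> where "\<delta> = min \<epsilon> d / 3"
    have \<delta>: "\<delta> > 0" "\<delta> < \<epsilon>" "2 * \<delta> < d" unfolding \<delta>_def using \<epsilon> d by auto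
    define C where "C = K \<inter> (cball \<xi> (2 * \<delta>) - ball \<xi> \<delta>)"
    have "compact C" unfolding C_def
      by (intro compact_Int_closed K closed_Diff) auto
    have "\<not> (\<exists>\<^sub>F n in sequentially. z n \<in> C)"
    proof
      assume "\<exists>\<^sub>F n in sequentially. z n \<in> C"
      then obtain x where x: "x \<in> C" "\<forall>\<delta>>0. \<exists>\<^sub>F n in sequentially. dist (z n) x < \<delta>"
        using cluster[OF \<open>compact C\<close>] by blast
      then have "x \<in> S" using limit unfolding C_def by blast
      then show False using d(2)[of x] x(1) \<delta> unfolding C_def by (cases "x = \<xi>") auto
    qed
    then have "eventually (\<lambda>n. z n \<notin> C) sequentially" by (simp add: not_frequently)
    moreover have "eventually (\<lambda>n. norm (z (Suc n) - z n) < \<delta>) sequentially"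
      using inc \<delta>(1) by (auto simp: tendsto_iff)
    ultimately obtain n0 where n0: "\<And>n. n \<ge> n0 \<Longrightarrow> z n \<notin> C \<and> norm (z (Suc n) - z n) < \<delta>"
      unfolding eventually_sequentially by (metis max.bounded_iff)
    obtain n1 where n1: "n1 \<ge> n0" "dist (z n1) \<xi> < \<delta>"
      using \<xi>(2)[OF \<delta>(1)] unfolding frequently_sequentially by blast
    have "dist (z n) \<xi> < \<delta>" if "n \<ge> n1" for n
      using that
    proof (induction n rule: dec_induct)
      case (step n)
      have "dist (z (Suc n)) \<xi> \<le> norm (z (Suc n) - z n) + dist (z n) \<xi>"
        unfolding dist_norm by (metis diff_add_cancel norm_triangle_ineq add_diff_eq)
      also have "\<dots> < 2 * \<delta>" using n0[of n] step n1 by simp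
      finally have "dist (z (Suc n)) \<xi> < 2 * \<delta>" .
      moreover have "z (Suc n) \<notin> C" using n0[of "Suc n"] step n1 by simp
      ultimately show ?case using K(2)[of "Suc n"] by (auto simp: C_def dist_commute)
    qed (rule n1)
    then show "\<exists>n0. \<forall>n\<ge>n0. dist (z n) \<xi> < \<epsilon>" using \<delta>(2) by (meson less_trans)
  qed
  then show ?thesis using \<xi>S by blast
qed

section \<open>Averages of sequences\<close>

lemma Cesaro_mean:
  fixes x :: "nat \<Rightarrow> real"
  assumes "x \<longlonglongrightarrow> L"
  shows "(\<lambda>n. (\<Sum>k<n. x k) / real n) \<longlonglongrightarrow> L"
proof (rule LIMSEQ_I)
  fix \<epsilon> :: real assume \<epsilon>: "\<epsilon> > 0"
  obtain n0 where n0: "\<And>n. n \<ge> n0 \<Longrightarrow> \<bar>x n - L\<bar> < \<epsilon> / 2"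
    using LIMSEQ_D[OF assms, of "\<epsilon> / 2"] \<epsilon> by auto
  define A where "A = (\<Sum>k<n0. \<bar>x k - L\<bar>)"
  have A: "(\<lambda>n. A / real n) \<longlonglongrightarrow> 0" by (rule lim_const_over_n)
  then obtain n1 where n1: "\<And>n. n \<ge> n1 \<Longrightarrow> \<bar>A / real n\<bar> < \<epsilon> / 2"
    using LIMSEQ_D[OF A, of "\<epsilon> / 2"] \<epsilon> by (auto simp: abs_divide)
  show "\<exists>N. \<forall>n\<ge>N. norm ((\<Sum>k<n. x k) / real n - L) < \<epsilon>"
  proof (intro exI allI impI)
    fix n assume n: "n \<ge> Suc (max n0 n1)"
    have "(\<Sum>k<n. x k) / real n - L = (\<Sum>k<n. x k - L) / real n"
      using n by (simp add: sum_subtractf field_simps)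
    also have "\<bar>\<dots>\<bar> \<le> (\<Sum>k<n. \<bar>x k - L\<bar>) / real n"
      by (simp add: divide_right_mono sum_abs)
    also have "(\<Sum>k<n. \<bar>x k - L\<bar>) = A + (\<Sum>k=n0..<n. \<bar>x k - L\<bar>)"
      unfolding A_def using n by (simp add: lessThan_atLeast0 sum.atLeastLessThan_concat)
    also have "(\<Sum>k=n0..<n. \<bar>x k - L\<bar>) \<le> (\<Sum>k=n0..<n. \<epsilon> / 2)"
      using n0 by (intro sum_mono less_imp_le) auto
    also have "\<dots> \<le> real n * (\<epsilon> / 2)" using \<epsilon> by (simp add: mult_right_mono)
    also have "(A + real n * (\<epsilon> / 2)) / real n = A / real n + \<epsilon> / 2" using n by (simp add: field_simps)
    also have "\<dots> < \<epsilon>"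
    proof -
      have "\<bar>A / real n\<bar> < \<epsilon> / 2" using n by (intro n1) simp
      then show ?thesis by linarith
    qed
    finally show "norm ((\<Sum>k<n. x k) / real n - L) < \<epsilon>" by (simp add: divide_right_mono)
  qed
qed

text \<open>Kronecker's lemma for the weights k + 1: by Abel summation the average of
  \<open>x\<close> is the partial sum \<open>s n\<close> minus the Cesaro mean of the earlier
  partial sums, and both tend to the same limit.\<close>

lemma Kronecker_mean:
  fixes x :: "nat \<Rightarrow> real"
  assumes "summable (\<lambda>k. x k / (real k + 1))"
  shows "(\<lambda>n. (\<Sum>k<n. x k) / real n) \<longlonglongrightarrow> 0"
proof -
  define y where "y = (\<lambda>k. x k / (real k + 1))"
  define s where "s = (\<lambda>n. \<Sum>k<n. y k)"
  have x: "x k = (real k + 1) * y k" for k by (simp add: y_def)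
  obtain L where L: "s \<longlonglongrightarrow> L" using assms unfolding summable_iff_convergent convergent_def s_def y_def by blast
  have Abel: "(\<Sum>k<n. x k) = real n * s n - (\<Sum>k<n. s k)" for n
    unfolding x by (induction n) (auto simp: s_def algebra_simps)
  have "(\<lambda>n. s n - (\<Sum>k<n. s k) / real n) \<longlonglongrightarrow> L - L"
    by (intro tendsto_diff L Cesaro_mean)
  moreover have "eventually (\<lambda>n. s n - (\<Sum>k<n. s k) / real n = (\<Sum>k<n. x k) / real n) sequentially"
    using eventually_gt_at_top[of 0] by eventually_elim (simp add: Abel field_simps)
  ultimately show ?thesis by (auto intro: Lim_transform_eventually)
qed

section \<open>The linearized drift and its stable zeros\<close>

lemma f_theta_has_derivative:
  "(f_theta \<theta> has_real_derivative 6 * (2 * \<theta> - 1) * x * (1 - x)) (at x)"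
  unfolding f_theta_def[abs_def]
  by (auto intro!: derivative_eq_intros simp: power2_eq_square algebra_simps)

lemma deriv_f_theta: "deriv (f_theta \<theta>) x = 6 * (2 * \<theta> - 1) * x * (1 - x)"
  by (rule DERIV_imp_deriv[OF f_theta_has_derivative])

lemma f_theta_continuous: "continuous_on S (f_theta \<theta>)"
  unfolding f_theta_def[abs_def] by (intro continuous_intros)

lemma smoothstep_bounds:
  fixes x :: real
  assumes "x \<in> {0..1}"
  shows "3 * x^2 - 2 * x^3 \<in> {0..1}"
proof -
  have "3 * x^2 - 2 * x^3 = x\<^sup>2 * (3 - 2 * x)" "1 - (3 * x^2 - 2 * x^3) = (1 - x)\<^sup>2 * (1 + 2 * x)"
    by (simp_all add: power2_eq_square power3_eq_cube algebra_simps)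
  moreover have "0 \<le> x\<^sup>2 * (3 - 2 * x)" "0 \<le> (1 - x)\<^sup>2 * (1 + 2 * x)"
    using assms by (auto intro!: mult_nonneg_nonneg)
  ultimately show ?thesis by auto
qed

lemma f_theta_bounds:
  assumes "x \<in> {0..1}" "\<theta> > 1/2"
  shows "f_theta \<theta> x \<in> {1 - \<theta>..\<theta>}"
proof -
  have "(2 * \<theta> - 1) * (3 * x^2 - 2 * x^3) \<le> (2 * \<theta> - 1) * 1" "0 \<le> (2 * \<theta> - 1) * (3 * x^2 - 2 * x^3)"
    using smoothstep_bounds[OF assms(1)] assms(2) by (intro mult_left_mono mult_nonneg_nonneg; simp)+
  then show ?thesis unfolding f_theta_def by auto
qed

text \<open>The quadratic form attains its maximum c on the unit sphere at some \<open>v\<close>.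
  The form c |x|^2 - x . T x is nonnegative and vanishes at \<open>v\<close>, so its first variation
  there in the direction y = c v - T v, which is 2 |y|^2, must vanish. The lemma turns the absence
  of positive eigenvalues into a sign of the quadratic form.\<close>

lemma self_adjoint_pos_eigenvalue:
  fixes T :: "'a::euclidean_space \<Rightarrow> 'a"
  assumes T: "linear T" and adj: "\<And>x y. T x \<bullet> y = x \<bullet> T y" and w: "w \<bullet> T w > 0"
  shows "\<exists>c>0. \<exists>v. v \<noteq> 0 \<and> T v = c *\<^sub>R v"
proof -
  have cont: "continuous_on S (\<lambda>x. x \<bullet> T x)" for S
    by (intro continuous_intros linear_continuous_on linear_conv_bounded_linear[THEN iffD1] T)
  have w0: "w \<noteq> 0" using w linear_0[OF T] by auto
  define u where "u = w /\<^sub>R norm w"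
  have u: "u \<in> sphere 0 1" unfolding u_def using w0 by simp
  have uT: "u \<bullet> T u > 0" unfolding u_def using w w0 by (simp add: linear_scale[OF T])
  obtain v where v: "v \<in> sphere 0 1" "\<And>x. x \<in> sphere 0 1 \<Longrightarrow> x \<bullet> T x \<le> v \<bullet> T v"
    using continuous_attains_sup[OF compact_sphere _ cont, of 0 1] u by blast
  define c where "c = v \<bullet> T v"
  have c: "c > 0" using v(2)[OF u] uT unfolding c_def by simp
  have le: "x \<bullet> T x \<le> c * (x \<bullet> x)" for x
  proof (cases "x = 0")
    case False
    have "(x /\<^sub>R norm x) \<bullet> T (x /\<^sub>R norm x) \<le> c"
      unfolding c_def using False by (intro v) simp
    then have "(x \<bullet> T x) / (norm x)\<^sup>2 \<le> c"
      using False by (simp add: linear_scale[OF T] power2_eq_square divide_simps)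
    then show ?thesis using False by (simp add: divide_simps power2_norm_eq_inner)
  qed (simp add: linear_0[OF T])
  define y where "y = c *\<^sub>R v - T v"
  define a b where "a = y \<bullet> y" and "b = c * (y \<bullet> y) - y \<bullet> T y"
  have quad: "2 * t * a + t\<^sup>2 * b \<ge> 0" for t
  proof -
    have "v \<bullet> v = 1" using v(1) by (simp add: norm_eq_1)
    then have "2 * t * a + t\<^sup>2 * b = c * ((v + t *\<^sub>R y) \<bullet> (v + t *\<^sub>R y)) - (v + t *\<^sub>R y) \<bullet> T (v + t *\<^sub>R y)"
      using adj[of v y] c_def unfolding a_def b_def
      by (simp add: linear_add[OF T] linear_scale[OF T] inner_simps power2_eq_square)
         (simp add: y_def inner_simps inner_commute algebra_simps)
    then show ?thesis using le[of "v + t *\<^sub>R y"] by simp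
  qed
  have "a = 0"
  proof (rule ccontr)
    assume "a \<noteq> 0"
    then have a: "a > 0" unfolding a_def by (simp add: inner_gt_zero_iff)
    \<comment> \<open>At t = -s the quadratic term is at most half the size of the negative linear
      one, so \<open>quad\<close> fails.\<close>
    define s where "s = a / (\<bar>b\<bar> + 1)"
    have s: "s > 0" unfolding s_def using a by simp
    have "s * (\<bar>b\<bar> + 1) = a" unfolding s_def by simp
    moreover have "s * (s * b) \<le> s * (s * (\<bar>b\<bar> + 1))" using s by (intro mult_left_mono) auto
    ultimately have "s * (s * b) \<le> s * a" by simp
    then have "2 * (-s) * a + (-s)\<^sup>2 * b \<le> - (s * a)" by (simp add: power2_eq_square algebra_simps)
    also have "\<dots> < 0" using s a by simp
    finally show False using quad[of "-s"] by simp
  qed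
  then have "T v = c *\<^sub>R v" unfolding a_def y_def by simp
  moreover have "v \<noteq> 0" using v(1) by auto
  ultimately show ?thesis using c by blast
qed

definition linearized_drift :: "real \<Rightarrow> real \<Rightarrow> real \<Rightarrow> real^'n \<Rightarrow> real^'n \<Rightarrow> real^'n" where
  "linearized_drift \<alpha> \<beta> \<theta> z v =
     (\<chi> h. \<alpha> * comp_mean v + ((1 - \<alpha> - \<beta>) * (6 * (2 * \<theta> - 1) * z $ h * (1 - z $ h)) - 1) * v $ h)"

lemma comp_mean_add: "comp_mean (x + y) = comp_mean x + comp_mean y"
  by (simp add: comp_mean_def sum.distrib algebra_simps)

lemma comp_mean_scaleR: "comp_mean (c *\<^sub>R x) = c * comp_mean x"
  by (simp add: comp_mean_def flip: sum_distrib_left)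

lemma linear_linearized_drift: "linear (linearized_drift \<alpha> \<beta> \<theta> z)"
  by (rule linearI) (simp_all add: vec_eq_iff linearized_drift_def comp_mean_add comp_mean_scaleR algebra_simps)

lemma linearized_drift_inner:
  fixes x :: "real^'n"
  shows "linearized_drift \<alpha> \<beta> \<theta> z x \<bullet> y = \<alpha> * CARD('n) * comp_mean x * comp_mean y +
    (\<Sum>h\<in>UNIV. ((1 - \<alpha> - \<beta>) * (6 * (2 * \<theta> - 1) * z $ h * (1 - z $ h)) - 1) * (x $ h * y $ h))"
proof -
  have "(\<Sum>h\<in>UNIV. (\<alpha> * m + d h * x $ h) * y $ h) = \<alpha> * CARD('n) * m * comp_mean y + (\<Sum>h\<in>UNIV. d h * (x $ h * y $ h))"
    for m and d :: "'n \<Rightarrow> real"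
    by (simp add: comp_mean_def distrib_right sum.distrib mult.assoc flip: sum_distrib_left)
  then show ?thesis by (simp add: inner_vec_def linearized_drift_def)
qed

lemma linearized_drift_self_adjoint:
  "linearized_drift \<alpha> \<beta> \<theta> z x \<bullet> y = x \<bullet> linearized_drift \<alpha> \<beta> \<theta> z y"
  unfolding inner_commute[of x] linearized_drift_inner by (simp add: ac_simps)

lemma drift_has_derivative:
  "(drift \<alpha> \<beta> q (f_theta \<theta>) has_derivative linearized_drift \<alpha> \<beta> \<theta> z) (at (z :: real^'n))"
proof (subst has_derivative_componentwise_within, intro ballI)
  fix b :: "real^'n" assume "b \<in> Basis"
  then obtain h where b: "b = axis h 1" unfolding Basis_vec_def Basis_real_def by auto
  have f: "((\<lambda>z. f_theta \<theta> (z $ h)) has_derivative (\<lambda>v. 6 * (2 * \<theta> - 1) * z $ h * (1 - z $ h) * v $ h)) (at z)"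
    using has_derivative_compose[OF bounded_linear_imp_has_derivative[OF bounded_linear_vec_nth[of h]]
        f_theta_has_derivative[of \<theta> "z $ h", unfolded has_field_derivative_def]] by simp
  have c: "(comp_mean has_derivative comp_mean) (at z)"
    by (rule linear_imp_has_derivative) (rule linearI, simp_all add: comp_mean_add comp_mean_scaleR)
  have n: "((\<lambda>z. z $ h) has_derivative (\<lambda>v. v $ h)) (at z)"
    by (rule bounded_linear_imp_has_derivative[OF bounded_linear_vec_nth])
  show "((\<lambda>x. drift \<alpha> \<beta> q (f_theta \<theta>) x \<bullet> b) has_derivative (\<lambda>x. linearized_drift \<alpha> \<beta> \<theta> z x \<bullet> b)) (at z)"
    unfolding b inner_axis drift_def linearized_drift_def
    by (auto intro!: derivative_eq_intros f c n simp: algebra_simps)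
qed

text \<open>At interior points the derivative within the cube is the ordinary one. This covers all
  zeros of the drift, which lie in the open cube by \<open>zero_in_box\<close>.\<close>

lemma jacobian_drift:
  fixes z :: "real^'n"
  assumes "z \<in> box 0 1"
  shows "jacobian (drift \<alpha> \<beta> q (f_theta \<theta>)) (at z within cbox 0 1) *v v = linearized_drift \<alpha> \<beta> \<theta> z v"
proof -
  have "at z within cbox 0 1 = at z" using assms by (intro at_within_interior) (simp add: interior_cbox)
  moreover have "frechet_derivative (drift \<alpha> \<beta> q (f_theta \<theta>)) (at z) = linearized_drift \<alpha> \<beta> \<theta> z"
    by (rule frechet_derivative_at[OF drift_has_derivative, symmetric])
  ultimately show ?thesis
    unfolding jacobian_def by (simp add: matrix_works linear_linearized_drift)
qed

text \<open>The analytic part, free of probability. The derivative of \<open>f_theta\<close> is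
  largest at 1/2, with value 3 \<theta> - 3/2, so \<open>steep\<close> says that \<kappa> times this
  derivative exceeds 1 there; this separates two ranges in which a component can be stable.\<close>

locale cubic_params =
  fixes \<alpha> \<beta> q \<theta> :: real
  assumes alpha_nonneg: "\<alpha> \<ge> 0" and beta_nonneg: "\<beta> \<ge> 0" and alpha_beta_less: "\<alpha> + \<beta> < 1"
    and q01: "q \<in> {0<..1}" and theta: "\<theta> \<in> {1/2<..<1}"
    and steep: "1 / (1 - \<alpha> - \<beta>) < 3 * \<theta> - 3 / 2"
begin

abbreviation "\<kappa> \<equiv> 1 - \<alpha> - \<beta>"
abbreviation "drift_field \<equiv> drift \<alpha> \<beta> q (f_theta \<theta>) :: real^'n \<Rightarrow> real^'n"
abbreviation "deriv_f x \<equiv> 6 * (2 * \<theta> - 1) * x * (1 - x)"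

lemma kappa: "\<kappa> > 0" "\<kappa> \<le> 1" using alpha_beta_less alpha_nonneg beta_nonneg by auto

text \<open>The leading coefficient of the cubic \<kappa> f x - x is -2 times this number.\<close>

definition "steepness = \<kappa> * (2 * \<theta> - 1)"

lemma steepness_pos: "steepness > 0" unfolding steepness_def using kappa theta by simp

lemma steepness_le_1: "steepness \<le> 1"
  unfolding steepness_def using kappa theta mult_mono[of \<kappa> 1 "2 * \<theta> - 1" 1] by simp

lemma steepness_gt: "1 / (6 * steepness) < 1 / 4"
proof -
  have "1 < (3 * \<theta> - 3 / 2) * \<kappa>" using steep kappa by (simp add: divide_simps)
  also have "(3 * \<theta> - 3 / 2) * \<kappa> = 3 / 2 * steepness" unfolding steepness_def by (simp add: field_simps)
  finally have "2 < 3 * steepness" by simp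
  then show ?thesis by (simp add: field_simps)
qed

text \<open>The smaller root of 6 \<open>steepness\<close> x (1 - x) = 1, the equation for slope 1
  of \<kappa> f; by symmetry about 1/2 the other root is \<open>x2\<close>.\<close>

definition "x1 = 1 / 2 - sqrt (1 / 4 - 1 / (6 * steepness))"
definition "x2 = 1 - x1"

lemma x1_bounds: "x1 \<in> {0<..<1/2}" "x2 \<in> {1/2<..<1}"
proof -
  define s where "s = sqrt (1 / 4 - 1 / (6 * steepness))"
  have "1 / (6 * steepness) > 0" using steepness_pos by simp
  then have "s < sqrt (1 / 4)" unfolding s_def by (intro real_sqrt_less_mono) simp
  also have "sqrt (1 / 4) = (1/2 :: real)" by (simp add: real_sqrt_divide)
  finally have "s < 1/2" .
  moreover have "s > 0" unfolding s_def using steepness_gt by simp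
  ultimately show "x1 \<in> {0<..<1/2}" "x2 \<in> {1/2<..<1}" unfolding x2_def x1_def s_def[symmetric] by auto
qed

lemma slope_factor: "\<kappa> * deriv_f x - 1 = - (6 * steepness) * (x - x1) * (x - x2)"
proof -
  define s where "s = sqrt (1 / 4 - 1 / (6 * steepness))"
  have s2: "s\<^sup>2 = 1 / 4 - 1 / (6 * steepness)" unfolding s_def using steepness_gt by simp
  have "(x - x1) * (x - x2) = (x - 1 / 2)\<^sup>2 - s\<^sup>2"
    unfolding x2_def x1_def s_def[symmetric] by (simp add: power2_eq_square algebra_simps)
  then have "- (6 * steepness) * (x - x1) * (x - x2) = - (6 * steepness) * ((x - 1/2)\<^sup>2 - 1/4) - 1"
    using steepness_pos unfolding s2 by (simp only: mult.assoc) (simp add: algebra_simps)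
  also have "\<dots> = \<kappa> * deriv_f x - 1"
    unfolding steepness_def by (simp add: power2_eq_square algebra_simps)
  finally show ?thesis by simp
qed

lemma slope_neg: "x < x1 \<Longrightarrow> \<kappa> * deriv_f x - 1 < 0" "x > x2 \<Longrightarrow> \<kappa> * deriv_f x - 1 < 0"
proof -
  have "\<kappa> * deriv_f x - 1 < 0" if "(x - x1) * (x - x2) > 0"
    unfolding slope_factor using mult_pos_pos[OF steepness_pos that] by (simp add: mult.assoc)
  moreover have "(x - x1) * (x - x2) > 0" if "x < x1"
    using that x1_bounds by (intro mult_neg_neg) auto
  moreover have "(x - x1) * (x - x2) > 0" if "x > x2"
    using that x1_bounds by (intro mult_pos_pos) auto
  ultimately show "x < x1 \<Longrightarrow> \<kappa> * deriv_f x - 1 < 0" "x > x2 \<Longrightarrow> \<kappa> * deriv_f x - 1 < 0"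
    by blast+
qed

lemma slope_nonpos_cases:
  assumes "\<kappa> * deriv_f x - 1 \<le> 0"
  shows "x \<le> x1 \<or> x \<ge> x2"
proof (rule ccontr)
  assume "\<not> ?thesis"
  then have "(x - x1) * (x - x2) < 0" by (intro mult_pos_neg) auto
  from mult_pos_neg[OF _ this, of "6 * steepness"] have "6 * steepness * ((x - x1) * (x - x2)) < 0"
    using steepness_pos by linarith
  then show False using assms unfolding slope_factor by (simp add: mult.assoc)
qed

lemma critical_points: "{x \<in> {0..1}. deriv (f_theta \<theta>) x = 1 / \<kappa>} = {x1, x2}"
proof -
  have "deriv (f_theta \<theta>) x = 1 / \<kappa> \<longleftrightarrow> \<kappa> * deriv_f x - 1 = 0" for x
    unfolding deriv_f_theta using kappa by (simp add: field_simps)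
  also have "\<dots> x \<longleftrightarrow> x = x1 \<or> x = x2" for x
    unfolding slope_factor using steepness_pos by auto
  finally show ?thesis using x1_bounds by auto
qed

section \<open>Location of zeros and of stable zeros\<close>

lemma zero_nth:
  assumes "drift_field z = 0"
  shows "z $ h = \<alpha> * comp_mean z + \<beta> * q + \<kappa> * f_theta \<theta> (z $ h)"
  using arg_cong[OF assms, of "\<lambda>w. w $ h"] by (simp add: drift_def)

text \<open>On the unit interval \<open>f_theta\<close> has values in [1 - \<theta>, \<theta>],
  which leaves the margin \<kappa> (1 - \<theta>) at both ends. The margin keeps zeros off the
  boundary and serves as the constant \<open>c\<close> of \<open>expanding_urn\<close>.\<close>

lemma rate_bounds:
  fixes z :: "real^'n"
  assumes z: "\<And>h. z $ h \<in> {0..1}"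
  shows "rate \<alpha> \<beta> q (f_theta \<theta>) z h \<in> {\<kappa> * (1 - \<theta>)..1 - \<kappa> * (1 - \<theta>)}"
proof -
  have m: "comp_mean z \<in> {0..1}" using z by (rule comp_mean_bounds)
  have f: "f_theta \<theta> (z $ h) \<in> {1 - \<theta>..\<theta>}" using z theta by (intro f_theta_bounds) auto
  have "\<alpha> * comp_mean z \<le> \<alpha> * 1" "\<beta> * q \<le> \<beta> * 1" "\<kappa> * f_theta \<theta> (z $ h) \<le> \<kappa> * \<theta>"
    "\<kappa> * (1 - \<theta>) \<le> \<kappa> * f_theta \<theta> (z $ h)"
    using m f alpha_nonneg beta_nonneg q01 kappa by (intro mult_left_mono; simp)+
  moreover have "0 \<le> \<alpha> * comp_mean z" "0 \<le> \<beta> * q"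
    using m alpha_nonneg beta_nonneg q01 by auto
  ultimately show ?thesis unfolding rate_def by (auto simp: algebra_simps)
qed

lemma rate_margin_pos: "\<kappa> * (1 - \<theta>) > 0" using kappa theta by simp

lemma mem_unit_cbox: "z \<in> cbox (0 :: real^'n) 1 \<longleftrightarrow> (\<forall>h. z $ h \<in> {0..1})"
  by (auto simp: mem_box_cart)

lemma zero_in_box:
  fixes z :: "real^'n"
  assumes "z \<in> cbox 0 1" "drift_field z = 0"
  shows "z \<in> box 0 1"
proof -
  have "z $ h \<in> {\<kappa> * (1 - \<theta>)..1 - \<kappa> * (1 - \<theta>)}" for h
    using rate_bounds[of z h] zero_nth[OF assms(2), of h] assms(1) by (simp add: rate_def mem_unit_cbox)
  then show ?thesis
    using rate_margin_pos unfolding mem_box_cart atLeastAtMost_iff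
    by (metis add.commute diff_add_cancel le_less_trans less_add_same_cancel1 less_le_trans one_index zero_index)
qed

lemma stable_zeros_iff:
  fixes z :: "real^'n"
  shows "z \<in> stable_zeros drift_field \<longleftrightarrow> z \<in> cbox 0 1 \<and> drift_field z = 0 \<and>
    (\<forall>c v. v \<noteq> 0 \<longrightarrow> linearized_drift \<alpha> \<beta> \<theta> z v = c *\<^sub>R v \<longrightarrow> c \<le> 0)"
proof (cases "z \<in> cbox 0 1 \<and> drift_field z = 0")
  case True
  then have "jacobian drift_field (at z within cbox 0 1) *v v = linearized_drift \<alpha> \<beta> \<theta> z v" for v
    by (intro jacobian_drift zero_in_box) auto
  then show ?thesis using True by (auto simp: stable_zeros_def is_eigenvalue_def)
qed (auto simp: stable_zeros_def)

lemma stable_quadratic_form: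
  fixes z :: "real^'n"
  assumes "z \<in> stable_zeros drift_field"
  shows "w \<bullet> linearized_drift \<alpha> \<beta> \<theta> z w \<le> 0"
proof (rule ccontr)
  assume "\<not> ?thesis"
  then obtain c v where "c > 0" "v \<noteq> 0" "linearized_drift \<alpha> \<beta> \<theta> z v = c *\<^sub>R v"
    using self_adjoint_pos_eigenvalue[OF linear_linearized_drift linearized_drift_self_adjoint] by (meson not_le)
  then show False using assms unfolding stable_zeros_iff by force
qed

text \<open>Testing the quadratic form on a coordinate vector shows that a diagonal entry of the
  Jacobian is nonpositive. The coupling contributes \<alpha>/N to it, which for \<alpha> > 0 leaves
  a strict margin.\<close>

lemma stable_slope:
  fixes z :: "real^'n"
  assumes "z \<in> stable_zeros drift_field"
  shows "\<kappa> * deriv_f (z $ h) - 1 \<le> - \<alpha> / CARD('n)"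
proof -
  have "linearized_drift \<alpha> \<beta> \<theta> z (axis h 1) $ h \<le> 0"
    using stable_quadratic_form[OF assms, of "axis h 1"] by (simp only: inner_axis') simp
  moreover have "linearized_drift \<alpha> \<beta> \<theta> z (axis h 1) $ h = \<alpha> / CARD('n) + (\<kappa> * deriv_f (z $ h) - 1)"
    by (simp add: linearized_drift_def comp_mean_def axis_def)
  ultimately show ?thesis by simp
qed

text \<open>For \<alpha> > 0 the margin in \<open>stable_slope\<close> excludes the points
  \<open>x1\<close> and \<open>x2\<close>. For \<alpha> = 0 the components decouple, and a component
  equal to \<open>x1\<close> or \<open>x2\<close> is a double root of its scalar equation; its
  eigenvalue 0 is compatible with stability. Hence the extra alternatives, which the final statement
  inherits.\<close>

lemma stable_zero_nth:
  fixes z :: "real^'n"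
  assumes z: "z \<in> stable_zeros drift_field"
  shows "z $ h \<in> {0<..<x1} \<or> \<alpha> = 0 \<and> z $ h = x1 \<or> z $ h \<in> {x2<..<1} \<or> \<alpha> = 0 \<and> z $ h = x2"
proof -
  have zb: "z \<in> box 0 1" using z zero_in_box unfolding stable_zeros_iff by blast
  have s: "\<kappa> * deriv_f (z $ h) - 1 \<le> - \<alpha> / CARD('n)" by (rule stable_slope[OF z])
  also have "\<dots> \<le> 0" using alpha_nonneg by simp
  finally have c: "z $ h \<le> x1 \<or> z $ h \<ge> x2" by (rule slope_nonpos_cases)
  have "\<alpha> = 0" if "z $ h = x1 \<or> z $ h = x2"
  proof -
    have "\<kappa> * deriv_f (z $ h) - 1 = 0" unfolding slope_factor using that by auto
    then show ?thesis using s alpha_nonneg by (simp add: divide_simps)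
  qed
  moreover have "z $ h \<in> {0<..<1}" using zb by (simp add: mem_box_cart)
  ultimately show ?thesis using c by force
qed

text \<open>By the mean value theorem two distinct solutions would force \<kappa> f to have slope 1
  strictly between them, but on either outer side the slope is below 1. A stable zero thus takes at
  most one value on each side.\<close>

lemma fixed_point_inj:
  assumes a: "a = C + \<kappa> * f_theta \<theta> a" and b: "b = C + \<kappa> * f_theta \<theta> b"
    and side: "a \<le> x1 \<and> b \<le> x1 \<or> a \<ge> x2 \<and> b \<ge> x2"
  shows "a = b"
proof -
  have False if ab: "a < b" "a = C + \<kappa> * f_theta \<theta> a" "b = C + \<kappa> * f_theta \<theta> b"
    "a \<le> x1 \<and> b \<le> x1 \<or> a \<ge> x2 \<and> b \<ge> x2" for a b
  proof -
    obtain \<xi> where \<xi>: "a < \<xi>" "\<xi> < b" "f_theta \<theta> b - f_theta \<theta> a = (b - a) * deriv_f \<xi>"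
      using MVT2[OF ab(1) f_theta_has_derivative] by blast
    have "b - a = \<kappa> * (f_theta \<theta> b - f_theta \<theta> a)" using ab by (simp add: right_diff_distrib)
    then have "(b - a) * (\<kappa> * deriv_f \<xi> - 1) = 0" unfolding \<xi>(3) by (simp add: algebra_simps)
    moreover have "\<xi> < x1 \<or> \<xi> > x2" using \<xi>(1,2) ab(4) by linarith
    then have "\<kappa> * deriv_f \<xi> - 1 < 0" using slope_neg by blast
    ultimately show False using ab(1) by auto
  qed
  from this[of a b] this[of b a] show ?thesis
    using assms by (cases a b rule: linorder_cases) blast+
qed

end

lemma finite_vec_components:
  assumes "finite T"
  shows "finite {z :: 'a^'n. \<forall>h. z $ h \<in> T}"
proof -
  have "{z :: 'a^'n. \<forall>h. z $ h \<in> T} \<subseteq> vec_lambda ` (PiE UNIV (\<lambda>_. T))"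
  proof
    fix z :: "'a^'n" assume "z \<in> {z. \<forall>h. z $ h \<in> T}"
    then have "vec_nth z \<in> PiE UNIV (\<lambda>_. T)" by auto
    then show "z \<in> vec_lambda ` (PiE UNIV (\<lambda>_. T))" by (metis image_eqI vec_nth_inverse)
  qed
  then show ?thesis using assms by (meson finite_PiE finite_imageI finite_subset finite)
qed

lemma f_theta_expand: "f_theta \<theta> x = (1 - \<theta>) + 3 * (2 * \<theta> - 1) * x^2 - 2 * (2 * \<theta> - 1) * x^3"
  by (simp add: f_theta_def algebra_simps)

context cubic_params
begin

text \<open>The constant \<open>3/2\<close> is the sum of the roots of the cubic \<open>C + \<kappa> f\<^sub>\<theta> x - x\<close>.\<close>

lemma level_set_two_roots:
  assumes a: "a = C + \<kappa> * f_theta \<theta> a" and b: "b = C + \<kappa> * f_theta \<theta> b" and "a \<noteq> b"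
  shows "a\<^sup>2 + a * b + b\<^sup>2 - 3 / 2 * (a + b) + 1 / (2 * steepness) = 0"
proof -
  have "b - a = \<kappa> * (f_theta \<theta> b - f_theta \<theta> a)"
    using a b by (simp add: right_diff_distrib)
  also have "\<dots> = (b - a) * (steepness * (3 * (a + b) - 2 * (a\<^sup>2 + a * b + b\<^sup>2)))"
    unfolding f_theta_expand steepness_def by (simp add: algebra_simps power2_eq_square power3_eq_cube)
  finally have "steepness * (3 * (a + b) - 2 * (a\<^sup>2 + a * b + b\<^sup>2)) = 1"
    using \<open>a \<noteq> b\<close> by simp
  then show ?thesis using steepness_pos by (simp add: field_simps)
qed

lemma level_set_third_root:
  assumes a: "a = C + \<kappa> * f_theta \<theta> a" and b: "b = C + \<kappa> * f_theta \<theta> b" and ab: "a \<noteq> b"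
    and w: "w = C + \<kappa> * f_theta \<theta> w" "w \<noteq> a" "w \<noteq> b"
  shows "w = 3 / 2 - a - b"
proof -
  have "a\<^sup>2 + a * b + b\<^sup>2 - 3 / 2 * (a + b) = a\<^sup>2 + a * w + w\<^sup>2 - 3 / 2 * (a + w)"
    using level_set_two_roots[OF a b ab] level_set_two_roots[OF a w(1)] w by simp
  then have "(b - w) * (a + b + w - 3 / 2) = 0"
    by (simp add: field_simps power2_eq_square)
  then show ?thesis using w by simp
qed

text \<open>On the diagonal the zeros solve one cubic. Among three stable roots the middle one would
  have positive slope, against stability in the direction of the vector of ones. Finiteness is
  stated separately because \<open>card\<close> of an infinite set is 0.\<close>

lemma constant_stable_zeros:
  "finite {z \<in> stable_zeros drift_field. \<exists>x. z = x *\<^sub>R (1 :: real^'n)}"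
  "card {z \<in> stable_zeros drift_field. \<exists>x. z = x *\<^sub>R (1 :: real^'n)} \<le> 2"
proof -
  define S where "S = {x. x *\<^sub>R (1 :: real^'n) \<in> stable_zeros drift_field}"
  have N: "real CARD('n) > 0" by simp
  have mean: "comp_mean (x *\<^sub>R (1 :: real^'n)) = x" for x by (simp add: comp_mean_def)
  have root: "x = \<alpha> * x + \<beta> * q + \<kappa> * f_theta \<theta> x" and slope: "\<alpha> + \<kappa> * deriv_f x - 1 \<le> 0" if "x \<in> S" for x
  proof -
    have st: "x *\<^sub>R (1 :: real^'n) \<in> stable_zeros drift_field" using that by (simp add: S_def)
    then show "x = \<alpha> * x + \<beta> * q + \<kappa> * f_theta \<theta> x"
      using zero_nth[of "x *\<^sub>R (1 :: real^'n)"] unfolding stable_zeros_iff by (simp add: mean)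
    have "(\<Sum>h\<in>(UNIV :: 'n set). \<alpha> + (\<kappa> * deriv_f x - 1)) \<le> 0"
      using stable_quadratic_form[OF st, of 1] mean[of 1]
      by (simp add: inner_vec_def linearized_drift_def)
    then show "\<alpha> + \<kappa> * deriv_f x - 1 \<le> 0" using N by (simp add: mult_le_0_iff)
  qed
  have no3: False if "x \<in> S" "y \<in> S" "w \<in> S" "x < y" "y < w" for x y w
  proof -
    \<comment> \<open>The divided difference of the cubic at two distinct roots vanishes.\<close>
    have quot: "2 * steepness * (a\<^sup>2 + a * b + b\<^sup>2 - 3 / 2 * (a + b)) + (1 - \<alpha>) = 0"
      if "a \<in> S" "b \<in> S" "a \<noteq> b" for a b
    proof -
      have "(b - a) * (1 - \<alpha>) = \<kappa> * (f_theta \<theta> b - f_theta \<theta> a)"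
        using root[OF that(1)] root[OF that(2)] by (simp add: algebra_simps)
      also have "\<dots> = (b - a) * (steepness * (3 * (a + b) - 2 * (a\<^sup>2 + a * b + b\<^sup>2)))"
        unfolding f_theta_expand steepness_def by (simp add: algebra_simps power2_eq_square power3_eq_cube)
      finally have "1 - \<alpha> = steepness * (3 * (a + b) - 2 * (a\<^sup>2 + a * b + b\<^sup>2))" using that(3) by simp
      then show ?thesis by (simp add: algebra_simps)
    qed
    have "2 * steepness * (x\<^sup>2 + x * y + y\<^sup>2 - 3 / 2 * (x + y)) = 2 * steepness * (y\<^sup>2 + y * w + w\<^sup>2 - 3 / 2 * (y + w))"
    proof -
      have "x \<noteq> y" "y \<noteq> w" using that by auto
      from trans[OF quot[OF that(1,2) this(1)] quot[OF that(2,3) this(2), symmetric]]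
      show ?thesis by (rule add_right_imp_eq)
    qed
    then have "x\<^sup>2 + x * y + y\<^sup>2 - 3 / 2 * (x + y) = y\<^sup>2 + y * w + w\<^sup>2 - 3 / 2 * (y + w)"
      by (rule mult_left_cancel[THEN iffD1, rotated]) (use steepness_pos in simp)
    then have "(x - w) * (x + y + w - 3 / 2) = 0"
      by (simp add: field_simps power2_eq_square)
    then have sum: "x + y + w = 3 / 2" using that by simp
    \<comment> \<open>This is the derivative at t = y of -2 \<open>steepness\<close> (t - x) (t - y)
      (t - w).\<close>
    have "2 * steepness * ((y - x) * (w - y)) = \<alpha> + \<kappa> * deriv_f y - 1"
    proof -
      have w: "w = 3 / 2 - x - y" using sum by simp
      have "\<kappa> * deriv_f y = 6 * steepness * (y - y\<^sup>2)"
        unfolding steepness_def by (simp add: algebra_simps power2_eq_square)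
      moreover have "2 * steepness * (x\<^sup>2 + x * y + y\<^sup>2 - 3 / 2 * (x + y)) + (1 - \<alpha>) = 0"
        using quot[of x y] that by blast
      moreover have "2 * steepness * ((y - x) * (w - y)) =
          6 * steepness * (y - y\<^sup>2) + 2 * steepness * (x\<^sup>2 + x * y + y\<^sup>2 - 3 / 2 * (x + y))"
        unfolding w by (simp add: field_simps power2_eq_square)
      ultimately show ?thesis by linarith
    qed
    moreover have "2 * steepness * ((y - x) * (w - y)) > 0" using that steepness_pos by simp
    ultimately show False using slope[OF that(2)] by simp
  qed
  have "finite S \<and> card S \<le> 2"
  proof (rule ccontr)
    assume "\<not> ?thesis"
    then have "infinite S \<or> card S \<ge> 3" by auto
    then obtain T where T: "T \<subseteq> S" "finite T" "card T = 3"
      by (metis infinite_arbitrarily_large obtain_subset_with_card_n)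
    then obtain x y w where "T = {x, y, w}" "x \<noteq> y" "y \<noteq> w" "x \<noteq> w" by (auto simp: card_3_iff)
    then have xyw: "x \<in> S" "y \<in> S" "w \<in> S" "x \<noteq> y" "y \<noteq> w" "x \<noteq> w" using T by auto
    then consider "x < y" "y < w" | "x < w" "w < y" | "y < x" "x < w" | "y < w" "w < x" | "w < x" "x < y" | "w < y" "y < x"
      by linarith
    then show False using no3 xyw by cases blast+
  qed
  moreover have "{z \<in> stable_zeros drift_field. \<exists>x. z = x *\<^sub>R (1 :: real^'n)} = (\<lambda>x. x *\<^sub>R (1 :: real^'n)) ` S"
    unfolding S_def by auto
  ultimately show "finite {z \<in> stable_zeros drift_field. \<exists>x. z = x *\<^sub>R (1 :: real^'n)}"
    "card {z \<in> stable_zeros drift_field. \<exists>x. z = x *\<^sub>R (1 :: real^'n)} \<le> 2"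
    by (auto intro: order_trans[OF card_image_le])
qed

text \<open>All components solve the same scalar equation, in which the others appear only through
  the mean. So \<open>fixed_point_inj\<close> leaves one value on each side, and both sides occur
  because \<open>z\<close> is not constant. The bijection \<open>e\<close> lists the low components
  first.\<close>

lemma nonconstant_stable_zero:
  fixes z :: "real^'n"
  assumes z: "z \<in> stable_zeros drift_field" and nc: "\<nexists>x. z = x *\<^sub>R 1"
  shows "\<exists>e N\<^sub>1 z\<^sub>1 z\<^sub>2. bij_betw e {1..CARD('n)} UNIV \<and> N\<^sub>1 \<in> {1..CARD('n) - 1} \<and>
     (z\<^sub>1 \<in> {0<..<x1} \<or> \<alpha> = 0 \<and> z\<^sub>1 = x1) \<and> (z\<^sub>2 \<in> {x2<..<1} \<or> \<alpha> = 0 \<and> z\<^sub>2 = x2) \<and>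
     (\<forall>h\<in>{1..CARD('n)}. z $ e h = (if h \<le> N\<^sub>1 then z\<^sub>1 else z\<^sub>2))"
proof -
  define L where "L = {h. z $ h \<le> x1}"
  have root: "z $ h = (\<alpha> * comp_mean z + \<beta> * q) + \<kappa> * f_theta \<theta> (z $ h)" for h
    using z zero_nth unfolding stable_zeros_iff by blast
  have x12: "x1 < x2" using x1_bounds by auto
  have low: "z $ h \<in> {0<..<x1} \<or> \<alpha> = 0 \<and> z $ h = x1" if "h \<in> L" for h
    using stable_zero_nth[OF z, of h] that x12 by (auto simp: L_def)
  have high: "z $ h \<in> {x2<..<1} \<or> \<alpha> = 0 \<and> z $ h = x2" if "h \<notin> L" for h
    using stable_zero_nth[OF z, of h] that by (auto simp: L_def)
  have eqL: "z $ h = z $ h'" if "h \<in> L" "h' \<in> L" for h h'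
    using that by (intro fixed_point_inj[OF root root]) (auto simp: L_def)
  have eqR: "z $ h = z $ h'" if "h \<notin> L" "h' \<notin> L" for h h'
    using high[OF that(1)] high[OF that(2)] by (intro fixed_point_inj[OF root root]) auto
  have "L \<noteq> {}"
  proof
    assume "L = {}"
    then have "z $ h = z $ h'" for h h' using eqR by auto
    then have "z = (z $ undefined) *\<^sub>R 1" by (simp add: vec_eq_iff)
    then show False using nc by blast
  qed
  moreover have "L \<noteq> UNIV"
  proof
    assume "L = UNIV"
    then have "z $ h = z $ h'" for h h' using eqL by auto
    then have "z = (z $ undefined) *\<^sub>R 1" by (simp add: vec_eq_iff)
    then show False using nc by blast
  qed
  ultimately obtain l u where l: "l \<in> L" and u: "u \<notin> L" by auto
  have cards: "card L + card (- L) = CARD('n)"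
    using card_Un_disjoint[of L "-L"] by (simp add: Compl_partition)
  have "card L > 0" "card (- L) > 0" using l u by (auto simp: card_gt_0_iff)
  then have N1: "card L \<in> {1..CARD('n) - 1}" using cards by auto
  obtain e1 where e1: "bij_betw e1 {1..card L} L"
    using finite_same_card_bij[of "{1..card L}" L] by auto
  obtain e2 where e2: "bij_betw e2 {Suc (card L)..CARD('n)} (- L)"
    using finite_same_card_bij[of "{Suc (card L)..CARD('n)}" "- L"] diff_add_inverse[of "card L" "card (- L)"]
    by (auto simp: cards)
  define e where "e = (\<lambda>h. if h \<le> card L then e1 h else e2 h)"
  have b1: "bij_betw e {1..card L} L"
    using e1 by (subst bij_betw_cong[of _ e e1]) (auto simp: e_def)
  have b2: "bij_betw e {Suc (card L)..CARD('n)} (- L)"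
    using e2 by (subst bij_betw_cong[of _ e e2]) (auto simp: e_def)
  have "{1..card L} \<union> {Suc (card L)..CARD('n)} = {1..CARD('n)}" using N1 by auto
  then have "bij_betw e {1..CARD('n)} UNIV"
    using bij_betw_combine[OF b1 b2] by auto
  moreover have "z $ e h = (if h \<le> card L then z $ l else z $ u)" if "h \<in> {1..CARD('n)}" for h
  proof (cases "h \<le> card L")
    case True
    then have "e h \<in> L" using bij_betwE[OF b1] that by auto
    then show ?thesis using True eqL[of "e h" l] l by simp
  next
    case False
    then have "e h \<notin> L" using bij_betwE[OF b2] that by auto
    then show ?thesis using False eqR[of "e h" u] u by simp
  qed
  ultimately show ?thesis using N1 low[OF l] high[OF u]
    by (intro exI[of _ e] exI[of _ "card L"] exI[of _ "z $ l"] exI[of _ "z $ u"]) blast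
qed

end

section \<open>Finiteness of the zeros, potential and instability\<close>

text \<open>The square of a cubic has degree six, which a quadratic cannot cancel. Equations of this
  shape arise when the difference of two components of a zero is eliminated by squaring.\<close>

lemma finite_cubic_squared_eq_quadratic:
  fixes a0 a1 a2 a3 b0 b1 b2 :: real
  assumes "a3 \<noteq> 0"
  shows "finite {s. (a0 + a1 * s + a2 * s^2 + a3 * s^3)\<^sup>2 = b0 + b1 * s + b2 * s^2}"
proof -
  let ?P = "[:a0, a1, a2, a3:] * [:a0, a1, a2, a3:] - [:b0, b1, b2:]"
  have "coeff ?P 6 = a3 * a3" by (simp add: eval_nat_numeral)
  then have "?P \<noteq> 0" using assms by auto
  then have "finite {s. poly ?P s = 0}" by (rule poly_roots_finite)
  moreover have "{s. (a0 + a1 * s + a2 * s^2 + a3 * s^3)\<^sup>2 = b0 + b1 * s + b2 * s^2} \<subseteq> {s. poly ?P s = 0}"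
    by (auto simp: algebra_simps power2_eq_square power3_eq_cube)
  ultimately show ?thesis by (rule finite_subset[rotated])
qed

lemma finite_quadratic_roots: "finite {x :: real. x\<^sup>2 - s * x + c = 0}"
proof -
  have "finite {x. poly [:c, -s, 1:] x = 0}" by (rule poly_roots_finite) simp
  then show ?thesis by (rule rev_finite_subset) (auto simp: algebra_simps power2_eq_square)
qed

context cubic_params
begin

text \<open>If a zero has two distinct components \<open>a\<close> and \<open>b\<close>, then every component lies in
  \<open>{a, b, 3/2 - a - b}\<close>, and eliminating \<open>a - b\<close> from the equation for the mean leaves a nontrivial
  polynomial equation for \<open>s = a + b\<close>, one for each pair of multiplicities.\<close>

lemma finite_zeros: "finite {z :: real^'n. drift_field z = 0}"
proof -
  let ?N = "real CARD('n)"
  define k where "k = steepness"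
  have k: "k > 0" unfolding k_def by (rule steepness_pos)
  define g where "g = 1 / (2 * k)"
  define c0 where "c0 = \<kappa> * (1 - \<theta>) + \<beta> * q"
  \<comment> \<open>For multiplicities n1 and n2 this is the equation \<open>L2\<close> below, with
    both sides expanded in powers of s.\<close>
  define R where "R = (\<lambda>(n1, n2). {s :: real.
     (?N * (3 * k * g - c0) - \<alpha> * (?N - (n1 + n2)) * (3/2)
      + (- (2 * k * ?N * (9/4 + g)) + \<alpha> * (?N - (n1 + n2)) - \<alpha> * (n1 + n2) / 2) * s
      + (6 * k * ?N) * s^2 + (- (2 * k * ?N)) * s^3)\<^sup>2
     = - (\<alpha>\<^sup>2 * (n1 - n2)\<^sup>2 * g) + (\<alpha>\<^sup>2 * (n1 - n2)\<^sup>2 * (3/2)) * s + (- (\<alpha>\<^sup>2 * (n1 - n2)\<^sup>2 * (3/4))) * s^2})"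
  have finR: "finite (R y)" for y
  proof (cases y)
    case (Pair n1 n2)
    show ?thesis
      unfolding R_def Pair prod.case by (rule finite_cubic_squared_eq_quadratic) (use k in simp)
  qed
  \<comment> \<open>Candidates when all components agree. Otherwise a component is a root of the
    quadratic whose roots have sum s and product s^2 - 3/2 s + g.\<close>
  define R0 where "R0 = {x. poly [:c0, \<alpha> - 1, 3 * k, - (2 * k):] x = 0}"
  have finR0: "finite R0" unfolding R0_def using k by (intro poly_roots_finite) auto
  define T where "T = R0 \<union> (\<Union>y \<in> real ` {..CARD('n)} \<times> real ` {..CARD('n)}. \<Union>s\<in>R y.
     {x. x\<^sup>2 - s * x + (s\<^sup>2 - 3 / 2 * s + g) = 0} \<union> {3 / 2 - s})"
  have finT: "finite T" unfolding T_def using finR0 finR by (auto intro!: finite_quadratic_roots)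
  have "z $ h \<in> T" if zero: "drift_field z = 0" for z :: "real^'n" and h
  proof (cases "\<exists>h'. z $ h' \<noteq> z $ h")
    case False
    then have "(\<Sum>i\<in>UNIV. z $ i) = (\<Sum>i\<in>(UNIV :: 'n set). z $ h)" by (intro sum.cong) auto
    then have "comp_mean z = z $ h" by (simp add: comp_mean_def)
    then have "z $ h = \<alpha> * z $ h + \<beta> * q + \<kappa> * f_theta \<theta> (z $ h)" using zero_nth[OF zero, of h] by simp
    then have "z $ h \<in> R0"
      unfolding R0_def c0_def k_def steepness_def f_theta_expand
      by (simp add: algebra_simps power2_eq_square power3_eq_cube)
    then show ?thesis unfolding T_def by blast
  next
    case True
    then obtain h' where h': "z $ h' \<noteq> z $ h" by blast
    define a b where "a = z $ h" and "b = z $ h'"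
    define m where "m = comp_mean z"
    define C where "C = \<alpha> * m + \<beta> * q"
    define s where "s = a + b"
    define w where "w = 3 / 2 - s"
    have ab: "a \<noteq> b" using h' by (simp add: a_def b_def)
    have root: "z $ i = C + \<kappa> * f_theta \<theta> (z $ i)" for i
      using zero_nth[OF zero, of i] by (simp add: C_def m_def)
    have ra: "a = C + \<kappa> * f_theta \<theta> a" and rb: "b = C + \<kappa> * f_theta \<theta> b"
      unfolding a_def b_def by (rule root)+
    have quad: "a\<^sup>2 + a * b + b\<^sup>2 - 3 / 2 * (a + b) + g = 0"
      using level_set_two_roots[OF ra rb ab] by (simp add: g_def k_def)
    have p: "a * b = s\<^sup>2 - 3 / 2 * s + g"
      using quad unfolding s_def by (simp add: algebra_simps power2_eq_square)
    \<comment> \<open>Vieta: up to the leading coefficient, the constant term is the product of the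
      three roots.\<close>
    have C: "C + \<kappa> * (1 - \<theta>) = 2 * k * (a * b * w)"
    proof -
      have "C + \<kappa> * (1 - \<theta>) = a * (2 * k * g) - 3 * k * a^2 + 2 * k * a^3"
        using ra k unfolding f_theta_expand g_def k_def steepness_def
        by (simp add: algebra_simps)
      also have "g = - (a\<^sup>2 + a * b + b\<^sup>2 - 3 / 2 * (a + b))" using quad by simp
      also have "a * (2 * k * - (a\<^sup>2 + a * b + b\<^sup>2 - 3 / 2 * (a + b))) - 3 * k * a^2 + 2 * k * a^3 = 2 * k * (a * b * w)"
        unfolding w_def s_def by (simp add: field_simps power2_eq_square power3_eq_cube)
      finally show ?thesis .
    qed
    define n1 n2 where "n1 = real (card {i. z $ i = a})" and "n2 = real (card {i. z $ i = b})"
    have "?N * m = (\<Sum>i\<in>UNIV. z $ i)" by (simp add: m_def comp_mean_def)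
    \<comment> \<open>Components other than a and b equal w; the formula stays valid when w
      coincides with a or b.\<close>
    also have "\<dots> = (\<Sum>i\<in>(UNIV :: 'n set). w + (a - w) * of_bool (z $ i = a) + (b - w) * of_bool (z $ i = b))"
    proof (intro sum.cong refl)
      fix i
      have "z $ i = a \<or> z $ i = b \<or> z $ i = w"
        using level_set_third_root[OF ra rb ab root[of i]]
        by (cases "z $ i = a"; cases "z $ i = b") (simp_all add: w_def s_def)
      then show "z $ i = w + (a - w) * of_bool (z $ i = a) + (b - w) * of_bool (z $ i = b)"
        using ab by auto
    qed
    also have "\<dots> = ?N * w + (a - w) * n1 + (b - w) * n2"
      by (simp add: sum.distrib n1_def n2_def flip: sum_distrib_left)
    finally have mean: "?N * m = ?N * w + (a - w) * n1 + (b - w) * n2" .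
    have E: "?N * (2 * k * ((s\<^sup>2 - 3 / 2 * s + g) * w) - c0) = \<alpha> * (?N * w + (a - w) * n1 + (b - w) * n2)"
    proof -
      have "2 * k * ((s\<^sup>2 - 3 / 2 * s + g) * w) - c0 = \<alpha> * m"
        using C unfolding p[symmetric] c0_def C_def by simp
      then show ?thesis unfolding mean[symmetric] by simp
    qed
    \<comment> \<open>\<open>L\<close> collects the terms symmetric in a and b. The rest is a
      multiple of a - b, whose square is again a polynomial in s.\<close>
    define L where "L = ?N * (2 * k * ((s\<^sup>2 - 3 / 2 * s + g) * w) - c0) - \<alpha> * ((?N - (n1 + n2)) * w + (n1 + n2) * (s / 2))"
    have L: "L = \<alpha> * ((n1 - n2) * ((a - b) / 2))"
      unfolding L_def E unfolding s_def by (simp add: field_simps)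
    have "L\<^sup>2 = \<alpha>\<^sup>2 * (n1 - n2)\<^sup>2 * ((a - b)\<^sup>2 / 4)" unfolding L by (simp add: power_mult_distrib power_divide)
    also have "(a - b)\<^sup>2 = s\<^sup>2 - 4 * (a * b)" unfolding s_def by (simp add: power2_eq_square algebra_simps)
    also have "\<dots> / 4 = - (3/4) * s\<^sup>2 + 3/2 * s - g" unfolding p by (simp add: field_simps)
    finally have L2: "L\<^sup>2 = \<alpha>\<^sup>2 * (n1 - n2)\<^sup>2 * (- (3/4) * s\<^sup>2 + 3/2 * s - g)" .
    have Lp: "L = ?N * (3 * k * g - c0) - \<alpha> * (?N - (n1 + n2)) * (3/2)
      + (- (2 * k * ?N * (9/4 + g)) + \<alpha> * (?N - (n1 + n2)) - \<alpha> * (n1 + n2) / 2) * s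
      + (6 * k * ?N) * s^2 + (- (2 * k * ?N)) * s^3"
      unfolding L_def w_def by (simp add: field_simps power2_eq_square power3_eq_cube)
    have "s \<in> R (n1, n2)"
      unfolding R_def prod.case mem_Collect_eq Lp[symmetric] L2 by (simp add: algebra_simps)
    moreover have "n1 \<in> real ` {..CARD('n)}" "n2 \<in> real ` {..CARD('n)}"
      unfolding n1_def n2_def by (auto intro!: imageI card_mono)
    moreover have "a\<^sup>2 - s * a + (s\<^sup>2 - 3 / 2 * s + g) = 0"
      unfolding s_def using quad by (simp add: algebra_simps power2_eq_square)
    ultimately show ?thesis unfolding T_def a_def[symmetric] by blast
  qed
  then have "{z :: real^'n. drift_field z = 0} \<subseteq> {z. \<forall>h. z $ h \<in> T}" by blast
  then show ?thesis using finite_vec_components[OF finT] finite_subset by blast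
qed

section \<open>The potential and its second order bound\<close>

definition potential :: "real^'n \<Rightarrow> real" where
  "potential z = \<alpha> / (2 * CARD('n)) * (\<Sum>h\<in>UNIV. z $ h)\<^sup>2 +
     (\<Sum>h\<in>UNIV. (\<beta> * q + \<kappa> * (1 - \<theta>)) * z $ h + steepness * ((z $ h)^3 - (z $ h)^4 / 2) - (z $ h)\<^sup>2 / 2)"

lemma potential_continuous: "continuous_on S potential"
  unfolding potential_def[abs_def] by (intro continuous_intros) auto

text \<open>The part depending on the mean is convex and costs nothing. In each coordinate the exact
  remainder is d^2 (\<open>steepness\<close> B - 1/2) with B \<ge> -7 and \<open>steepness\<close>
  \<le> 1, which the constant 8 covers.\<close>

lemma potential_Taylor:
  fixes z z' :: "real^'n"
  assumes z: "\<And>h. z $ h \<in> {0..1}" and z': "\<And>h. z' $ h \<in> {0..1}"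
  shows "potential z' \<ge> potential z + drift_field z \<bullet> (z' - z) - 8 * (norm (z' - z))\<^sup>2"
proof -
  define \<phi> where "\<phi> = (\<lambda>x :: real. (\<beta> * q + \<kappa> * (1 - \<theta>)) * x + steepness * (x^3 - x^4 / 2) - x\<^sup>2 / 2)"
  define s s' where "s = (\<Sum>h\<in>UNIV. z $ h)" and "s' = (\<Sum>h\<in>UNIV. z' $ h)"
  have one: "\<phi> y \<ge> \<phi> x + (\<beta> * q + \<kappa> * f_theta \<theta> x - x) * (y - x) - 8 * (y - x)\<^sup>2"
    if "x \<in> {0..1}" "y \<in> {0..1}" for x y
  proof -
    define d where "d = y - x"
    define B where "B = 3 * x + d - 3 * x\<^sup>2 - 2 * x * d - d\<^sup>2 / 2"
    have y: "y = x + d" by (simp add: d_def)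
    have d: "\<bar>d\<bar> \<le> 1" using that by (auto simp: d_def)
    have "x\<^sup>2 \<le> 1" "d\<^sup>2 \<le> 1" using that d by (auto simp: abs_square_le_1)
    moreover have "\<bar>x * d\<bar> \<le> 1 * 1" unfolding abs_mult using that d by (intro mult_mono) auto
    ultimately have "B \<ge> - 7" unfolding B_def using that d by (simp add: abs_le_iff)
    have "steepness * B \<ge> - 7"
    proof (cases "B \<ge> 0")
      case True
      then have "steepness * B \<ge> 0" using steepness_pos by simp
      then show ?thesis by simp
    next
      case False
      then have "1 * B \<le> steepness * B" using steepness_le_1 by (intro mult_right_mono_neg) auto
      then show ?thesis using \<open>B \<ge> - 7\<close> by simp
    qed
    then have "0 \<le> d\<^sup>2 * (steepness * B - 1/2 + 8)" by (intro mult_nonneg_nonneg) auto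
    also have "\<dots> = \<phi> y - (\<phi> x + (\<beta> * q + \<kappa> * f_theta \<theta> x - x) * (y - x) - 8 * (y - x)\<^sup>2)"
      unfolding y \<phi>_def B_def f_theta_expand steepness_def
      by (simp add: field_simps power2_eq_square power3_eq_cube power4_eq_xxxx)
    finally show ?thesis by simp
  qed
  have "drift_field z \<bullet> (z' - z) = \<alpha> * comp_mean z * (s' - s) +
      (\<Sum>h\<in>UNIV. (\<beta> * q + \<kappa> * f_theta \<theta> (z $ h) - z $ h) * (z' $ h - z $ h))"
    unfolding inner_vec_def drift_def s_def s'_def
    by (simp add: sum_subtractf[symmetric] sum_distrib_left sum.distrib[symmetric] algebra_simps)
  also have "\<alpha> * comp_mean z * (s' - s) = \<alpha> / (2 * CARD('n)) * (2 * s * (s' - s))"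
    unfolding comp_mean_def s_def by simp
  also have "\<dots> \<le> \<alpha> / (2 * CARD('n)) * (s'\<^sup>2 - s\<^sup>2)"
  proof (intro mult_left_mono)
    have "0 \<le> (s' - s)\<^sup>2" by simp
    then show "2 * s * (s' - s) \<le> s'\<^sup>2 - s\<^sup>2" by (simp add: power2_eq_square algebra_simps)
  qed (use alpha_nonneg in simp)
  finally have A: "drift_field z \<bullet> (z' - z) \<le> \<alpha> / (2 * CARD('n)) * (s'\<^sup>2 - s\<^sup>2) +
      (\<Sum>h\<in>UNIV. (\<beta> * q + \<kappa> * f_theta \<theta> (z $ h) - z $ h) * (z' $ h - z $ h))" by simp
  have "(\<Sum>h\<in>UNIV. \<phi> (z $ h) + (\<beta> * q + \<kappa> * f_theta \<theta> (z $ h) - z $ h) * (z' $ h - z $ h) - 8 * (z' $ h - z $ h)\<^sup>2)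
      \<le> (\<Sum>h\<in>UNIV. \<phi> (z' $ h))"
    by (intro sum_mono one z z')
  then have "(\<Sum>h\<in>UNIV. \<phi> (z $ h)) + (\<Sum>h\<in>UNIV. (\<beta> * q + \<kappa> * f_theta \<theta> (z $ h) - z $ h) * (z' $ h - z $ h))
      - 8 * (norm (z' - z))\<^sup>2 \<le> (\<Sum>h\<in>UNIV. \<phi> (z' $ h))"
    unfolding norm_vec_squared by (simp add: sum.distrib sum_subtractf sum_distrib_left)
  moreover have "potential y = \<alpha> / (2 * CARD('n)) * (\<Sum>h\<in>UNIV. y $ h)\<^sup>2 + (\<Sum>h\<in>UNIV. \<phi> (y $ h))" for y :: "real^'n"
    unfolding potential_def \<phi>_def ..
  ultimately show ?thesis using A by (simp add: s_def s'_def right_diff_distrib)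
qed

text \<open>For u = |w| with w an eigenvector of the Jacobian J to c > 0, the triangle inequality
  and \<alpha> \<ge> 0 give J u \<ge> c u componentwise. As J is symmetric, pairing \<open>u\<close>
  with an ordered difference then shows expansion. This subinvariance stands in for Perron-Frobenius
  and covers \<alpha> = 0, where J is diagonal.\<close>

lemma unstable_zero_expanding:
  fixes z0 :: "real^'n"
  assumes z0: "z0 \<in> cbox 0 1" "drift_field z0 = 0" "z0 \<notin> stable_zeros drift_field"
    and r: "\<And>n. r n \<in> {0..1}"
  obtains \<rho> v \<mu> c where "\<rho> > 0"
    "expanding_urn (rate \<alpha> \<beta> q (f_theta \<theta>)) r {z. \<forall>h. z $ h \<in> {0..1} \<and> \<bar>z $ h - z0 $ h\<bar> \<le> \<rho>} v \<mu> c"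
proof -
  obtain c w where c: "c > 0" and w: "w \<noteq> 0" "linearized_drift \<alpha> \<beta> \<theta> z0 w = c *\<^sub>R w"
    using z0 unfolding stable_zeros_iff by (auto simp: not_le)
  define d where "d = (\<lambda>h. \<kappa> * deriv_f (z0 $ h) - 1)"
  define u where "u = (\<chi> h. \<bar>w $ h\<bar>)"
  have u0: "u $ h \<ge> 0" for h by (simp add: u_def)
  have su: "(\<Sum>h\<in>UNIV. u $ h) > 0"
  proof -
    obtain h where "w $ h \<noteq> 0" using w(1) by (auto simp: vec_eq_iff)
    then show ?thesis using u0 by (intro sum_pos2[of _ h]) (auto simp: u_def)
  qed
  have Ju: "c * u $ h \<le> \<alpha> * comp_mean u + d h * u $ h" for h
  proof -
    have "c * w $ h = \<alpha> * comp_mean w + d h * w $ h"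
      using arg_cong[OF w(2), of "\<lambda>y. y $ h"] by (simp add: linearized_drift_def d_def)
    then have "(c - d h) * w $ h = \<alpha> * comp_mean w" by (simp add: algebra_simps)
    then have "\<bar>c - d h\<bar> * \<bar>w $ h\<bar> = \<bar>\<alpha> * comp_mean w\<bar>" by (metis abs_mult)
    moreover have "\<bar>comp_mean w\<bar> \<le> comp_mean u"
      unfolding comp_mean_def u_def by (simp add: abs_mult divide_right_mono sum_abs)
    then have "\<bar>\<alpha> * comp_mean w\<bar> \<le> \<alpha> * comp_mean u"
      using alpha_nonneg by (simp add: abs_mult mult_left_mono)
    moreover have "(c - d h) * u $ h \<le> \<bar>c - d h\<bar> * \<bar>w $ h\<bar>" unfolding u_def by (simp add: mult_right_mono)
    ultimately show ?thesis by (simp add: algebra_simps)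
  qed
  \<comment> \<open>Half of \<open>c\<close> is given up to absorb the variation of the slopes near
    \<open>z0\<close>.\<close>
  define \<mu> where "\<mu> = c / 2"
  have \<mu>: "\<mu> > 0" using c by (simp add: \<mu>_def)
  obtain \<rho> where \<rho>: "\<rho> > 0" "\<And>h x. \<bar>x - z0 $ h\<bar> \<le> \<rho> \<Longrightarrow> \<kappa> * deriv_f x - 1 \<ge> d h - \<mu>"
  proof -
    have "\<exists>\<rho>>0. \<forall>x. \<bar>x - z0 $ h\<bar> \<le> \<rho> \<longrightarrow> \<kappa> * deriv_f x - 1 \<ge> d h - \<mu>" for h
    proof -
      have "isCont (\<lambda>x. \<kappa> * deriv_f x - 1) (z0 $ h)" by (intro continuous_intros)
      then obtain e where e: "e > 0" "\<And>x. dist x (z0 $ h) < e \<Longrightarrow> dist (\<kappa> * deriv_f x - 1) (d h) < \<mu>"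
        using \<mu> unfolding continuous_at_eps_delta d_def by blast
      show ?thesis
      proof (intro exI[of _ "e / 2"] conjI allI impI)
        fix x assume "\<bar>x - z0 $ h\<bar> \<le> e / 2"
        then have "dist (\<kappa> * deriv_f x - 1) (d h) < \<mu>" using e(1) by (intro e(2)) (simp add: dist_real_def)
        then show "\<kappa> * deriv_f x - 1 \<ge> d h - \<mu>" unfolding dist_real_def by linarith
      qed (use e in simp)
    qed
    then obtain R where R: "\<And>h. R h > 0" "\<And>h x. \<bar>x - z0 $ h\<bar> \<le> R h \<Longrightarrow> \<kappa> * deriv_f x - 1 \<ge> d h - \<mu>"
      by metis
    show thesis
    proof (rule that[of "Min (range R)"])
      show "Min (range R) > 0" using R(1) by (subst Min_gr_iff) auto
      show "\<kappa> * deriv_f x - 1 \<ge> d h - \<mu>" if "\<bar>x - z0 $ h\<bar> \<le> Min (range R)" for x h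
        using that by (intro R(2) order_trans[OF that] Min_le) auto
    qed
  qed
  define U where "U = {z. \<forall>h. z $ h \<in> {0..1} \<and> \<bar>z $ h - z0 $ h\<bar> \<le> \<rho>}"
  define v where "v = (\<lambda>h. u $ h / (\<Sum>h\<in>UNIV. u $ h))"
  let ?p = "rate \<alpha> \<beta> q (f_theta \<theta>)"
  have growth: "\<kappa> * (f_theta \<theta> y - f_theta \<theta> x) \<ge> (d h + 1 - \<mu>) * (y - x)"
    if "x \<le> y" "\<bar>x - z0 $ h\<bar> \<le> \<rho>" "\<bar>y - z0 $ h\<bar> \<le> \<rho>" for x y h
  proof (cases "x = y")
    case False
    then have "x < y" using that by simp
    then obtain \<xi> where \<xi>: "x < \<xi>" "\<xi> < y" "f_theta \<theta> y - f_theta \<theta> x = (y - x) * deriv_f \<xi>"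
      using MVT2[OF _ f_theta_has_derivative, of x y \<theta>] by blast
    then have "\<kappa> * deriv_f \<xi> - 1 \<ge> d h - \<mu>" using that by (intro \<rho>(2)) auto
    then have "(d h + 1 - \<mu>) * (y - x) \<le> (\<kappa> * deriv_f \<xi>) * (y - x)"
      using \<open>x < y\<close> by (intro mult_right_mono) auto
    then show ?thesis unfolding \<xi>(3) by (simp only: mult_ac)
  qed simp
  have mono: "f_theta \<theta> x \<le> f_theta \<theta> y" if "x \<le> y" "x \<in> {0..1}" "y \<in> {0..1}" for x y
  proof (rule DERIV_nonneg_imp_nondecreasing[OF that(1)])
    fix t assume "x \<le> t" "t \<le> y"
    then show "\<exists>y. (f_theta \<theta> has_real_derivative y) (at t) \<and> 0 \<le> y"
      using that theta by (intro exI[of _ "deriv_f t"] conjI f_theta_has_derivative mult_nonneg_nonneg) auto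
  qed
  have expand: "(\<Sum>h\<in>UNIV. u $ h * (?p z' h - ?p z h)) \<ge> (1 + \<mu>) * (\<Sum>h\<in>UNIV. u $ h * (z' $ h - z $ h))"
    if "z \<in> U" "z' \<in> U" "\<And>h. z $ h \<le> z' $ h" for z z' :: "real^'n"
  proof -
    have "(1 + \<mu>) * (\<Sum>h\<in>UNIV. u $ h * (z' $ h - z $ h)) =
        (\<Sum>h\<in>UNIV. (c * u $ h + (1 - \<mu>) * u $ h) * (z' $ h - z $ h))"
      unfolding sum_distrib_left \<mu>_def by (intro sum.cong refl) (simp add: field_simps)
    also have "\<dots> \<le> (\<Sum>h\<in>UNIV. (\<alpha> * comp_mean u + d h * u $ h + (1 - \<mu>) * u $ h) * (z' $ h - z $ h))"
      using that(3) Ju by (intro sum_mono mult_right_mono add_right_mono) auto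
    also have "\<dots> = \<alpha> * comp_mean u * (\<Sum>h\<in>UNIV. z' $ h - z $ h) +
        (\<Sum>h\<in>UNIV. u $ h * ((d h + 1 - \<mu>) * (z' $ h - z $ h)))"
      unfolding sum_distrib_left sum.distrib[symmetric] by (intro sum.cong refl) (simp add: algebra_simps)
    \<comment> \<open>Symmetry of the coupling lets the mean change sides, from \<open>u\<close> to
      the difference.\<close>
    also have "\<alpha> * comp_mean u * (\<Sum>h\<in>UNIV. z' $ h - z $ h) =
        (\<Sum>h\<in>UNIV. u $ h) * (\<alpha> * (comp_mean z' - comp_mean z))"
      by (simp add: comp_mean_def sum_subtractf diff_divide_distrib algebra_simps)
    also have "\<dots> = (\<Sum>h\<in>UNIV. u $ h * (\<alpha> * (comp_mean z' - comp_mean z)))"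
      by (rule sum_distrib_right)
    also have "(\<Sum>h\<in>UNIV. u $ h * (\<alpha> * (comp_mean z' - comp_mean z))) +
        (\<Sum>h\<in>UNIV. u $ h * ((d h + 1 - \<mu>) * (z' $ h - z $ h))) \<le>
        (\<Sum>h\<in>UNIV. u $ h * (\<alpha> * (comp_mean z' - comp_mean z))) +
        (\<Sum>h\<in>UNIV. u $ h * (\<kappa> * (f_theta \<theta> (z' $ h) - f_theta \<theta> (z $ h))))"
      using that by (intro add_left_mono sum_mono mult_left_mono growth u0) (auto simp: U_def)
    also have "\<dots> = (\<Sum>h\<in>UNIV. u $ h * (?p z' h - ?p z h))"
      unfolding sum.distrib[symmetric] by (intro sum.cong refl) (simp add: rate_def right_diff_distrib distrib_left)
    finally show ?thesis .
  qed
  have "expanding_urn ?p r U v \<mu> (\<kappa> * (1 - \<theta>))"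
  proof
    show "\<kappa> * (1 - \<theta>) > 0" by (rule rate_margin_pos)
    show "?p z h \<in> {\<kappa> * (1 - \<theta>)..1 - \<kappa> * (1 - \<theta>)}" if "z \<in> U" for z h
      using that by (intro rate_bounds) (auto simp: U_def)
    show "?p z h \<le> ?p z' h" if "z \<in> U" "z' \<in> U" "\<And>h. z $ h \<le> z' $ h" for z z' h
      unfolding rate_def using that alpha_nonneg beta_nonneg kappa
      by (intro add_mono mult_left_mono mono comp_mean_mono) (auto simp: U_def)
    show "v h \<ge> 0" for h unfolding v_def using u0 su by simp
    show "(\<Sum>h\<in>UNIV. v h) = 1" unfolding v_def using su by (simp flip: sum_divide_distrib)
    show "(\<Sum>h\<in>UNIV. v h * (?p z' h - ?p z h)) \<ge> (1 + \<mu>) * (\<Sum>h\<in>UNIV. v h * (z' $ h - z $ h))"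
      if "z \<in> U" "z' \<in> U" "\<And>h. z $ h \<le> z' $ h" for z z'
      using divide_right_mono[OF expand[OF that] less_imp_le[OF su]]
      unfolding v_def by (simp add: sum_divide_distrib[symmetric])
    show "r n \<in> {0..1}" for n by (rule r)
  qed (auto simp: U_def \<mu>)
  then show thesis using that \<rho>(1) unfolding U_def by blast
qed

end

section \<open>Almost sure convergence\<close>

locale cubic_system = continuous_system M \<alpha> \<beta> q "f_theta \<theta>" r Z I + cubic_params \<alpha> \<beta> q \<theta>
  for M :: "'a measure" and \<alpha> \<beta> q \<theta> :: real and r and Z I :: "nat \<Rightarrow> 'a \<Rightarrow> real^'n"
begin

lemma Z_mem_cbox: "\<omega> \<in> space M \<Longrightarrow> Z n \<omega> \<in> cbox 0 1"
  using Z_range[of \<omega> n] unfolding mem_unit_cbox by blast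

text \<open>A trajectory converging to \<open>z0\<close> would remain in the expanding neighbourhood
  from some time \<open>n\<close> on, and for each of the countably many \<open>n\<close> this event
  is null.\<close>

lemma AE_no_convergence_to_unstable_zero:
  assumes z0: "z0 \<in> cbox 0 1" "drift_field z0 = 0" "z0 \<notin> stable_zeros drift_field"
  shows "AE \<omega> in M. \<not> (\<lambda>n. Z n \<omega>) \<longlonglongrightarrow> z0"
proof -
  obtain \<rho> v \<mu> c where \<rho>: "\<rho> > 0" and
    urn: "expanding_urn p r {z. \<forall>h. z $ h \<in> {0..1} \<and> \<bar>z $ h - z0 $ h\<bar> \<le> \<rho>} v \<mu> c"
    by (rule unstable_zero_expanding[OF z0 r_range])
  define U where "U = {z :: real^'n. \<forall>h. z $ h \<in> {0..1} \<and> \<bar>z $ h - z0 $ h\<bar> \<le> \<rho>}"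
  have "closed U"
    unfolding U_def atLeastAtMost_iff
    by (intro closed_Collect_all closed_Collect_conj closed_Collect_le continuous_intros)
  then have "AE \<omega> in M. \<not> (\<forall>l\<ge>n. Z l \<omega> \<in> U)" for n
    by (rule AE_leaves_expanding_region[OF _ urn[folded U_def]])
  then have "AE \<omega> in M. \<forall>n. \<not> (\<forall>l\<ge>n. Z l \<omega> \<in> U)"
    unfolding AE_all_countable by blast
  then show ?thesis
    using AE_space
  proof eventually_elim
    case (elim \<omega>)
    show ?case
    proof
      assume "(\<lambda>n. Z n \<omega>) \<longlonglongrightarrow> z0"
      then obtain n where n: "\<And>l. l \<ge> n \<Longrightarrow> norm (Z l \<omega> - z0) < \<rho>" using LIMSEQ_D \<rho> by blast
      have "Z l \<omega> \<in> U" if "l \<ge> n" for l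
        unfolding U_def
      proof (safe, goal_cases)
        case (1 h)
        show ?case using Z_range elim by blast
      next
        case (2 h)
        have "\<bar>(Z l \<omega> - z0) $ h\<bar> \<le> norm (Z l \<omega> - z0)" by (rule component_le_norm_cart)
        then show ?case using n[OF that] by simp
      qed
      then show False using elim by blast
    qed
  qed
qed

text \<open>Finiteness of the zeros serves twice: it forces convergence, and it lets the null events
  of the unstable zeros be united.\<close>

lemma AE_converges_to_stable_zero:
  "AE \<omega> in M. \<exists>\<xi>\<in>stable_zeros drift_field. (\<lambda>n. Z n \<omega>) \<longlonglongrightarrow> \<xi>"
proof -
  let ?S = "{z :: real^'n. z \<in> cbox 0 1 \<and> drift_field z = 0}"
  have S: "finite ?S" by (rule finite_subset[OF _ finite_zeros]) auto
  have "AE \<omega> in M. \<forall>z0\<in>?S - stable_zeros drift_field. \<not> (\<lambda>n. Z n \<omega>) \<longlonglongrightarrow> z0"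
    using S by (intro AE_finite_allI AE_no_convergence_to_unstable_zero) auto
  moreover have "AE \<omega> in M. summable (\<lambda>n. r n * (norm (drift_field (Z n \<omega>)))\<^sup>2)"
  proof -
    have "compact (potential ` cbox (0 :: real^'n) 1)"
      by (intro compact_continuous_image potential_continuous compact_cbox)
    then have "\<exists>B. \<forall>z \<in> cbox (0 :: real^'n) 1. \<bar>potential z\<bar> \<le> B"
      by (auto dest!: compact_imp_bounded simp: bounded_iff)
    then obtain B where "\<And>z :: real^'n. z \<in> cbox 0 1 \<Longrightarrow> \<bar>potential z\<bar> \<le> B" by blast
    then have "\<bar>potential z\<bar> \<le> B" if "\<And>h. z $ h \<in> {0..1}" for z :: "real^'n"
      using that by (simp add: mem_unit_cbox)
    then show ?thesis
      by (intro AE_summable_drift[where W = potential and K = 8] potential_Taylor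
          borel_measurable_continuous_onI potential_continuous) auto
  qed
  ultimately show ?thesis
    using AE_summable_r_noise AE_space
  proof eventually_elim
    case (elim \<omega>)
    define z where "z = (\<lambda>n. Z n \<omega>)"
    define e where "e = (\<lambda>n. (\<chi> h. noise h n \<omega>) :: real^'n)"
    have step: "z (Suc n) = z n + r n *\<^sub>R (drift_field (z n) + e n)" for n
      unfolding z_def e_def by (rule Z_Suc_noise) (rule elim)
    have "(\<lambda>n. \<Sum>k<n. r k *\<^sub>R e k) \<longlonglongrightarrow> (\<chi> h. \<Sum>k. r k * noise h k \<omega>)"
    proof (rule vec_tendstoI)
      fix h
      have "(\<lambda>n. \<Sum>k<n. r k * noise h k \<omega>) \<longlonglongrightarrow> (\<Sum>k. r k * noise h k \<omega>)"
        using elim by (intro summable_LIMSEQ) blast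
      then show "(\<lambda>n. (\<Sum>k<n. r k *\<^sub>R e k) $ h) \<longlonglongrightarrow> (\<chi> h. \<Sum>k. r k * noise h k \<omega>) $ h"
        by (simp add: e_def)
    qed
    then have noise: "summable (\<lambda>n. r n *\<^sub>R e n)"
      unfolding summable_iff_convergent convergent_def by blast
    have r0: "r \<longlonglongrightarrow> 0"
    proof -
      have "(\<lambda>n. (r n)\<^sup>2) \<longlonglongrightarrow> 0" by (rule summable_LIMSEQ_zero[OF summable_r_squared])
      from tendsto_real_sqrt[OF this] show ?thesis using r_range by simp
    qed
    have "\<exists>\<xi>\<in>?S. z \<longlonglongrightarrow> \<xi>"
    proof (rule converges_if_finitely_many_limit_points[OF compact_cbox])
      show "z n \<in> cbox 0 1" for n unfolding z_def using elim by (intro Z_mem_cbox) simp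
      show "finite ?S" by (rule S)
      show "\<xi> \<in> ?S" if "\<xi> \<in> cbox 0 1" "\<And>\<delta>. \<delta> > 0 \<Longrightarrow> \<exists>\<^sub>F n in sequentially. dist (z n) \<xi> < \<delta>" for \<xi>
      proof -
        have "isCont drift_field \<xi>"
          by (rule has_derivative_continuous[OF drift_has_derivative])
        then have "drift_field \<xi> = 0"
          using limit_points_are_zeros[of z r drift_field e, OF step _ not_summable_if_asymp_inverse[OF r_lim] noise]
            r_range elim that(2) unfolding z_def by auto
        then show ?thesis using that(1) by simp
      qed
      show "(\<lambda>n. z (Suc n) - z n) \<longlonglongrightarrow> 0"
      proof (rule vec_tendstoI)
        fix h
        show "(\<lambda>n. (z (Suc n) - z n) $ h) \<longlonglongrightarrow> 0 $ h"
          unfolding zero_index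
        proof (rule Lim_null_comparison[OF always_eventually r0], rule allI)
          fix n
          have "\<bar>I (Suc n) \<omega> $ h - Z n \<omega> $ h\<bar> \<le> 1"
            using I_range[of \<omega> n h] Z_range[of \<omega> n h] elim by auto
          moreover have "(z (Suc n) - z n) $ h = r n * (I (Suc n) \<omega> $ h - Z n \<omega> $ h)"
            unfolding z_def using elim by (simp add: Z_Suc algebra_simps)
          ultimately show "norm ((z (Suc n) - z n) $ h) \<le> r n"
            using r_range[of n] by (simp add: abs_mult mult_left_le)
        qed
      qed
    qed
    then show ?case using elim(1) unfolding z_def by blast
  qed
qed

text \<open>Each outcome is noise plus a rate. The noise averages out by Kronecker's lemma, and the
  rates tend to their value at \<xi>, which is \<xi> itself at a zero. One null set serves all
  \<xi>.\<close>

lemma AE_mean_converges: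
  "AE \<omega> in M. \<forall>\<xi>. drift_field \<xi> = 0 \<longrightarrow> (\<lambda>n. Z n \<omega>) \<longlonglongrightarrow> \<xi> \<longrightarrow>
     (\<lambda>n. (1 / real n) *\<^sub>R (\<Sum>k=1..n. I k \<omega>)) \<longlonglongrightarrow> \<xi>"
proof -
  have "AE \<omega> in M. \<forall>h. summable (\<lambda>k. 1 / (real k + 1) * noise h k \<omega>)"
    unfolding AE_all_countable by (intro allI AE_summable_noise[where C = 1]) simp
  then show ?thesis
    using AE_space
  proof eventually_elim
    case (elim \<omega>)
    show ?case
    proof (intro allI impI vec_tendstoI)
      fix \<xi> :: "real^'n" and h assume \<xi>: "drift_field \<xi> = 0" "(\<lambda>n. Z n \<omega>) \<longlonglongrightarrow> \<xi>"
      have "summable (\<lambda>k. noise h k \<omega> / (real k + 1))" using elim(1) by simp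
      then have 1: "(\<lambda>n. (\<Sum>k<n. noise h k \<omega>) / real n) \<longlonglongrightarrow> 0" by (rule Kronecker_mean)
      have "isCont (\<lambda>z :: real^'n. p z h) \<xi>"
      proof -
        have "isCont (\<lambda>z :: real^'n. drift_field z $ h + z $ h) \<xi>"
          by (intro continuous_intros has_derivative_continuous[OF drift_has_derivative])
        then show ?thesis by (simp add: drift_nth)
      qed
      then have "(\<lambda>k. p (Z k \<omega>) h) \<longlonglongrightarrow> p \<xi> h" using \<xi>(2) by (rule isCont_tendsto_compose)
      then have "(\<lambda>n. (\<Sum>k<n. p (Z k \<omega>) h) / real n) \<longlonglongrightarrow> p \<xi> h" by (rule Cesaro_mean)
      from tendsto_add[OF 1 this]
      have "(\<lambda>n. (\<Sum>k<n. noise h k \<omega>) / real n + (\<Sum>k<n. p (Z k \<omega>) h) / real n) \<longlonglongrightarrow> p \<xi> h" by simp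
      moreover have "p \<xi> h = \<xi> $ h" using drift_nth[of \<alpha> \<beta> q "f_theta \<theta>" \<xi> h] \<xi>(1) by simp
      moreover have "(\<Sum>k<n. noise h k \<omega>) / real n + (\<Sum>k<n. p (Z k \<omega>) h) / real n =
          ((1 / real n) *\<^sub>R (\<Sum>k=1..n. I k \<omega>)) $ h" for n
      proof -
        have "(\<Sum>k=1..n. I k \<omega> $ h) = (\<Sum>k<n. I (Suc k) \<omega> $ h)"
          by (simp add: sum.atLeast1_atMost_eq)
        then show ?thesis
          by (simp add: noise_def sum_subtractf add_divide_distrib[symmetric])
      qed
      ultimately show "(\<lambda>n. ((1 / real n) *\<^sub>R (\<Sum>k=1..n. I k \<omega>)) $ h) \<longlonglongrightarrow> \<xi> $ h" by simp
    qed
  qed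
qed

lemma ex_limit_random_variable:
  "\<exists>Zinf \<in> borel_measurable M.
      (AE \<omega> in M. (\<lambda>n. Z n \<omega>) \<longlonglongrightarrow> Zinf \<omega> \<and>
         (\<lambda>n. (1 / real n) *\<^sub>R (\<Sum>k=1..n. I k \<omega>)) \<longlonglongrightarrow> Zinf \<omega>) \<and>
      (\<forall>\<omega>\<in>space M. Zinf \<omega> \<in> stable_zeros drift_field)"
proof -
  let ?SZ = "stable_zeros drift_field :: (real^'n) set"
  obtain s0 where s0: "s0 \<in> ?SZ"
  proof -
    have "\<exists>\<omega>. \<exists>\<xi>\<in>?SZ. (\<lambda>n. Z n \<omega>) \<longlonglongrightarrow> \<xi>"
    proof (rule ccontr)
      assume "\<not> ?thesis"
      then have "AE \<omega> in M. False" using AE_converges_to_stable_zero by simp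
      then show False using prob_space by (simp add: AE_False measure_def)
    qed
    then show thesis using that by blast
  qed
  \<comment> \<open>Off the almost sure event the value falls back to the stable zero
    \<open>s0\<close> unless \<open>lim\<close> is itself stable, so membership holds everywhere.
    Such an \<open>s0\<close> exists because an almost sure event is not empty.\<close>
  define Zinf where "Zinf = (\<lambda>\<omega>. if lim (\<lambda>n. Z n \<omega>) \<in> ?SZ then lim (\<lambda>n. Z n \<omega>) else s0)"
  have "finite ?SZ" by (rule finite_subset[OF _ finite_zeros]) (auto simp: stable_zeros_iff)
  then have [measurable]: "?SZ \<in> sets borel" by (intro borel_closed finite_imp_closed)
  have [measurable]: "(\<lambda>\<omega>. lim (\<lambda>n. Z n \<omega>)) \<in> borel_measurable M"
    by (rule borel_measurable_lim_metric) simp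
  have "Zinf \<in> borel_measurable M" unfolding Zinf_def by measurable
  moreover have "AE \<omega> in M. (\<lambda>n. Z n \<omega>) \<longlonglongrightarrow> Zinf \<omega> \<and>
         (\<lambda>n. (1 / real n) *\<^sub>R (\<Sum>k=1..n. I k \<omega>)) \<longlonglongrightarrow> Zinf \<omega>"
    using AE_converges_to_stable_zero AE_mean_converges
  proof eventually_elim
    case (elim \<omega>)
    then obtain \<xi> where \<xi>: "\<xi> \<in> ?SZ" "(\<lambda>n. Z n \<omega>) \<longlonglongrightarrow> \<xi>" by blast
    then have "Zinf \<omega> = \<xi>" unfolding Zinf_def by (simp add: limI)
    moreover have "drift_field \<xi> = 0" using \<xi>(1) unfolding stable_zeros_iff by blast
    ultimately show ?case using elim(2) \<xi>(2) by blast
  qed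
  moreover have "Zinf \<omega> \<in> ?SZ" for \<omega> using s0 by (simp add: Zinf_def)
  ultimately show ?thesis by blast
qed

end

theorem theorem3p18:
  fixes M :: "'a measure"
    and \<alpha> \<beta> q \<theta> :: real
    and r :: "nat \<Rightarrow> real"
    and Z I :: "nat \<Rightarrow> 'a \<Rightarrow> real^'n"
  assumes "reinforced_system M \<alpha> \<beta> q (f_theta \<theta>) r Z I"
    and "\<theta> \<in> {1/2<..<1}"
    and "1 / (1 - \<alpha> - \<beta>) < 3 * \<theta> - 3 / 2"
  defines "SZ \<equiv> stable_zeros (drift \<alpha> \<beta> q (f_theta \<theta>) :: real^'n \<Rightarrow> real^'n)"
  shows "(\<exists>Zinf \<in> borel_measurable M.
            (AE \<omega> in M. (\<lambda>n. Z n \<omega>) \<longlonglongrightarrow> Zinf \<omega> \<and>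
               (\<lambda>n. (1 / real n) *\<^sub>R (\<Sum>k=1..n. I k \<omega>)) \<longlonglongrightarrow> Zinf \<omega>) \<and>
            (\<forall>\<omega>\<in>space M. Zinf \<omega> \<in> SZ)) \<and>
         SZ \<subseteq> box 0 1 \<and>
         finite {z \<in> SZ. \<exists>x. z = x *\<^sub>R 1} \<and> card {z \<in> SZ. \<exists>x. z = x *\<^sub>R 1} \<le> 2 \<and>
         (\<exists>x\<^sub>1 x\<^sub>2. x\<^sub>1 \<in> {0<..<1/2} \<and> x\<^sub>2 \<in> {1/2<..<1} \<and> x\<^sub>2 = 1 - x\<^sub>1 \<and>
            {x \<in> {0..1}. deriv (f_theta \<theta>) x = 1 / (1 - \<alpha> - \<beta>)} = {x\<^sub>1, x\<^sub>2} \<and>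
            (\<forall>z\<in>SZ. (\<nexists>x. z = x *\<^sub>R 1) \<longrightarrow>
               (\<exists>e N\<^sub>1 z\<^sub>1 z\<^sub>2. bij_betw e {1..CARD('n)} UNIV \<and> N\<^sub>1 \<in> {1..CARD('n) - 1} \<and>
                  (z\<^sub>1 \<in> {0<..<x\<^sub>1} \<or> \<alpha> = 0 \<and> z\<^sub>1 = x\<^sub>1) \<and>
                  (z\<^sub>2 \<in> {x\<^sub>2<..<1} \<or> \<alpha> = 0 \<and> z\<^sub>2 = x\<^sub>2) \<and>
                  (\<forall>h\<in>{1..CARD('n)}. z $ e h = (if h \<le> N\<^sub>1 then z\<^sub>1 else z\<^sub>2)))))"
proof -
  interpret reinforced_system M \<alpha> \<beta> q "f_theta \<theta>" r Z I by (rule assms(1))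
  interpret cubic_system M \<alpha> \<beta> q \<theta> r Z I
    using alpha beta alpha_beta q assms(2,3) f_theta_continuous by unfold_locales auto
  have "SZ \<subseteq> box 0 1" unfolding SZ_def using zero_in_box stable_zeros_iff by blast
  moreover have "\<exists>x\<^sub>1 x\<^sub>2. x\<^sub>1 \<in> {0<..<1/2} \<and> x\<^sub>2 \<in> {1/2<..<1} \<and> x\<^sub>2 = 1 - x\<^sub>1 \<and>
            {x \<in> {0..1}. deriv (f_theta \<theta>) x = 1 / (1 - \<alpha> - \<beta>)} = {x\<^sub>1, x\<^sub>2} \<and>
            (\<forall>z\<in>SZ. (\<nexists>x. z = x *\<^sub>R 1) \<longrightarrow>
               (\<exists>e N\<^sub>1 z\<^sub>1 z\<^sub>2. bij_betw e {1..CARD('n)} UNIV \<and> N\<^sub>1 \<in> {1..CARD('n) - 1} \<and>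
                  (z\<^sub>1 \<in> {0<..<x\<^sub>1} \<or> \<alpha> = 0 \<and> z\<^sub>1 = x\<^sub>1) \<and>
                  (z\<^sub>2 \<in> {x\<^sub>2<..<1} \<or> \<alpha> = 0 \<and> z\<^sub>2 = x\<^sub>2) \<and>
                  (\<forall>h\<in>{1..CARD('n)}. z $ e h = (if h \<le> N\<^sub>1 then z\<^sub>1 else z\<^sub>2))))"
    unfolding SZ_def
    by (rule exI[of _ x1], rule exI[of _ x2],
        intro conjI x1_bounds critical_points ballI impI nonconstant_stable_zero) (simp add: x2_def)
  ultimately show ?thesis
    using ex_limit_random_variable constant_stable_zeros unfolding SZ_def by blast
qed

end
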